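(* Let $p\ge 3$ and let $\mathbf X_1,\dots,\mathbf X_n$ be iid random vectors in $\mathbb R^p$ with distribution $F$. Let $h:\mathbb R^p\times\mathbb R^p\to\mathbb R^{p\times p}$ be a measurable kernel which is symmetric ($h(\mathbf x_1,\mathbf x_2)=h(\mathbf x_2,\mathbf x_1)$), takes values in symmetric matrices, and satisfies $\mathbb E\|h(\mathbf X,\mathbf X')\|<\infty$. Let $U=\binom n2^{-1}\sum_{1\le i<j\le n}h(\mathbf X_i,\mathbf X_j)$ be non-degenerate. Let $B_n\ge 1$. Assume there exist constants $C_1,C_2\in(0,\infty)$ and $K\in(0,1)$ such that: (GA.1) for all $1\le m,k\le p$, $\mathbb E g_{mk}^2\ge C_1$ and $$\max_{\ell=0,1,2}\mathbb E\big(|h_{mk}|^{2+\ell}/B_n^{\ell}\big)\vee \mathbb E\big[\exp(|h_{mk}|/B_n)\big]\le 2;$$ (GA.2) $B_n^2\log^7(pn)/n\le C_2 n^{-K}$. Then there exists a constant $C>0$ depending only on $C_1,C_2$ such that $$\rho(\bar T_0,\bar Z_0):=\sup_{t\in\mathbb R}\big|\mathbb P(\bar T_0\le t)-\mathbb P(\bar Z_0\le t)\big|\le C n^{-K/8}.$$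
   Context: For a matrix $A$, $\|A\|=\max_{m,k}|A_{mk}|$. $\mathbf X,\mathbf X'$ denote independent random vectors with distribution $F$, independent of the sample. $\mathbb E h=\mathbb E[h(\mathbf X,\mathbf X')]$, $h_{mk}=h_{mk}(\mathbf X,\mathbf X')$; $g(\mathbf x)=\mathbb E[h(\mathbf x,\mathbf X')]-\mathbb E h$ and $g_{mk}=g_{mk}(\mathbf X)$. "Non-degenerate" means $\mathrm{Var}(g_{mk}(\mathbf X))>0$ for all $m,k$. $T=\sqrt n(U-\mathbb EU)/2$ and $\bar T_0=\max_{1\le m,k\le p}T_{mk}$. With $p'=p(p+1)/2$, $\Gamma_g$ is the $p'\times p'$ covariance matrix of $\mathrm{vech}(g(\mathbf X))$ (the vector of lower-triangular entries $g_{jk}$, $j\ge k$); $Z_1,\dots,Z_n$ are iid $N(\mathbf 0,\Gamma_g)$, each identified with a symmetric $p\times p$ matrix, and $\bar Z_0=\max_{1\le m,k\le p} n^{-1/2}\sum_{i=1}^n Z_{i,mk}$. *)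

theory Defs
  imports "HOL-Probability.Probability"
begin

text \<open>Vectors in R^p are extensional functions on {..<p}; p x p matrices are
  functions nat => nat => real read on indices m,k < p (0-based).\<close>

definition Rp :: "nat \<Rightarrow> (nat \<Rightarrow> real) measure" where
  "Rp p = PiM {..<p} (\<lambda>_. (borel :: real measure))"

definition maxnorm :: "nat \<Rightarrow> (nat \<Rightarrow> nat \<Rightarrow> real) \<Rightarrow> real" where
  "maxnorm p A = Max {\<bar>A m k\<bar> | m k. m < p \<and> k < p}"

definition Eh :: "(nat \<Rightarrow> real) measure \<Rightarrow> ((nat \<Rightarrow> real) \<Rightarrow> (nat \<Rightarrow> real) \<Rightarrow> nat \<Rightarrow> nat \<Rightarrow> real)
    \<Rightarrow> nat \<Rightarrow> nat \<Rightarrow> real" where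
  "Eh F h m k = integral\<^sup>L (pair_measure F F) (\<lambda>z. h (fst z) (snd z) m k)"

definition gfun :: "(nat \<Rightarrow> real) measure \<Rightarrow> ((nat \<Rightarrow> real) \<Rightarrow> (nat \<Rightarrow> real) \<Rightarrow> nat \<Rightarrow> nat \<Rightarrow> real)
    \<Rightarrow> (nat \<Rightarrow> real) \<Rightarrow> nat \<Rightarrow> nat \<Rightarrow> real" where
  "gfun F h x m k = integral\<^sup>L F (\<lambda>y. h x y m k) - Eh F h m k"

text \<open>Index set of vech: lower-triangular pairs (j,k), j >= k.\<close>
definition vI :: "nat \<Rightarrow> (nat \<times> nat) set" where
  "vI p = {(j, k). k \<le> j \<and> j < p}"

definition Gamma_g :: "(nat \<Rightarrow> real) measure \<Rightarrow> ((nat \<Rightarrow> real) \<Rightarrow> (nat \<Rightarrow> real) \<Rightarrow> nat \<Rightarrow> nat \<Rightarrow> real)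
    \<Rightarrow> nat \<times> nat \<Rightarrow> nat \<times> nat \<Rightarrow> real" where
  "Gamma_g F h a b = integral\<^sup>L F (\<lambda>x. gfun F h x (fst a) (snd a) * gfun F h x (fst b) (snd b))
     - integral\<^sup>L F (\<lambda>x. gfun F h x (fst a) (snd a)) * integral\<^sup>L F (\<lambda>x. gfun F h x (fst b) (snd b))"

definition centered_gaussian :: "'i set \<Rightarrow> ('i \<Rightarrow> 'i \<Rightarrow> real) \<Rightarrow> ('i \<Rightarrow> real) measure \<Rightarrow> bool" where
  "centered_gaussian I \<Gamma> G \<longleftrightarrow> prob_space G \<and> sets G = sets (PiM I (\<lambda>_. (borel :: real measure))) \<and>
     (\<forall>a :: 'i \<Rightarrow> real.
        (let v = (\<Sum>i\<in>I. \<Sum>j\<in>I. a i * a j * \<Gamma> i j) in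
          (v = 0 \<and> distr G borel (\<lambda>w. \<Sum>i\<in>I. a i * w i) = return borel 0) \<or>
          (v > 0 \<and> distr G borel (\<lambda>w. \<Sum>i\<in>I. a i * w i) = density lborel (normal_density 0 (sqrt v)))))"

definition sample :: "nat \<Rightarrow> 'a measure \<Rightarrow> (nat \<Rightarrow> 'a) measure" where
  "sample n M = PiM {..<n} (\<lambda>_. M)"

definition Ustat :: "nat \<Rightarrow> ((nat \<Rightarrow> real) \<Rightarrow> (nat \<Rightarrow> real) \<Rightarrow> nat \<Rightarrow> nat \<Rightarrow> real)
    \<Rightarrow> (nat \<Rightarrow> nat \<Rightarrow> real) \<Rightarrow> nat \<Rightarrow> nat \<Rightarrow> real" where
  "Ustat n h \<omega> m k = (\<Sum>i<n. \<Sum>j\<in>{i<..<n}. h (\<omega> i) (\<omega> j) m k) / real (n choose 2)"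

definition Tbar0 :: "nat \<Rightarrow> nat \<Rightarrow> (nat \<Rightarrow> real) measure
    \<Rightarrow> ((nat \<Rightarrow> real) \<Rightarrow> (nat \<Rightarrow> real) \<Rightarrow> nat \<Rightarrow> nat \<Rightarrow> real) \<Rightarrow> (nat \<Rightarrow> nat \<Rightarrow> real) \<Rightarrow> real" where
  "Tbar0 p n F h \<omega> = Max {sqrt (real n) *
      (Ustat n h \<omega> m k - integral\<^sup>L (sample n F) (\<lambda>\<omega>'. Ustat n h \<omega>' m k)) / 2 | m k. m < p \<and> k < p}"

text \<open>bar Z_0 = max_{m,k} n^{-1/2} sum_i Z_{i,mk}, Z_i identified with a symmetric matrix
  via its lower-triangular entries.\<close>
definition Zbar0 :: "nat \<Rightarrow> nat \<Rightarrow> (nat \<Rightarrow> nat \<times> nat \<Rightarrow> real) \<Rightarrow> real" where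
  "Zbar0 p n \<zeta> = Max {(\<Sum>i<n. \<zeta> i (max m k, min m k)) / sqrt (real n) | m k. m < p \<and> k < p}"

definition kol_dist :: "'a measure \<Rightarrow> ('a \<Rightarrow> real) \<Rightarrow> 'b measure \<Rightarrow> ('b \<Rightarrow> real) \<Rightarrow> real" where
  "kol_dist P X Q Y = (SUP t::real. \<bar>measure P {\<omega> \<in> space P. X \<omega> \<le> t} - measure Q {\<omega> \<in> space Q. Y \<omega> \<le> t}\<bar>)"

end

theory Submission
  imports Defs
begin

text \<open>
  The maximum is smoothed by \<open>ln (\<Sum> exp (\<beta> s\<^sub>j)) / \<beta>\<close> and the indicator of a half-line by a spline, and
  the Hajek projection of the U-statistic is compared with the Gaussian sum by Lindeberg's replacement
  argument. Along a line, the derivatives of the soft maximum are cumulants of the increment under the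
  Gibbs weights, so the third derivative is controlled by a single weighted third moment; a shift
  of size \<open>Y\<close> changes the weights by a factor at most \<open>exp (2 \<beta> Y)\<close>. Hence each replacement error is
  uniform in the base point and only involves third moments of single coordinates, which are of order \<open>B\<close>.

  Anti-concentration of the Gaussian maximum needs no density estimate. If \<open>\<chi> \<ge> \<chi>' / \<beta> \<ge> 0\<close>, then by
  convexity of the soft maximum \<open>f\<close> the second-order operator applied to \<open>\<Phi>(f)\<close>, with \<open>\<Phi>' = \<chi>\<close>, is at least
  \<open>C1 \<chi>'(f)\<close>, and by Stein's identity its expectation equals that of \<open>\<chi>(f)\<close> times the weighted mean of the
  coordinates. Taking \<open>\<chi>'\<close> to be a bump bounds the probability of a window by its width times the
  expected maximum. Stein's identity is only used approximately, for a sum of \<open>n + 1\<close> iid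
  vectors with one left out.

  The degenerate part of the U-statistic is a martingale in the sample size; applying an even moment
  inequality twice bounds its moments of order \<open>ln (p n)\<close>.

  With \<open>x\<^sup>2 = ln (p n)\<close> and \<open>u\<^sup>8 = B\<^sup>2 ln (p n)^7 / n\<close> the choice \<open>\<beta> = x\<^sup>3 / u\<close> and smoothing width \<open>u / x\<close> makes
  all error terms of order \<open>u\<close>.
\<close>

text \<open>The obstacle is that \<open>card J\<close> may be exponential in a power of n, so it may
  enter only through its logarithm. Gibbs weights achieve this: they are nonnegative and sum to 1,
  so each replacement error is a convex combination of one-coordinate moments. The price is the
  factor \<open>exp (2 * \<beta> * Y)\<close>, which is harmless only if \<beta> B / sqrt n is
  small; with the choices above it is u^3 / x^4. The eighth power in u comes from a balance. After
  scaling by 1 / sqrt n, the dominant replacement error is \<beta>^2 / (width) times B / sqrt n,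
  that is x^7 / u^3 times B / sqrt n, and it equals u exactly when B / sqrt n = u^4 / x^7. The bias
  ln (card J) / \<beta> of the soft maximum and the smoothing width are both of order u / x, and
  anti-concentration multiplies them by the size x of the Gaussian maximum. The covariance matrix
  may be singular, since only its diagonal is bounded below. Hence the convexity argument asks for
  lower bounds on variances alone.\<close>

abbreviation iid :: "'i set \<Rightarrow> 'a measure \<Rightarrow> ('i \<Rightarrow> 'a) measure" where
  "iid I P \<equiv> PiM I (\<lambda>_. P)"

section \<open>The soft maximum along a line\<close>

locale softmax =
  fixes J :: "'j set" and \<beta> :: real
  assumes finite_J: "finite J" and J_ne: "J \<noteq> {}" and beta_pos: "\<beta> > 0"
begin

definition expsum :: "('j \<Rightarrow> real) \<Rightarrow> real" where
  "expsum s = (\<Sum>j\<in>J. exp (\<beta> * s j))"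

definition weight :: "('j \<Rightarrow> real) \<Rightarrow> 'j \<Rightarrow> real" where
  "weight s j = exp (\<beta> * s j) / expsum s"

definition lse :: "('j \<Rightarrow> real) \<Rightarrow> real" where
  "lse s = ln (expsum s) / \<beta>"

text \<open>Moments of the direction \<open>y\<close> under the Gibbs measure at \<open>s\<close>.
  Raw moments rather than cumulants are kept because they form a closed system under differentiation
  along \<open>y\<close>.\<close>

definition mom :: "nat \<Rightarrow> ('j \<Rightarrow> real) \<Rightarrow> ('j \<Rightarrow> real) \<Rightarrow> real" where
  "mom k s y = (\<Sum>j\<in>J. weight s j * y j ^ k)"

definition absmom3 :: "('j \<Rightarrow> real) \<Rightarrow> ('j \<Rightarrow> real) \<Rightarrow> real" where
  "absmom3 s y = (\<Sum>j\<in>J. weight s j * \<bar>y j\<bar> ^ 3)"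

lemma expsum_pos: "expsum s > 0"
  unfolding expsum_def using finite_J J_ne by (intro sum_pos) auto

lemma weight_nonneg: "weight s j \<ge> 0"
  unfolding weight_def using expsum_pos[of s] by simp

lemma sum_weight: "(\<Sum>j\<in>J. weight s j) = 1"
  unfolding weight_def sum_divide_distrib[symmetric] using expsum_pos[of s]
  by (simp add: expsum_def)

lemma le_lse: "j \<in> J \<Longrightarrow> s j \<le> lse s"
proof -
  assume j: "j \<in> J"
  have "exp (\<beta> * s j) \<le> expsum s"
    unfolding expsum_def using finite_J j by (intro member_le_sum) auto
  then have "\<beta> * s j \<le> ln (expsum s)"
    using expsum_pos[of s] by (simp add: ln_ge_iff)
  then show ?thesis unfolding lse_def using beta_pos by (simp add: field_simps)
qed

lemma lse_le:
  assumes "\<And>j. j \<in> J \<Longrightarrow> s j \<le> t"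
  shows "lse s \<le> t + ln (card J) / \<beta>"
proof -
  have "expsum s \<le> (\<Sum>j\<in>J. exp (\<beta> * t))"
    unfolding expsum_def using assms beta_pos by (intro sum_mono) auto
  also have "\<dots> = card J * exp (\<beta> * t)" by simp
  finally have "ln (expsum s) \<le> ln (card J * exp (\<beta> * t))"
    using expsum_pos[of s] by (subst ln_le_cancel_iff) auto
  also have "\<dots> = ln (card J) + \<beta> * t"
    using finite_J J_ne by (simp add: ln_mult card_gt_0_iff)
  finally show ?thesis unfolding lse_def using beta_pos by (simp add: field_simps)
qed

lemma expsum_moment_deriv:
  "((\<lambda>\<tau>. \<Sum>j\<in>J. exp (\<beta> * (s j + \<tau> * y j)) * y j ^ k) has_real_derivative
      \<beta> * (\<Sum>j\<in>J. exp (\<beta> * (s j + \<tau> * y j)) * y j ^ Suc k)) (at \<tau>)"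
  unfolding sum_distrib_left
  by (rule derivative_eq_intros refl sum.cong | simp add: mult_ac)+

lemma mom_eq: "mom k s y = (\<Sum>j\<in>J. exp (\<beta> * s j) * y j ^ k) / expsum s"
  unfolding mom_def weight_def by (simp add: sum_divide_distrib)

lemma expsum_deriv:
  "((\<lambda>\<tau>. expsum (\<lambda>j. s j + \<tau> * y j)) has_real_derivative
      \<beta> * (\<Sum>j\<in>J. exp (\<beta> * (s j + \<tau> * y j)) * y j)) (at \<tau>)"
  using expsum_moment_deriv[of s y 0 \<tau>] by (simp add: expsum_def)

text \<open>The normaliser moves as well as the numerator, so the result is \<beta> times a Gibbs
  covariance, that of \<open>y ^ k\<close> and \<open>y\<close>.\<close>

lemma mom_deriv:
  "((\<lambda>\<tau>. mom k (\<lambda>j. s j + \<tau> * y j) y) has_real_derivative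
     \<beta> * (mom (Suc k) (\<lambda>j. s j + \<tau> * y j) y
        - mom k (\<lambda>j. s j + \<tau> * y j) y * mom 1 (\<lambda>j. s j + \<tau> * y j) y)) (at \<tau>)"
proof -
  have *: "expsum (\<lambda>j. s j + \<tau> * y j) \<noteq> 0"
    using expsum_pos less_irrefl by metis
  show ?thesis
    unfolding mom_eq
    apply (rule DERIV_cong[OF DERIV_divide[OF expsum_moment_deriv expsum_deriv *]])
    using * by (simp add: divide_simps) (simp add: algebra_simps power2_eq_square)
qed

lemma lse_deriv:
  "((\<lambda>\<tau>. lse (\<lambda>j. s j + \<tau> * y j)) has_real_derivative
     mom 1 (\<lambda>j. s j + \<tau> * y j) y) (at \<tau>)"
  unfolding lse_def mom_eq
  apply (rule DERIV_cong[OF DERIV_cdivide[OF DERIV_ln_divide[THEN DERIV_chain2, OF expsum_pos expsum_deriv]]])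
  using beta_pos by simp

text \<open>All moments are taken under one probability measure, so these are power-mean
  inequalities. In place of Hoelder's inequality, nonnegative polynomials centred at the weighted
  mean \<open>c\<close> of the absolute values are expanded.\<close>

lemma absmom3_ge:
  shows "\<bar>mom 1 s y\<bar> ^ 3 \<le> absmom3 s y"
    and "\<bar>mom 1 s y\<bar> * mom 2 s y \<le> absmom3 s y"
    and "\<bar>mom 3 s y\<bar> \<le> absmom3 s y"
    and mom2_ge: "(mom 1 s y)\<^sup>2 \<le> mom 2 s y"
proof -
  define c where "c = (\<Sum>j\<in>J. weight s j * \<bar>y j\<bar>)"
  have c0: "c \<ge> 0" unfolding c_def by (intro sum_nonneg) (simp add: weight_nonneg)
  have m1: "\<bar>mom 1 s y\<bar> \<le> c"
    unfolding mom_def c_def by (rule sum_abs[THEN order_trans]) (simp add: abs_mult weight_nonneg)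
  have *: "0 \<le> (\<Sum>j\<in>J. weight s j * ((\<bar>y j\<bar> - c)\<^sup>2 * (\<bar>y j\<bar> + d)))" if "d \<ge> 0" for d
    by (intro sum_nonneg mult_nonneg_nonneg weight_nonneg) (auto simp: that)
  have e: "(\<bar>z\<bar> - c)\<^sup>2 * (\<bar>z\<bar> + d) = \<bar>z\<bar>^3 - (2*c - d) * z^2 + (c^2-2*c*d) * \<bar>z\<bar> + c^2*d" for z d :: real
    by (simp add: power2_eq_square power3_eq_cube algebra_simps)
  have **: "(\<Sum>j\<in>J. weight s j * ((\<bar>y j\<bar> - c)\<^sup>2 * (\<bar>y j\<bar> + d))) =
     absmom3 s y - (2*c-d) * mom 2 s y + (c^2-2*c*d) * c + c^2*d" for d
  proof -
    have "(\<Sum>j\<in>J. weight s j * ((\<bar>y j\<bar> - c)\<^sup>2 * (\<bar>y j\<bar> + d))) =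
      (\<Sum>j\<in>J. weight s j * \<bar>y j\<bar>^3 - (2*c - d) * (weight s j * y j^2) + (c^2-2*c*d) * (weight s j * \<bar>y j\<bar>) + c^2*d * weight s j)"
      by (intro sum.cong refl, subst e) (simp add: algebra_simps)
    also have "\<dots> = absmom3 s y - (2*c-d) * mom 2 s y + (c^2-2*c*d) * c + c^2*d * (\<Sum>j\<in>J. weight s j)"
      unfolding absmom3_def mom_def c_def[symmetric]
      by (simp add: sum.distrib sum_subtractf sum_distrib_left[symmetric] c_def[symmetric])
    finally show ?thesis by (simp add: sum_weight)
  qed
  have m2: "mom 2 s y \<ge> 0" unfolding mom_def by (intro sum_nonneg) (simp add: weight_nonneg)
  \<comment> \<open>With \<open>d = c\<close> the linear and constant terms cancel after averaging,
    leaving only the third and second moments.\<close>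
  have A: "c * mom 2 s y \<le> absmom3 s y"
    using *[OF c0] **[of c] by (simp add: power2_eq_square algebra_simps)
  have B: "c\<^sup>2 \<le> mom 2 s y"
  proof -
    have "0 \<le> (\<Sum>j\<in>J. weight s j * (\<bar>y j\<bar> - c)\<^sup>2)"
      by (intro sum_nonneg mult_nonneg_nonneg weight_nonneg) auto
    also have "\<dots> = (\<Sum>j\<in>J. weight s j * y j ^ 2 - 2*c*(weight s j * \<bar>y j\<bar>) + c^2 * weight s j)"
      by (intro sum.cong refl) (simp add: power2_eq_square algebra_simps)
    also have "\<dots> = mom 2 s y - 2*c*c + c^2 * (\<Sum>j\<in>J. weight s j)"
      unfolding mom_def
      by (simp add: sum.distrib sum_subtractf sum_distrib_left[symmetric] c_def[symmetric])
    finally show ?thesis by (simp add: sum_weight power2_eq_square)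
  qed
  show "\<bar>mom 1 s y\<bar> * mom 2 s y \<le> absmom3 s y"
    using mult_right_mono[OF m1 m2] A by simp
  have "\<bar>mom 1 s y\<bar> ^ 3 \<le> c ^ 3" using m1 by (intro power_mono) auto
  also have "\<dots> \<le> absmom3 s y"
    using mult_left_mono[OF B c0] A by (simp add: power3_eq_cube power2_eq_square)
  finally show "\<bar>mom 1 s y\<bar> ^ 3 \<le> absmom3 s y" .
  show "\<bar>mom 3 s y\<bar> \<le> absmom3 s y"
    unfolding mom_def absmom3_def by (rule sum_abs[THEN order_trans]) (simp add: abs_mult weight_nonneg power_abs)
  have "(mom 1 s y)\<^sup>2 \<le> c\<^sup>2" using m1 c0 by (simp add: abs_le_square_iff[symmetric])
  then show "(mom 1 s y)\<^sup>2 \<le> mom 2 s y" using B by simp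
qed

text \<open>The numerator and the normaliser of a weight each change by at most a factor
  \<open>exp (\<beta> * Y)\<close>. Returning to the weights at the base point \<open>s\<close>
  matters because these do not depend on the random increment, so expectations can be taken
  coordinate by coordinate.\<close>

lemma absmom3_shift:
  assumes Y: "\<And>j. j \<in> J \<Longrightarrow> \<bar>y j\<bar> \<le> Y" and t: "0 \<le> \<tau>" "\<tau> \<le> 1"
  shows "absmom3 (\<lambda>j. s j + \<tau> * y j) y \<le> exp (2 * \<beta> * Y) * absmom3 s y"
proof -
  have ty: "\<bar>\<tau> * y j\<bar> \<le> Y" if "j \<in> J" for j
    using mult_mono[OF t(2) Y[OF that]] t by (simp add: abs_mult)
  have bty: "\<bar>\<beta> * (\<tau> * y j)\<bar> \<le> \<beta> * Y" if "j \<in> J" for j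
    using mult_left_mono[OF ty[OF that], of \<beta>] beta_pos by (simp add: abs_mult)
  have lo: "exp (\<beta> * s j) * exp (-(\<beta> * Y)) \<le> exp (\<beta> * (s j + \<tau> * y j))" if "j \<in> J" for j
    using bty[OF that] unfolding exp_add[symmetric] exp_le_cancel_iff distrib_left by linarith
  have hi: "exp (\<beta> * (s j + \<tau> * y j)) \<le> exp (\<beta> * s j) * exp (\<beta> * Y)" if "j \<in> J" for j
    using bty[OF that] unfolding exp_add[symmetric] exp_le_cancel_iff distrib_left by linarith
  have den: "expsum s * exp (-(\<beta> * Y)) \<le> expsum (\<lambda>j. s j + \<tau> * y j)"
    unfolding expsum_def sum_distrib_right using lo by (intro sum_mono) auto
  have "weight (\<lambda>j. s j + \<tau> * y j) j \<le> exp (2 * \<beta> * Y) * weight s j" if "j \<in> J" for j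
  proof -
    have "weight (\<lambda>j. s j + \<tau> * y j) j \<le> (exp (\<beta> * s j) * exp (\<beta> * Y)) / (expsum s * exp (-(\<beta> * Y)))"
      unfolding weight_def using hi[OF that] den expsum_pos
      by (intro frac_le) (auto simp: less_imp_le)
    also have "\<dots> = exp (2 * \<beta> * Y) * weight s j"
      unfolding weight_def by (simp add: exp_minus field_simps flip: exp_add)
    finally show ?thesis .
  qed
  then show ?thesis
    unfolding absmom3_def sum_distrib_left mult.assoc[symmetric]
    by (intro sum_mono mult_right_mono) auto
qed

section \<open>Derivatives and Taylor expansions of smooth functions of the soft maximum\<close>

definition diff1 :: "(real \<Rightarrow> real) \<Rightarrow> ('j \<Rightarrow> real) \<Rightarrow> ('j \<Rightarrow> real) \<Rightarrow> real" where
  "diff1 g1 s y = g1 (lse s) * mom 1 s y"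

text \<open>For an outer function with successive derivatives \<open>g1\<close>, \<open>g2\<close>,
  \<open>g3\<close>, the three quantities are the derivatives of its composition with
  \<open>lse\<close> along \<open>y\<close>. The outer function itself is left out because the Stein
  argument works with its derivative alone. The factors of \<open>g1 (lse s)\<close> in
  \<open>diff2\<close> and \<open>diff3\<close> are the second and third Gibbs cumulants, scaled by
  \<beta> and its square.\<close>

definition diff2 :: "(real \<Rightarrow> real) \<Rightarrow> (real \<Rightarrow> real) \<Rightarrow> ('j \<Rightarrow> real) \<Rightarrow> ('j \<Rightarrow> real) \<Rightarrow> real" where
  "diff2 g1 g2 s y = g2 (lse s) * (mom 1 s y)\<^sup>2 + g1 (lse s) * \<beta> * (mom 2 s y - (mom 1 s y)\<^sup>2)"

definition diff3 :: "(real \<Rightarrow> real) \<Rightarrow> (real \<Rightarrow> real) \<Rightarrow> (real \<Rightarrow> real) \<Rightarrow> ('j \<Rightarrow> real) \<Rightarrow> ('j \<Rightarrow> real) \<Rightarrow> real" where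
  "diff3 g1 g2 g3 s y = g3 (lse s) * mom 1 s y ^ 3
     + 3 * g2 (lse s) * \<beta> * mom 1 s y * (mom 2 s y - (mom 1 s y)\<^sup>2)
     + g1 (lse s) * \<beta>\<^sup>2 * (mom 3 s y - 3 * mom 1 s y * mom 2 s y + 2 * mom 1 s y ^ 3)"

lemma diff1_deriv:
  assumes "\<And>x. (g1 has_real_derivative g2 x) (at x)"
  shows "((\<lambda>\<tau>. diff1 g1 (\<lambda>j. s j + \<tau> * y j) y) has_real_derivative
     diff2 g1 g2 (\<lambda>j. s j + \<tau> * y j) y) (at \<tau>)"
  unfolding diff1_def diff2_def
  apply (rule DERIV_cong[OF DERIV_mult[OF DERIV_chain2[OF assms lse_deriv] mom_deriv]])
  by (simp add: algebra_simps power2_eq_square numeral_2_eq_2)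

lemma diff2_deriv:
  assumes "\<And>x. (g1 has_real_derivative g2 x) (at x)" "\<And>x. (g2 has_real_derivative g3 x) (at x)"
  shows "((\<lambda>\<tau>. diff2 g1 g2 (\<lambda>j. s j + \<tau> * y j) y) has_real_derivative
     diff3 g1 g2 g3 (\<lambda>j. s j + \<tau> * y j) y) (at \<tau>)"
  unfolding diff2_def diff3_def
  apply (rule DERIV_cong)
   apply (rule DERIV_add DERIV_mult DERIV_power DERIV_diff DERIV_const
      DERIV_chain2[OF assms(1) lse_deriv] DERIV_chain2[OF assms(2) lse_deriv] mom_deriv)+
  by (simp add: algebra_simps power2_eq_square power3_eq_cube numeral_2_eq_2 numeral_3_eq_3)

text \<open>Every product of moments is controlled by \<open>absmom3_ge\<close>: the mean times the
  variance costs 2, taken three times, and the third cumulant costs 1 + 3 + 2. This is the origin of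
  both coefficients 6.\<close>

lemma diff3_bound:
  assumes "\<And>x. \<bar>g1 x\<bar> \<le> c1" "\<And>x. \<bar>g2 x\<bar> \<le> c2" "\<And>x. \<bar>g3 x\<bar> \<le> c3"
  shows "\<bar>diff3 g1 g2 g3 s y\<bar> \<le> (c3 + 6 * \<beta> * c2 + 6 * \<beta>\<^sup>2 * c1) * absmom3 s y"
proof -
  let ?n = "absmom3 s y" and ?a = "mom 1 s y" and ?b = "mom 2 s y" and ?c = "mom 3 s y"
  note h = absmom3_ge[of s y]
  have b0: "?b \<ge> 0" using h(4) zero_le_power2 order_trans by blast
  have h1: "\<bar>?a ^ 3\<bar> \<le> ?n" using h(1) by (simp add: power_abs)
  have h2: "\<bar>?a * ?b\<bar> \<le> ?n" using h(2) b0 by (simp add: abs_mult)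
  have "\<bar>?a * (?b - ?a\<^sup>2)\<bar> \<le> 2 * ?n"
  proof -
    have "?a * (?b - ?a\<^sup>2) = ?a * ?b - ?a^3" by (simp add: algebra_simps power2_eq_square power3_eq_cube)
    then show ?thesis using h1 h2 by linarith
  qed
  then have "\<bar>3 * \<beta> * (?a * (?b - ?a\<^sup>2))\<bar> \<le> 3 * \<beta> * (2 * ?n)"
    using beta_pos by (simp add: abs_mult[of "3 * \<beta>"])
  then have t2: "\<bar>g2 (lse s) * (3 * \<beta> * (?a * (?b - ?a\<^sup>2)))\<bar> \<le> c2 * (3 * \<beta> * (2 * ?n))"
    unfolding abs_mult[of "g2 (lse s)"] using assms(2)[of "lse s"]
    by (intro mult_mono) auto
  have "\<bar>?c - 3 * (?a * ?b) + 2 * ?a ^ 3\<bar> \<le> 6 * ?n" using h(3) h1 h2 by linarith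
  then have "\<bar>\<beta>\<^sup>2 * (?c - 3 * (?a * ?b) + 2 * ?a ^ 3)\<bar> \<le> \<beta>\<^sup>2 * (6 * ?n)"
    using beta_pos by (simp add: abs_mult[of "\<beta>\<^sup>2"])
  then have t3: "\<bar>g1 (lse s) * (\<beta>\<^sup>2 * (?c - 3 * (?a * ?b) + 2 * ?a ^ 3))\<bar> \<le> c1 * (\<beta>\<^sup>2 * (6 * ?n))"
    unfolding abs_mult[of "g1 (lse s)"] using assms(1)[of "lse s"]
    by (intro mult_mono) auto
  have t1: "\<bar>g3 (lse s) * ?a ^ 3\<bar> \<le> c3 * ?n"
    unfolding abs_mult[of _ "?a ^ 3"] using h1 assms(3)[of "lse s"] by (intro mult_mono) auto
  have eq: "diff3 g1 g2 g3 s y = g3 (lse s) * ?a ^ 3 + g2 (lse s) * (3 * \<beta> * (?a * (?b - ?a\<^sup>2)))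
     + g1 (lse s) * (\<beta>\<^sup>2 * (?c - 3 * (?a * ?b) + 2 * ?a ^ 3))"
    unfolding diff3_def by (simp add: algebra_simps)
  have "\<bar>diff3 g1 g2 g3 s y\<bar> \<le> c3 * ?n + c2 * (3 * \<beta> * (2 * ?n)) + c1 * (\<beta>\<^sup>2 * (6 * ?n))"
    unfolding eq using t1 t2 t3 by linarith
  then show ?thesis by (simp add: algebra_simps)
qed

context
  fixes g0 g1 g2 g3 :: "real \<Rightarrow> real" and c1 c2 c3 Y :: real and s y :: "'j \<Rightarrow> real"
  assumes d1: "\<And>x. (g1 has_real_derivative g2 x) (at x)" and d2: "\<And>x. (g2 has_real_derivative g3 x) (at x)"
    and b: "\<And>x. \<bar>g1 x\<bar> \<le> c1" "\<And>x. \<bar>g2 x\<bar> \<le> c2" "\<And>x. \<bar>g3 x\<bar> \<le> c3"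
    and Y: "\<And>j. j \<in> J \<Longrightarrow> \<bar>y j\<bar> \<le> Y"
begin

lemma diff3_line_bound:
  assumes "0 \<le> t" "t \<le> 1"
  shows "\<bar>diff3 g1 g2 g3 (\<lambda>j. s j + t * y j) y\<bar> \<le>
     (c3 + 6 * \<beta> * c2 + 6 * \<beta>\<^sup>2 * c1) * (exp (2 * \<beta> * Y) * absmom3 s y)"
proof -
  have "c1 \<ge> 0" "c2 \<ge> 0" "c3 \<ge> 0" using b[of 0] by linarith+
  then have "c3 + 6 * \<beta> * c2 + 6 * \<beta>\<^sup>2 * c1 \<ge> 0" using beta_pos by simp
  moreover have "\<bar>diff3 g1 g2 g3 (\<lambda>j. s j + t * y j) y\<bar> \<le>
     (c3 + 6 * \<beta> * c2 + 6 * \<beta>\<^sup>2 * c1) * absmom3 (\<lambda>j. s j + t * y j) y"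
    by (rule diff3_bound) (rule b)+
  moreover have sh: "absmom3 (\<lambda>j. s j + t * y j) y \<le> exp (2 * \<beta> * Y) * absmom3 s y"
    by (rule absmom3_shift[OF Y assms])
  ultimately show ?thesis using sh by (meson mult_left_mono order_trans)
qed

lemma smooth_taylor:
  assumes d0: "\<And>x. (g0 has_real_derivative g1 x) (at x)"
  shows "\<bar>g0 (lse (\<lambda>j. s j + y j)) - g0 (lse s) - diff1 g1 s y - diff2 g1 g2 s y / 2\<bar>
    \<le> (c3 + 6 * \<beta> * c2 + 6 * \<beta>\<^sup>2 * c1) / 6 * (exp (2 * \<beta> * Y) * absmom3 s y)"
proof -
  let ?s = "\<lambda>t j. s j + t * y j"
  define D where "D = (\<lambda>m::nat. if m = 0 then (\<lambda>t. g0 (lse (?s t))) else if m = 1 then (\<lambda>t. diff1 g1 (?s t) y)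
     else if m = 2 then (\<lambda>t. diff2 g1 g2 (?s t) y) else (\<lambda>t. diff3 g1 g2 g3 (?s t) y))"
  have "\<exists>t::real. 0 < t \<and> t < 1 \<and> D 0 1 = sum (\<lambda>m::nat. (D m 0 / fact m) * 1 ^ m) {..<3} + (D 3 t / fact 3) * 1 ^ 3"
  proof (rule Maclaurin)
    have "(D m has_real_derivative D (Suc m) t) (at t)" if mlt: "m < 3" for m :: nat and t
    proof -
      consider "m = 0" | "m = 1" | "m = 2" using mlt by fastforce
      then show ?thesis
      proof cases
        case 1 then show ?thesis
          using DERIV_chain2[OF d0 lse_deriv, of s y t] by (simp add: D_def diff1_def)
      next
        case 2 then show ?thesis using diff1_deriv[OF d1, of s y t] by (simp add: D_def)
      next
        case 3 then show ?thesis using diff2_deriv[OF d1 d2, of s y t] by (simp add: D_def)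
      qed
    qed
    then show "\<forall>m t. m < 3 \<and> 0 \<le> t \<and> t \<le> 1 \<longrightarrow> (D m has_real_derivative D (Suc m) t) (at t)" by blast
  qed auto
  then obtain t where t: "0 < t" "t < 1"
    "D 0 1 = sum (\<lambda>m::nat. (D m 0 / fact m) * 1 ^ m) {..<3} + (D 3 t / fact 3) * 1 ^ 3" by blast
  have "g0 (lse (\<lambda>j. s j + y j)) = g0 (lse s) + diff1 g1 s y + diff2 g1 g2 s y / 2 + diff3 g1 g2 g3 (?s t) y / 6"
    using t(3) by (simp add: D_def eval_nat_numeral)
  moreover have "\<bar>diff3 g1 g2 g3 (?s t) y\<bar> \<le> 6 * ((c3 + 6 * \<beta> * c2 + 6 * \<beta>\<^sup>2 * c1) / 6 * (exp (2 * \<beta> * Y) * absmom3 s y))"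
    using diff3_line_bound[of t] t(1,2) by simp
  ultimately show ?thesis by linarith
qed

text \<open>The increment is here both displacement and direction: in the Stein argument a summand
  multiplies the gradient taken at a point that already contains that summand.\<close>

lemma diff1_taylor:
  shows "\<bar>diff1 g1 (\<lambda>j. s j + y j) y - diff1 g1 s y - diff2 g1 g2 s y\<bar>
    \<le> (c3 + 6 * \<beta> * c2 + 6 * \<beta>\<^sup>2 * c1) / 2 * (exp (2 * \<beta> * Y) * absmom3 s y)"
proof -
  let ?s = "\<lambda>t j. s j + t * y j"
  define D where "D = (\<lambda>m::nat. if m = 0 then (\<lambda>t. diff1 g1 (?s t) y)
     else if m = 1 then (\<lambda>t. diff2 g1 g2 (?s t) y) else (\<lambda>t. diff3 g1 g2 g3 (?s t) y))"
  have "\<exists>t::real. 0 < t \<and> t < 1 \<and> D 0 1 = sum (\<lambda>m::nat. (D m 0 / fact m) * 1 ^ m) {..<2} + (D 2 t / fact 2) * 1 ^ 2"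
  proof (rule Maclaurin)
    have "(D m has_real_derivative D (Suc m) t) (at t)" if mlt: "m < 2" for m :: nat and t
    proof -
      consider "m = 0" | "m = 1" using mlt by fastforce
      then show ?thesis
      proof cases
        case 1 then show ?thesis using diff1_deriv[OF d1, of s y t] by (simp add: D_def)
      next
        case 2 then show ?thesis using diff2_deriv[OF d1 d2, of s y t] by (simp add: D_def)
      qed
    qed
    then show "\<forall>m t. m < 2 \<and> 0 \<le> t \<and> t \<le> 1 \<longrightarrow> (D m has_real_derivative D (Suc m) t) (at t)" by blast
  qed auto
  then obtain t where t: "0 < t" "t < 1"
    "D 0 1 = sum (\<lambda>m::nat. (D m 0 / fact m) * 1 ^ m) {..<2} + (D 2 t / fact 2) * 1 ^ 2" by blast
  have "diff1 g1 (\<lambda>j. s j + y j) y = diff1 g1 s y + diff2 g1 g2 s y + diff3 g1 g2 g3 (?s t) y / 2"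
    using t(3) by (simp add: D_def eval_nat_numeral)
  moreover have "\<bar>diff3 g1 g2 g3 (?s t) y\<bar> \<le> 2 * ((c3 + 6 * \<beta> * c2 + 6 * \<beta>\<^sup>2 * c1) / 2 * (exp (2 * \<beta> * Y) * absmom3 s y))"
    using diff3_line_bound[of t] t(1,2) by simp
  ultimately show ?thesis by linarith
qed

end

end

section \<open>A smooth step function\<close>

definition trunc_pow :: "nat \<Rightarrow> real \<Rightarrow> real" where
  "trunc_pow k u = (max 0 u) ^ k"

text \<open>Exponents start at 2 because the first truncated power has a kink at 0. At the knot
  itself the difference quotient is dominated by the next lower truncated power, which tends to
  0.\<close>

lemma trunc_pow_deriv:
  "(trunc_pow (Suc (Suc k)) has_real_derivative real (Suc (Suc k)) * trunc_pow (Suc k) u) (at u)"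
proof -
  consider "u < 0" | "u > 0" | "u = 0" by linarith
  then show ?thesis
  proof cases
    case 1
    have "((\<lambda>_. 0) has_real_derivative 0) (at u)" by simp
    then have "(trunc_pow (Suc (Suc k)) has_real_derivative 0) (at u)"
      by (rule DERIV_cong_ev[THEN iffD1, rotated -1])
         (use 1 in \<open>auto simp: trunc_pow_def max_def intro!: eventually_mono[OF eventually_nhds_in_open[of "{..<0}" u]]\<close>)
    then show ?thesis using 1 by (simp add: trunc_pow_def)
  next
    case 2
    have "((\<lambda>u. u ^ Suc (Suc k)) has_real_derivative real (Suc (Suc k)) * u ^ Suc k) (at u)"
      by (rule DERIV_cong[OF DERIV_pow]) simp
    then have "(trunc_pow (Suc (Suc k)) has_real_derivative real (Suc (Suc k)) * u ^ Suc k) (at u)"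
      by (rule DERIV_cong_ev[THEN iffD1, rotated -1])
         (use 2 in \<open>auto simp: trunc_pow_def max_def intro!: eventually_mono[OF eventually_nhds_in_open[of "{0<..}" u]]\<close>)
    then show ?thesis using 2 by (simp add: trunc_pow_def max_def)
  next
    case 3
    have "((\<lambda>h. trunc_pow (Suc k) h) \<longlongrightarrow> trunc_pow (Suc k) 0) (at 0)"
      unfolding trunc_pow_def by (intro tendsto_intros)
    then have lim: "(\<lambda>h. trunc_pow (Suc k) h) \<midarrow>0\<rightarrow> 0" by (simp add: trunc_pow_def)
    have "\<bar>(trunc_pow (Suc (Suc k)) (0 + h) - trunc_pow (Suc (Suc k)) 0) / h\<bar> \<le> trunc_pow (Suc k) h" for h
      by (cases "h \<le> 0") (auto simp: trunc_pow_def max_def)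
    then have "((\<lambda>h. (trunc_pow (Suc (Suc k)) (0 + h) - trunc_pow (Suc (Suc k)) 0) / h) \<longlongrightarrow> 0) (at 0)"
      by (intro Lim_null_comparison[OF _ lim]) (auto intro!: always_eventually)
    then show ?thesis using 3 by (simp add: DERIV_def trunc_pow_def)
  qed
qed

text \<open>Normalised fourth differences: \<open>spline 4\<close> is the integral of the cubic B-spline
  \<open>spline 3\<close> supported on the interval from 0 to 4, hence a smooth step.\<close>
definition spline :: "nat \<Rightarrow> real \<Rightarrow> real" where
  "spline k u = (trunc_pow k u - 4 * trunc_pow k (u - 1) + 6 * trunc_pow k (u - 2)
     - 4 * trunc_pow k (u - 3) + trunc_pow k (u - 4)) / fact k"

lemma spline_deriv: "(spline (Suc (Suc k)) has_real_derivative spline (Suc k) u) (at u)"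
proof -
  have *: "((\<lambda>u. trunc_pow (Suc (Suc k)) (u - c)) has_real_derivative
     real (Suc (Suc k)) * trunc_pow (Suc k) (u - c)) (at u)" for c
    by (rule DERIV_cong[OF DERIV_chain2[OF trunc_pow_deriv]]) (auto intro!: derivative_eq_intros)
  have f: "fact (Suc (Suc k)) = real (Suc (Suc k)) * fact (Suc k)" by simp
  show ?thesis
    unfolding spline_def[abs_def]
    apply (rule DERIV_cong)
     apply (rule DERIV_cdivide DERIV_add DERIV_diff DERIV_cmult trunc_pow_deriv *)+
    unfolding f by (simp add: divide_simps del: fact_Suc of_nat_Suc) (simp add: algebra_simps del: fact_Suc of_nat_Suc)
qed

lemma spline_zero: "u \<le> 0 \<Longrightarrow> k > 0 \<Longrightarrow> spline k u = 0"
  by (simp add: spline_def trunc_pow_def max_def)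

text \<open>Beyond the last knot no truncation is active, and the fourth difference of u^4 / 4! is
  1.\<close>

lemma spline4_one: "u \<ge> 4 \<Longrightarrow> spline 4 u = 1"
  by (simp add: spline_def trunc_pow_def max_def fact_numeral power4_eq_xxxx algebra_simps)

text \<open>The pieces to the right of 2 are written in terms of \<open>4 - u\<close>, so that
  bounds on the left half carry over by reflection.\<close>

lemma spline3_eq:
  shows "u \<ge> 4 \<Longrightarrow> spline 3 u = 0"
    and "0 \<le> u \<Longrightarrow> u \<le> 1 \<Longrightarrow> spline 3 u = u^3 / 6"
    and "1 \<le> u \<Longrightarrow> u \<le> 2 \<Longrightarrow> spline 3 u = (u^3 - 4 * (u-1)^3) / 6"
    and "2 \<le> u \<Longrightarrow> u \<le> 3 \<Longrightarrow> spline 3 u = ((4-u)^3 - 4 * (3-u)^3) / 6"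
    and "3 \<le> u \<Longrightarrow> u \<le> 4 \<Longrightarrow> spline 3 u = (4-u)^3 / 6"
  by (auto simp: spline_def trunc_pow_def max_def fact_numeral power3_eq_cube field_simps)

text \<open>On the left half, v - 1 \<le> v / 2 gives v^3 - 4 (v - 1)^3 \<ge> v^3 / 2 \<ge> 1 / 2.
  This makes the bump dominate a multiple of the indicator of an interval, and 1 / 12 is the source
  of the factor 12 in \<open>anticoncentration\<close>.\<close>

lemma spline3_ge:
  assumes "1 \<le> u" "u \<le> 3" shows "spline 3 u \<ge> 1 / 12"
proof -
  have *: "1 / 12 \<le> (v^3 - 4 * (v-1)^3) / 6" if "1 \<le> v" "v \<le> 2" for v :: real
  proof -
    have "(v - 1)^3 \<le> (v/2)^3" using that by (intro power_mono) auto
    moreover have "1 \<le> v^3" using that by simp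
    ultimately show ?thesis by (simp add: power_divide)
  qed
  show ?thesis
  proof (cases "u \<le> 2")
    case True then show ?thesis using *[of u] assms by (simp add: spline3_eq)
  next
    case False then show ?thesis using *[of "4 - u"] assms by (simp add: spline3_eq)
  qed
qed

lemma spline3_nonneg: "spline 3 u \<ge> 0"
proof -
  consider "u \<le> 0" | "0 \<le> u" "u \<le> 1" | "1 \<le> u" "u \<le> 3" | "3 \<le> u" "u \<le> 4" | "4 \<le> u" by linarith
  then show ?thesis
  proof cases
    case 3 then show ?thesis using spline3_ge[of u] by simp
  qed (auto simp: spline3_eq spline_zero)
qed

lemma spline3_le: "spline 3 u \<le> 1"
proof -
  have *: "(v^3 - 4 * (v-1)^3) / 6 \<le> 1" if "1 \<le> v" "v \<le> 2" for v :: real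
  proof -
    have "(v - 1)^2 * (2 - v) \<le> 1 * (2 - v)"
      using that by (intro mult_right_mono power_le_one) auto
    moreover have "v^3 - 4 * (v-1)^3 = 1 + 3 * (v - 1) + 3 * ((v - 1)^2 * (2 - v))"
      by (simp add: power2_eq_square power3_eq_cube algebra_simps)
    ultimately show ?thesis using that by simp
  qed
  have **: "v ^ 3 \<le> 1" if "0 \<le> v" "v \<le> 1" for v :: real
    using that by (simp add: power_le_one)
  consider "u \<le> 0" | "0 \<le> u" "u \<le> 1" | "1 \<le> u" "u \<le> 2" | "2 \<le> u" "u \<le> 3" | "3 \<le> u" "u \<le> 4" | "4 \<le> u" by linarith
  then show ?thesis
    by cases (use *[of u] *[of "4-u"] **[of u] **[of "4-u"] in \<open>simp_all add: spline3_eq spline_zero\<close>)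
qed

lemma spline2_eq:
  shows "u \<ge> 4 \<Longrightarrow> spline 2 u = 0"
    and "0 \<le> u \<Longrightarrow> u \<le> 1 \<Longrightarrow> spline 2 u = u^2 / 2"
    and "1 \<le> u \<Longrightarrow> u \<le> 2 \<Longrightarrow> spline 2 u = (1 + 2 * (u - 1) - 3 * (u-1)^2) / 2"
    and "2 \<le> u \<Longrightarrow> u \<le> 3 \<Longrightarrow> spline 2 u = - ((1 + 2 * (3 - u) - 3 * (3 - u)^2) / 2)"
    and "3 \<le> u \<Longrightarrow> u \<le> 4 \<Longrightarrow> spline 2 u = - ((4-u)^2 / 2)"
  by (auto simp: spline_def trunc_pow_def max_def fact_numeral power2_eq_square field_simps)

lemma spline2_bound: "\<bar>spline 2 u\<bar> \<le> 2"
proof -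
  have *: "0 \<le> v^2 \<and> v ^ 2 \<le> 1 \<and> v\<^sup>2 \<le> v" if "0 \<le> v" "v \<le> 1" for v :: real
    using that mult_left_mono[of v 1 v] by (simp add: power_le_one power2_eq_square)
  consider "u \<le> 0" | "0 \<le> u" "u \<le> 1" | "1 \<le> u" "u \<le> 2" | "2 \<le> u" "u \<le> 3" | "3 \<le> u" "u \<le> 4" | "4 \<le> u" by linarith
  then show ?thesis
    by cases (use *[of u] *[of "u-1"] *[of "3-u"] *[of "4-u"] in \<open>simp_all add: spline2_eq spline_zero abs_le_iff, (linarith+)?\<close>)
qed

lemma spline1_bound: "\<bar>spline 1 u\<bar> \<le> 2"
  unfolding spline_def trunc_pow_def by (auto simp: max_def)

lemma spline4_bounds: "0 \<le> spline 4 u" "spline 4 u \<le> 1"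
proof -
  have mono: "spline 4 u \<le> spline 4 v" if "u \<le> v" for u v
  proof (rule DERIV_nonneg_imp_nondecreasing[OF that])
    fix x show "\<exists>y. (spline 4 has_real_derivative y) (at x) \<and> 0 \<le> y"
      using spline_deriv[of 2 x] spline3_nonneg[of x] by (auto simp: numeral_eq_Suc)
  qed
  show "0 \<le> spline 4 u"
    using mono[of "min u 0" u] spline_zero[of "min u 0" 4] by simp
  show "spline 4 u \<le> 1"
    using mono[of u "max u 4"] spline4_one[of "max u 4"] by simp
qed

section \<open>Independent summands\<close>

definition vmax :: "'j set \<Rightarrow> ('j \<Rightarrow> real) \<Rightarrow> real" where
  "vmax J y = Max ((\<lambda>j. \<bar>y j\<bar>) ` J)"

lemma le_vmax: "finite J \<Longrightarrow> j \<in> J \<Longrightarrow> \<bar>y j\<bar> \<le> vmax J y"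
  unfolding vmax_def by (intro Max_ge) auto

lemma vmax_measurable:
  assumes "finite J" "J \<noteq> {}" "\<And>j. j \<in> J \<Longrightarrow> (\<lambda>x. f x j) \<in> borel_measurable M"
  shows "(\<lambda>x. vmax J (f x)) \<in> borel_measurable M"
proof -
  have "(\<lambda>x. Max {\<bar>f x j\<bar> | j. j \<in> J}) \<in> borel_measurable M"
    unfolding setcompr_eq_image
    using borel_measurable_Max[of J "\<lambda>j x. \<bar>f x j\<bar>" M] assms by simp
  then show ?thesis unfolding vmax_def setcompr_eq_image by simp
qed

text \<open>A bijection of index sets transports the product measure. The use is in the
  leave-one-out argument, where the sum without the i-th term must have the same law for every
  i.\<close>

lemma integral_PiM_reindex_sum:
  fixes v :: "'a \<Rightarrow> 'j \<Rightarrow> real" and H :: "('j \<Rightarrow> real) \<Rightarrow> real"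
  assumes P: "prob_space P" and fin: "finite I" "finite K" and card: "card I = card K"
    and m: "(\<lambda>\<omega>. H (\<lambda>j. \<Sum>i\<in>K. v (\<omega> i) j)) \<in> borel_measurable (iid K P)"
  shows "(\<integral>\<omega>. H (\<lambda>j. \<Sum>i\<in>K. v (\<omega> i) j) \<partial>iid K P) =
    (\<integral>\<omega>. H (\<lambda>j. \<Sum>i\<in>I. v (\<omega> i) j) \<partial>iid I P)"
proof -
  obtain f where f: "bij_betw f K I" using finite_same_card_bij[OF fin(2,1)] card by auto
  have d: "distr (iid I P) (iid K P) (\<lambda>\<omega>. \<lambda>n\<in>K. \<omega> (f n)) = iid K P"
    using distr_PiM_reindex[of I "\<lambda>_. P" f K] P f by (auto simp: bij_betw_def)
  have t: "(\<lambda>\<omega>. \<lambda>n\<in>K. \<omega> (f n)) \<in> measurable (iid I P) (iid K P)"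
    using f by (intro measurable_restrict measurable_component_singleton) (auto simp: bij_betw_def)
  have "(\<integral>\<omega>. H (\<lambda>j. \<Sum>i\<in>K. v (\<omega> i) j) \<partial>iid K P) =
    (\<integral>\<omega>. H (\<lambda>j. \<Sum>i\<in>K. v (\<omega> i) j) \<partial>distr (iid I P) (iid K P) (\<lambda>\<omega>. \<lambda>n\<in>K. \<omega> (f n)))"
    by (simp add: d)
  also have "\<dots> = (\<integral>\<omega>. H (\<lambda>j. \<Sum>i\<in>K. v ((\<lambda>n\<in>K. \<omega> (f n)) i) j) \<partial>iid I P)"
    by (rule integral_distr[OF t m])
  also have "\<dots> = (\<integral>\<omega>. H (\<lambda>j. \<Sum>i\<in>I. v (\<omega> i) j) \<partial>iid I P)"
  proof (intro Bochner_Integration.integral_cong refl arg_cong[where f=H] ext)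
    fix \<omega> :: "'b \<Rightarrow> 'a" and j
    have "(\<Sum>i\<in>K. v ((\<lambda>n\<in>K. \<omega> (f n)) i) j) = (\<Sum>i\<in>K. v (\<omega> (f i)) j)" by simp
    also have "\<dots> = (\<Sum>i\<in>I. v (\<omega> i) j)" by (rule sum.reindex_bij_betw[OF f])
    finally show "(\<Sum>i\<in>K. v ((\<lambda>n\<in>K. \<omega> (f n)) i) j) = (\<Sum>i\<in>I. v (\<omega> i) j)" .
  qed
  finally show ?thesis .
qed

section \<open>Measurability, and integrability for one random summand\<close>

context softmax begin

lemma expsum_measurable:
  assumes "\<And>j. j \<in> J \<Longrightarrow> (\<lambda>x. s x j) \<in> borel_measurable M"
  shows "(\<lambda>x. expsum (s x)) \<in> borel_measurable M"
  unfolding expsum_def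
  by (intro borel_measurable_sum borel_measurable_exp[THEN measurable_compose[rotated]] borel_measurable_times borel_measurable_const assms)

lemma lse_measurable:
  assumes "\<And>j. j \<in> J \<Longrightarrow> (\<lambda>x. s x j) \<in> borel_measurable M"
  shows "(\<lambda>x. lse (s x)) \<in> borel_measurable M"
  unfolding lse_def using expsum_measurable[of s M, OF assms] by measurable

lemma mom_measurable:
  assumes "\<And>j. j \<in> J \<Longrightarrow> (\<lambda>x. s x j) \<in> borel_measurable M"
    and "\<And>j. j \<in> J \<Longrightarrow> (\<lambda>x. y x j) \<in> borel_measurable M"
  shows "(\<lambda>x. mom k (s x) (y x)) \<in> borel_measurable M"
proof -
  note [measurable] = expsum_measurable[of s M, OF assms(1)]
  show ?thesis unfolding mom_def weight_def
  proof (rule borel_measurable_sum)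
    fix j assume "j \<in> J"
    note [measurable] = assms[OF this]
    show "(\<lambda>x. exp (\<beta> * s x j) / expsum (s x) * y x j ^ k) \<in> borel_measurable M" by measurable
  qed
qed

lemma mom1_sum: "mom 1 s (\<lambda>j. \<Sum>i\<in>I. y i j) = (\<Sum>i\<in>I. mom 1 s (y i))"
  unfolding mom_def by (simp add: sum_distrib_left sum.swap[of _ I])

text \<open>Crude in the size of \<open>J\<close>, but its purpose is only to dominate integrands;
  it does not enter the error bounds.\<close>

lemma mom1_le_sum: "\<bar>mom 1 s y\<bar> \<le> (\<Sum>j\<in>J. \<bar>y j\<bar>)"
proof -
  have w: "weight s j \<le> 1" if "j \<in> J" for j
    using member_le_sum[OF that _ finite_J, of "weight s"] weight_nonneg sum_weight[of s] by auto
  have "\<bar>mom 1 s y\<bar> \<le> (\<Sum>j\<in>J. weight s j * \<bar>y j\<bar>)"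
    unfolding mom_def by (rule sum_abs[THEN order_trans]) (simp add: abs_mult weight_nonneg)
  also have "\<dots> \<le> (\<Sum>j\<in>J. \<bar>y j\<bar>)"
    using w by (intro sum_mono) (simp add: mult_left_le_one_le weight_nonneg)
  finally show ?thesis .
qed

text \<open>Separating the weights from the products of coordinates shows that the expectation of
  \<open>diff2\<close> sees a random direction only through its second moments. This is what cancels
  in Lindeberg's argument.\<close>

lemma diff2_eq:
  "diff2 g1 g2 s y = (g2 (lse s) - g1 (lse s) * \<beta>) * (\<Sum>j\<in>J. \<Sum>k\<in>J. weight s j * weight s k * (y j * y k))
     + g1 (lse s) * \<beta> * (\<Sum>j\<in>J. weight s j * (y j * y j))"
proof -
  have "(mom 1 s y)\<^sup>2 = (\<Sum>j\<in>J. \<Sum>k\<in>J. weight s j * weight s k * (y j * y k))"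
    unfolding mom_def power2_eq_square sum_product by (intro sum.cong refl) (simp add: mult_ac)
  moreover have "mom 2 s y = (\<Sum>j\<in>J. weight s j * (y j * y j))"
    unfolding mom_def by (simp add: power2_eq_square)
  ultimately show ?thesis unfolding diff2_def by (simp add: algebra_simps)
qed

end

text \<open>The exponential weight in the third moments is the price of returning to the base-point
  weights in \<open>absmom3_shift\<close>. \<open>M\<close> bounds each coordinate separately; as
  the Gibbs weights sum to 1, the same \<open>M\<close> bounds the whole remainder.\<close>

locale summand = softmax J \<beta> + prob_space P for J :: "'j set" and \<beta> :: real and P :: "'a measure" +
  fixes v :: "'a \<Rightarrow> 'j \<Rightarrow> real" and M :: real
  assumes v_meas: "\<And>j. j \<in> J \<Longrightarrow> (\<lambda>x. v x j) \<in> borel_measurable P"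
    and v_int: "\<And>j. j \<in> J \<Longrightarrow> integrable P (\<lambda>x. v x j)"
    and v_mean: "\<And>j. j \<in> J \<Longrightarrow> (\<integral>x. v x j \<partial>P) = 0"
    and v_int2: "\<And>j k. j \<in> J \<Longrightarrow> k \<in> J \<Longrightarrow> integrable P (\<lambda>x. v x j * v x k)"
    and v_int3: "\<And>j. j \<in> J \<Longrightarrow> integrable P (\<lambda>x. exp (2 * \<beta> * vmax J (v x)) * \<bar>v x j\<bar> ^ 3)"
    and v_mom3: "\<And>j. j \<in> J \<Longrightarrow> (\<integral>x. exp (2 * \<beta> * vmax J (v x)) * \<bar>v x j\<bar> ^ 3 \<partial>P) \<le> M"
begin

lemma prob_PiM: "prob_space (iid I P)"
  by (intro prob_space_PiM prob_space_axioms)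

lemma psf: "product_sigma_finite (\<lambda>_. P)"
  by (simp add: product_sigma_finite_def sigma_finite_measure_axioms)

lemma v_comp_meas:
  assumes "j \<in> J" "f \<in> measurable N P"
  shows "(\<lambda>x. v (f x) j) \<in> borel_measurable N"
  using measurable_compose[OF assms(2) v_meas[OF assms(1)]] .

lemma sum_meas:
  assumes "j \<in> J"
  shows "(\<lambda>\<omega>. \<Sum>i\<in>I. v (\<omega> i) j) \<in> borel_measurable (iid I P)"
  by (intro borel_measurable_sum v_comp_meas[OF assms] measurable_component_singleton)

lemma diff1_int:
  shows "integrable P (\<lambda>x. diff1 g1 s (v x))" and "(\<integral>x. diff1 g1 s (v x) \<partial>P) = 0"
proof -
  have "has_bochner_integral P (\<lambda>x. diff1 g1 s (v x)) (g1 (lse s) * (\<Sum>j\<in>J. weight s j * 0))"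
    unfolding diff1_def mom_def power_one_right
    by (intro has_bochner_integral_mult_right has_bochner_integral_sum)
       (metis has_bochner_integral_integrable v_int v_mean)
  then show "integrable P (\<lambda>x. diff1 g1 s (v x))" "(\<integral>x. diff1 g1 s (v x) \<partial>P) = 0"
    by (auto simp: has_bochner_integral_iff)
qed

lemma diff2_int:
  shows "integrable P (\<lambda>x. diff2 g1 g2 s (v x))"
    and "(\<integral>x. diff2 g1 g2 s (v x) \<partial>P) =
      (g2 (lse s) - g1 (lse s) * \<beta>) * (\<Sum>j\<in>J. \<Sum>k\<in>J. weight s j * weight s k * (\<integral>x. v x j * v x k \<partial>P))
     + g1 (lse s) * \<beta> * (\<Sum>j\<in>J. weight s j * (\<integral>x. v x j * v x j \<partial>P))"
proof -
  have "has_bochner_integral P (\<lambda>x. diff2 g1 g2 s (v x))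
    ((g2 (lse s) - g1 (lse s) * \<beta>) * (\<Sum>j\<in>J. \<Sum>k\<in>J. weight s j * weight s k * (\<integral>x. v x j * v x k \<partial>P))
     + g1 (lse s) * \<beta> * (\<Sum>j\<in>J. weight s j * (\<integral>x. v x j * v x j \<partial>P)))"
    unfolding diff2_eq
    by (intro has_bochner_integral_mult_right has_bochner_integral_sum has_bochner_integral_add
        has_bochner_integral_integrable v_int2)
  then show "integrable P (\<lambda>x. diff2 g1 g2 s (v x))"
    "(\<integral>x. diff2 g1 g2 s (v x) \<partial>P) =
      (g2 (lse s) - g1 (lse s) * \<beta>) * (\<Sum>j\<in>J. \<Sum>k\<in>J. weight s j * weight s k * (\<integral>x. v x j * v x k \<partial>P))
     + g1 (lse s) * \<beta> * (\<Sum>j\<in>J. weight s j * (\<integral>x. v x j * v x j \<partial>P))"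
    by (auto simp: has_bochner_integral_iff)
qed

lemma remainder_int:
  shows "integrable P (\<lambda>x. exp (2 * \<beta> * vmax J (v x)) * absmom3 s (v x))"
    and "(\<integral>x. exp (2 * \<beta> * vmax J (v x)) * absmom3 s (v x) \<partial>P) \<le> M"
proof -
  have eq: "exp (2 * \<beta> * vmax J (v x)) * absmom3 s (v x) =
     (\<Sum>j\<in>J. weight s j * (exp (2 * \<beta> * vmax J (v x)) * \<bar>v x j\<bar> ^ 3))" for x
    unfolding absmom3_def sum_distrib_left by (simp add: mult_ac)
  show "integrable P (\<lambda>x. exp (2 * \<beta> * vmax J (v x)) * absmom3 s (v x))"
    unfolding eq by (intro Bochner_Integration.integrable_sum integrable_mult_right v_int3)
  have "(\<integral>x. exp (2 * \<beta> * vmax J (v x)) * absmom3 s (v x) \<partial>P) =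
     (\<Sum>j\<in>J. weight s j * (\<integral>x. exp (2 * \<beta> * vmax J (v x)) * \<bar>v x j\<bar> ^ 3 \<partial>P))"
    unfolding eq using v_int3 by (subst Bochner_Integration.integral_sum) auto
  also have "\<dots> \<le> (\<Sum>j\<in>J. weight s j * M)"
    by (intro sum_mono mult_left_mono v_mom3 weight_nonneg)
  also have "\<dots> = M" by (simp add: sum_distrib_right[symmetric] sum_weight)
  finally show "(\<integral>x. exp (2 * \<beta> * vmax J (v x)) * absmom3 s (v x) \<partial>P) \<le> M" .
qed

lemma M_nonneg: "M \<ge> 0"
proof -
  obtain j where "j \<in> J" using J_ne by auto
  have "0 \<le> (\<integral>x. exp (2 * \<beta> * vmax J (v x)) * \<bar>v x j\<bar> ^ 3 \<partial>P)" by simp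
  with v_mom3[OF \<open>j \<in> J\<close>] show ?thesis by linarith
qed

lemma expectation_diff_le:
  assumes "integrable P f" "integrable P g" "\<And>x. \<bar>f x - g x\<bar> \<le> c * (exp (2 * \<beta> * vmax J (v x)) * absmom3 s (v x))"
    and "c \<ge> 0"
  shows "\<bar>(\<integral>x. f x \<partial>P) - (\<integral>x. g x \<partial>P)\<bar> \<le> c * M"
proof -
  have "\<bar>(\<integral>x. f x \<partial>P) - (\<integral>x. g x \<partial>P)\<bar> = \<bar>\<integral>x. f x - g x \<partial>P\<bar>"
    using assms by simp
  also have "\<dots> \<le> (\<integral>x. \<bar>f x - g x\<bar> \<partial>P)" by (rule integral_abs_bound)
  also have "\<dots> \<le> (\<integral>x. c * (exp (2 * \<beta> * vmax J (v x)) * absmom3 s (v x)) \<partial>P)"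
    using assms remainder_int(1)[of s] by (intro integral_mono) auto
  also have "\<dots> \<le> c * M"
    using mult_left_mono[OF remainder_int(2)[of s] assms(4)] by simp
  finally show ?thesis .
qed

end

section \<open>Expected one-step expansions\<close>

locale test_fun =
  fixes g1 g2 g3 :: "real \<Rightarrow> real" and c1 c2 c3 :: real
  assumes d1: "\<And>x. (g1 has_real_derivative g2 x) (at x)" and d2: "\<And>x. (g2 has_real_derivative g3 x) (at x)"
    and b1: "\<And>x. \<bar>g1 x\<bar> \<le> c1" and b2: "\<And>x. \<bar>g2 x\<bar> \<le> c2" and b3: "\<And>x. \<bar>g3 x\<bar> \<le> c3"
begin

lemma c_nonneg: "c1 \<ge> 0" "c2 \<ge> 0" "c3 \<ge> 0"
  using b1[of 0] b2[of 0] b3[of 0] by linarith+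

lemma g_meas: "g1 \<in> borel_measurable borel" "g2 \<in> borel_measurable borel"
  using d1 d2 by (auto intro!: borel_measurable_continuous_onI continuous_at_imp_continuous_on intro: DERIV_isCont)

end

locale summand_test = summand J \<beta> P v M + test_fun g1 g2 g3 c1 c2 c3
  for J :: "'j set" and \<beta> :: real and P :: "'a measure" and v M and g1 g2 g3 :: "real \<Rightarrow> real" and c1 c2 c3 :: real
begin

abbreviation "\<kappa> \<equiv> c3 + 6 * \<beta> * c2 + 6 * \<beta>\<^sup>2 * c1"

lemma kappa_nonneg: "\<kappa> \<ge> 0" using c_nonneg beta_pos by simp

lemma lse_shift_meas:
  assumes f: "f \<in> measurable N P"
  shows "(\<lambda>x. lse (\<lambda>j. s j + v (f x) j)) \<in> borel_measurable N"
  by (intro lse_measurable borel_measurable_add borel_measurable_const v_comp_meas f)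

lemma smooth_expectation:
  fixes g0 :: "real \<Rightarrow> real"
  assumes d0: "\<And>x. (g0 has_real_derivative g1 x) (at x)" and b0: "\<And>x. \<bar>g0 x\<bar> \<le> c0"
  shows "\<bar>(\<integral>x. g0 (lse (\<lambda>j. s j + v x j)) \<partial>P) - (g0 (lse s) + (\<integral>x. diff2 g1 g2 s (v x) \<partial>P) / 2)\<bar> \<le> \<kappa> / 6 * M"
proof -
  have g0m: "g0 \<in> borel_measurable borel"
    using d0 by (auto intro!: borel_measurable_continuous_onI continuous_at_imp_continuous_on intro: DERIV_isCont)
  have i0: "integrable P (\<lambda>x. g0 (lse (\<lambda>j. s j + v x j)))"
    by (rule integrable_const_bound[of _ c0]) (auto simp: b0 intro!: measurable_compose[OF lse_shift_meas g0m] measurable_ident_sets)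
  have ig: "integrable P (\<lambda>x. g0 (lse s) + diff1 g1 s (v x) + diff2 g1 g2 s (v x) / 2)"
    using diff1_int(1)[of g1 s] diff2_int(1)[of g1 g2 s] by simp
  have "\<bar>(\<integral>x. g0 (lse (\<lambda>j. s j + v x j)) \<partial>P) - (\<integral>x. g0 (lse s) + diff1 g1 s (v x) + diff2 g1 g2 s (v x) / 2 \<partial>P)\<bar> \<le> \<kappa> / 6 * M"
  proof (rule expectation_diff_le[OF i0 ig])
    fix x
    show "\<bar>g0 (lse (\<lambda>j. s j + v x j)) - (g0 (lse s) + diff1 g1 s (v x) + diff2 g1 g2 s (v x) / 2)\<bar>
         \<le> \<kappa> / 6 * (exp (2 * \<beta> * vmax J (v x)) * absmom3 s (v x))"
      using smooth_taylor[of g1 g2 g3 c1 c2 c3 "v x" "vmax J (v x)" g0 s, OF d1 d2 b1 b2 b3 le_vmax[OF finite_J] d0]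
      by (simp add: algebra_simps)
  qed (use kappa_nonneg in simp)
  also have "(\<integral>x. g0 (lse s) + diff1 g1 s (v x) + diff2 g1 g2 s (v x) / 2 \<partial>P) = g0 (lse s) + (\<integral>x. diff2 g1 g2 s (v x) \<partial>P) / 2"
    using diff1_int[of g1 s] diff2_int(1)[of g1 g2 s] by (simp add: prob_space)
  finally show ?thesis .
qed

lemma diff1_shift_int:
  "integrable P (\<lambda>x. diff1 g1 (\<lambda>j. s j + v x j) (v x))"
proof (rule Bochner_Integration.integrable_bound)
  show "integrable P (\<lambda>x. c1 * (\<Sum>j\<in>J. \<bar>v x j\<bar>))"
    using v_int by (intro integrable_mult_right Bochner_Integration.integrable_sum) auto
  show "(\<lambda>x. diff1 g1 (\<lambda>j. s j + v x j) (v x)) \<in> borel_measurable P"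
    unfolding diff1_def
    by (intro borel_measurable_times measurable_compose[OF lse_shift_meas g_meas(1)] mom_measurable
        borel_measurable_add borel_measurable_const v_meas measurable_ident_sets refl)
  show "AE x in P. norm (diff1 g1 (\<lambda>j. s j + v x j) (v x)) \<le> norm (c1 * (\<Sum>j\<in>J. \<bar>v x j\<bar>))"
    using b1 c_nonneg by (intro always_eventually allI) (auto simp: diff1_def abs_mult sum_nonneg simp del: One_nat_def intro!: mult_mono mom1_le_sum)
qed

text \<open>Since \<open>s\<close> is fixed and the summand is centred, the gradient at
  \<open>s\<close> contributes nothing, and the leading part is the second-order term: Stein's
  identity for a single small summand, with a third-order error.\<close>

lemma diff1_expectation:
  "\<bar>(\<integral>x. diff1 g1 (\<lambda>j. s j + v x j) (v x) \<partial>P) - (\<integral>x. diff2 g1 g2 s (v x) \<partial>P)\<bar> \<le> \<kappa> / 2 * M"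
proof -
  have "\<bar>(\<integral>x. diff1 g1 (\<lambda>j. s j + v x j) (v x) \<partial>P) - (\<integral>x. diff1 g1 s (v x) + diff2 g1 g2 s (v x) \<partial>P)\<bar> \<le> \<kappa> / 2 * M"
  proof (rule expectation_diff_le[OF diff1_shift_int])
    fix x
    show "\<bar>diff1 g1 (\<lambda>j. s j + v x j) (v x) - (diff1 g1 s (v x) + diff2 g1 g2 s (v x))\<bar>
         \<le> \<kappa> / 2 * (exp (2 * \<beta> * vmax J (v x)) * absmom3 s (v x))"
      using diff1_taylor[of g1 g2 g3 c1 c2 c3 "v x" "vmax J (v x)" s, OF d1 d2 b1 b2 b3 le_vmax[OF finite_J]]
      by (simp add: algebra_simps)
  qed (use kappa_nonneg diff1_int diff2_int in simp_all)
  then show ?thesis using diff1_int[of g1 s] diff2_int(1)[of g1 g2 s] by simp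
qed

end

section \<open>Lindeberg's argument and an approximate Stein identity\<close>

context softmax begin

text \<open>The base point \<open>s\<close> stays arbitrary in the induction. The newly inserted
  summand is first absorbed into \<open>s\<close> while the induction hypothesis exchanges all the
  others; afterwards the exchanged sum serves as base point for the new one. Uniformity of the
  one-step error in the base point is what lets both errors simply add.\<close>

lemma lindeberg_sum:
  fixes g0 g1 g2 g3 :: "real \<Rightarrow> real" and v :: "'a \<Rightarrow> 'j \<Rightarrow> real" and w :: "'b \<Rightarrow> 'j \<Rightarrow> real"
  assumes P: "summand J \<beta> P v M" and Q: "summand J \<beta> Q w M'" and T: "test_fun g1 g2 g3 c1 c2 c3"
    and cov: "\<And>j k. j \<in> J \<Longrightarrow> k \<in> J \<Longrightarrow> (\<integral>x. v x j * v x k \<partial>P) = (\<integral>x. w x j * w x k \<partial>Q)"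
    and d0: "\<And>x. (g0 has_real_derivative g1 x) (at x)" and b0: "\<And>x. \<bar>g0 x\<bar> \<le> c0"
    and I: "finite (I :: 'c set)"
  shows "\<bar>(\<integral>\<omega>. g0 (lse (\<lambda>j. s j + (\<Sum>i\<in>I. v (\<omega> i) j))) \<partial>iid I P)
     - (\<integral>\<omega>. g0 (lse (\<lambda>j. s j + (\<Sum>i\<in>I. w (\<omega> i) j))) \<partial>iid I Q)\<bar>
     \<le> card I * ((c3 + 6 * \<beta> * c2 + 6 * \<beta>\<^sup>2 * c1) / 6 * (M + M'))"
  using I
proof (induction I arbitrary: s rule: finite_induct)
  case empty
  interpret P: prob_space "PiM {} (\<lambda>_::'c. P)" using P by (intro prob_space_PiM) (simp add: summand_def)
  interpret Q: prob_space "PiM {} (\<lambda>_::'c. Q)" using Q by (intro prob_space_PiM) (simp add: summand_def)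
  show ?case by (simp add: P.prob_space Q.prob_space)
next
  case (insert i I)
  interpret P: summand J \<beta> P v M by fact
  interpret Q: summand J \<beta> Q w M' by fact
  interpret T: test_fun g1 g2 g3 c1 c2 c3 by fact
  interpret PT: summand_test J \<beta> P v M g1 g2 g3 c1 c2 c3 ..
  interpret QT: summand_test J \<beta> Q w M' g1 g2 g3 c1 c2 c3 ..
  interpret PI: product_sigma_finite "\<lambda>_. P" by (rule P.psf)
  interpret QI: product_sigma_finite "\<lambda>_. Q" by (rule Q.psf)
  interpret SP: prob_space "iid I P" by (rule P.prob_PiM)
  interpret SQ: prob_space "iid I Q" by (rule Q.prob_PiM)
  interpret SP': prob_space "iid (insert i I) P" by (rule P.prob_PiM)
  interpret SQ': prob_space "iid (insert i I) Q" by (rule Q.prob_PiM)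
  interpret PQ: pair_prob_space P "iid I Q" ..
  interpret PP: pair_prob_space P "iid I P" ..
  let ?K = "(c3 + 6 * \<beta> * c2 + 6 * \<beta>\<^sup>2 * c1) / 6"
  have g0m: "g0 \<in> borel_measurable borel"
    using d0 by (auto intro!: borel_measurable_continuous_onI continuous_at_imp_continuous_on intro: DERIV_isCont)
  have gm: "(\<lambda>\<omega>. g0 (lse (f \<omega>))) \<in> borel_measurable N"
    if "\<And>j. j \<in> J \<Longrightarrow> (\<lambda>\<omega>. f \<omega> j) \<in> borel_measurable N" for f :: "'z \<Rightarrow> 'j \<Rightarrow> real" and N
    by (rule measurable_compose[OF lse_measurable[OF that] g0m])
  have upd: "(\<Sum>k\<in>insert i I. u ((x(i := y)) k) j) = u y j + (\<Sum>k\<in>I. u (x k) j)"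
    for u :: "'z \<Rightarrow> 'j \<Rightarrow> real" and x y j
    using insert.hyps by (auto intro!: sum.cong)
  define G where "G s = g0 (lse s)" for s
  have Gb: "norm (G s) \<le> c0" for s by (simp add: G_def b0)
  have mPI: "(\<lambda>\<omega>. G (\<lambda>j. s j + (\<Sum>i\<in>K. v (\<omega> i) j))) \<in> borel_measurable (iid K P)" for s K
    unfolding G_def by (intro gm borel_measurable_add borel_measurable_const P.sum_meas)
  have mQI: "(\<lambda>\<omega>. G (\<lambda>j. s j + (\<Sum>i\<in>K. w (\<omega> i) j))) \<in> borel_measurable (iid K Q)" for s K
    unfolding G_def by (intro gm borel_measurable_add borel_measurable_const Q.sum_meas)
  have mPQ: "(\<lambda>z. G (\<lambda>j. s j + v (fst z) j + (\<Sum>i\<in>I. w (snd z i) j))) \<in> borel_measurable (P \<Otimes>\<^sub>M iid I Q)" for s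
    unfolding G_def
    by (intro gm borel_measurable_add borel_measurable_const P.v_comp_meas measurable_fst
        borel_measurable_sum Q.v_comp_meas measurable_compose[OF measurable_snd] measurable_component_singleton)
  have mPP: "(\<lambda>z. G (\<lambda>j. s j + v (fst z) j + (\<Sum>i\<in>I. v (snd z i) j))) \<in> borel_measurable (P \<Otimes>\<^sub>M iid I P)" for s
    unfolding G_def
    by (intro gm borel_measurable_add borel_measurable_const P.v_comp_meas measurable_fst
        borel_measurable_sum measurable_compose[OF measurable_snd] measurable_component_singleton)
  have iPQ: "integrable (P \<Otimes>\<^sub>M iid I Q) (\<lambda>z. G (\<lambda>j. s j + v (fst z) j + (\<Sum>i\<in>I. w (snd z i) j)))" for s
    by (rule PQ.P.integrable_const_bound[of _ c0]) (simp_all only: Gb mPQ AE_I2)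
  have iPP: "integrable (P \<Otimes>\<^sub>M iid I P) (\<lambda>z. G (\<lambda>j. s j + v (fst z) j + (\<Sum>i\<in>I. v (snd z i) j)))" for s
    by (rule PP.P.integrable_const_bound[of _ c0]) (simp_all only: Gb mPP AE_I2)
  define A where "A s = (\<integral>x. G (\<lambda>j. s j + (\<Sum>i\<in>I. v (x i) j)) \<partial>iid I P)" for s
  define B where "B s = (\<integral>x. G (\<lambda>j. s j + (\<Sum>i\<in>I. w (x i) j)) \<partial>iid I Q)" for s
  have IH: "\<bar>A s - B s\<bar> \<le> card I * (?K * (M + M'))" for s
    using insert.IH[of s] by (simp add: A_def B_def G_def)
  have "(\<integral>\<omega>. G (\<lambda>j. s j + (\<Sum>k\<in>insert i I. v (\<omega> k) j)) \<partial>iid (insert i I) P)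
     = (\<integral>x. \<integral>y. G (\<lambda>j. s j + v y j + (\<Sum>k\<in>I. v (x k) j)) \<partial>P \<partial>iid I P)"
    using SP'.integrable_const_bound[OF AE_I2[OF Gb] mPI] insert.hyps
    by (subst PI.product_integral_insert) (simp_all only: upd add.assoc not_False_eq_True)
  also have "\<dots> = (\<integral>y. \<integral>x. G (\<lambda>j. s j + v y j + (\<Sum>k\<in>I. v (x k) j)) \<partial>iid I P \<partial>P)"
    by (rule PP.Fubini_integral, unfold case_prod_beta, rule iPP)
  also have "\<dots> = (\<integral>y. A (\<lambda>j. s j + v y j) \<partial>P)" by (simp add: A_def)
  finally have LP: "(\<integral>\<omega>. G (\<lambda>j. s j + (\<Sum>k\<in>insert i I. v (\<omega> k) j)) \<partial>iid (insert i I) P)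
     = (\<integral>y. A (\<lambda>j. s j + v y j) \<partial>P)" .
  have LQ: "(\<integral>\<omega>. G (\<lambda>j. s j + (\<Sum>k\<in>insert i I. w (\<omega> k) j)) \<partial>iid (insert i I) Q)
     = (\<integral>x. \<integral>y. G (\<lambda>j. s j + w y j + (\<Sum>k\<in>I. w (x k) j)) \<partial>Q \<partial>iid I Q)"
    using SQ'.integrable_const_bound[OF AE_I2[OF Gb] mQI] insert.hyps
    by (subst QI.product_integral_insert) (simp_all only: upd add.assoc not_False_eq_True)
  \<comment> \<open>Fubini moves the remaining \<open>v\<close>-summand innermost, so that for fixed
    \<open>x\<close> the \<open>w\<close>-sum is deterministic.\<close>
  have FB: "(\<integral>y. B (\<lambda>j. s j + v y j) \<partial>P) = (\<integral>x. \<integral>y. G (\<lambda>j. s j + v y j + (\<Sum>k\<in>I. w (x k) j)) \<partial>P \<partial>iid I Q)"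
    unfolding B_def by (rule PQ.Fubini_integral[symmetric], unfold case_prod_beta, rule iPQ)
  have iA: "integrable P (\<lambda>y. A (\<lambda>j. s j + v y j))"
    using PP.integrable_fst'[OF iPP[of s]] by (simp add: A_def)
  have iB: "integrable P (\<lambda>y. B (\<lambda>j. s j + v y j))"
    using PQ.integrable_fst'[OF iPQ[of s]] by (simp add: B_def)
  have "\<bar>(\<integral>y. A (\<lambda>j. s j + v y j) \<partial>P) - (\<integral>y. B (\<lambda>j. s j + v y j) \<partial>P)\<bar>
      = \<bar>\<integral>y. A (\<lambda>j. s j + v y j) - B (\<lambda>j. s j + v y j) \<partial>P\<bar>" using iA iB by simp
  also have "\<dots> \<le> (\<integral>y. \<bar>A (\<lambda>j. s j + v y j) - B (\<lambda>j. s j + v y j)\<bar> \<partial>P)" by (rule integral_abs_bound)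
  also have "\<dots> \<le> (\<integral>y. card I * (?K * (M + M')) \<partial>P)"
    by (intro integral_mono integrable_abs Bochner_Integration.integrable_diff iA iB IH) simp
  also have "\<dots> = card I * (?K * (M + M'))" by (simp add: P.prob_space)
  finally have S1: "\<bar>(\<integral>y. A (\<lambda>j. s j + v y j) \<partial>P) - (\<integral>y. B (\<lambda>j. s j + v y j) \<partial>P)\<bar> \<le> card I * (?K * (M + M'))" .
  define C where "C x = (\<integral>y. G (\<lambda>j. s j + v y j + (\<Sum>k\<in>I. w (x k) j)) \<partial>P)" for x
  define D where "D x = (\<integral>y. G (\<lambda>j. s j + w y j + (\<Sum>k\<in>I. w (x k) j)) \<partial>Q)" for x
  have iC: "integrable (iid I Q) C"
    unfolding C_def by (rule PQ.integrable_snd, unfold case_prod_beta, rule iPQ)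
  have iD: "integrable (iid I Q) D"
  proof -
    interpret QQ: pair_prob_space Q "iid I Q" ..
    have mQQ: "(\<lambda>z. G (\<lambda>j. s j + w (fst z) j + (\<Sum>i\<in>I. w (snd z i) j))) \<in> borel_measurable (Q \<Otimes>\<^sub>M iid I Q)"
      unfolding G_def
      by (intro gm borel_measurable_add borel_measurable_const Q.v_comp_meas measurable_fst
        borel_measurable_sum measurable_compose[OF measurable_snd] measurable_component_singleton)
    have "integrable (Q \<Otimes>\<^sub>M iid I Q) (\<lambda>z. G (\<lambda>j. s j + w (fst z) j + (\<Sum>i\<in>I. w (snd z i) j)))"
      by (rule QQ.P.integrable_const_bound[of _ c0]) (simp_all only: Gb mQQ AE_I2)
    then show ?thesis unfolding D_def by (intro QQ.integrable_snd, unfold case_prod_beta)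
  qed
  \<comment> \<open>Both one-step expansions have the same second-order term because the second
    moments agree; only the two remainders survive.\<close>
  have CD: "\<bar>C x - D x\<bar> \<le> ?K * (M + M')" for x
  proof -
    let ?s = "\<lambda>j. s j + (\<Sum>k\<in>I. w (x k) j)"
    have d: "(\<integral>y. diff2 g1 g2 ?s (v y) \<partial>P) = (\<integral>y. diff2 g1 g2 ?s (w y) \<partial>Q)"
      unfolding P.diff2_int Q.diff2_int by (simp add: cov cong: sum.cong)
    have "\<bar>C x - (g0 (lse ?s) + (\<integral>y. diff2 g1 g2 ?s (v y) \<partial>P) / 2)\<bar> \<le> ?K * M"
      using PT.smooth_expectation[OF d0 b0, of ?s] by (simp add: C_def G_def add_ac)
    moreover have "\<bar>D x - (g0 (lse ?s) + (\<integral>y. diff2 g1 g2 ?s (w y) \<partial>Q) / 2)\<bar> \<le> ?K * M'"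
      using QT.smooth_expectation[OF d0 b0, of ?s] by (simp add: D_def G_def add_ac)
    ultimately show ?thesis unfolding d distrib_left by linarith
  qed
  have "\<bar>(\<integral>x. C x \<partial>iid I Q) - (\<integral>x. D x \<partial>iid I Q)\<bar> = \<bar>\<integral>x. C x - D x \<partial>iid I Q\<bar>"
    using iC iD by simp
  also have "\<dots> \<le> (\<integral>x. \<bar>C x - D x\<bar> \<partial>iid I Q)" by (rule integral_abs_bound)
  also have "\<dots> \<le> (\<integral>x. ?K * (M + M') \<partial>iid I Q)"
    by (intro integral_mono integrable_abs Bochner_Integration.integrable_diff iC iD CD) simp
  also have "\<dots> = ?K * (M + M')" by (simp add: SQ.prob_space)
  finally have S2: "\<bar>(\<integral>x. C x \<partial>iid I Q) - (\<integral>x. D x \<partial>iid I Q)\<bar> \<le> ?K * (M + M')" .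
  have "\<bar>(\<integral>\<omega>. G (\<lambda>j. s j + (\<Sum>k\<in>insert i I. v (\<omega> k) j)) \<partial>iid (insert i I) P)
     - (\<integral>\<omega>. G (\<lambda>j. s j + (\<Sum>k\<in>insert i I. w (\<omega> k) j)) \<partial>iid (insert i I) Q)\<bar>
    \<le> card I * (?K * (M + M')) + ?K * (M + M')"
    unfolding LP LQ using S1 S2 unfolding FB C_def D_def by linarith
  moreover have "real (card (insert i I)) * X = real (card I) * X + X" for X :: real
    using insert.hyps by (simp add: distrib_right)
  ultimately show ?case unfolding G_def by simp
qed

end

context summand_test begin

text \<open>An approximate Stein identity, bounded from below: for Gaussian summands the left-hand side
  would equal the expectation of \<open>diff2\<close> exactly, and \<open>\<beta> g1 \<ge> g2 \<ge> 0\<close> lets the convexity of the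
  soft maximum be used to discard the possibly degenerate rank-one part of its Hessian.\<close>
lemma stein_lower_bound:
  assumes g2: "\<And>x. 0 \<le> g2 x" "\<And>x. g2 x \<le> \<beta> * g1 x"
    and var: "\<And>j. j \<in> J \<Longrightarrow> c \<le> (\<integral>x. v x j * v x j \<partial>P)"
  shows "real (Suc n) * (c * (\<integral>\<omega>. g2 (lse (\<lambda>j. \<Sum>i<n. v (\<omega> i) j)) \<partial>iid {..<n} P) - \<kappa> / 2 * M)
     \<le> (\<integral>\<omega>. diff1 g1 (\<lambda>j. \<Sum>i<Suc n. v (\<omega> i) j) (\<lambda>j. \<Sum>i<Suc n. v (\<omega> i) j) \<partial>iid {..<Suc n} P)"
proof -
  let ?I = "{..<Suc n}"
  interpret PI: product_sigma_finite "\<lambda>_. P" by (rule psf)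
  have g2_int: "integrable (iid K P) (\<lambda>\<omega>. g2 (lse (\<lambda>j. \<Sum>i\<in>K. v (\<omega> i) j)))" for K :: "nat set"
  proof -
    interpret K: prob_space "iid K P" by (rule prob_PiM)
    show ?thesis
      by (rule K.integrable_const_bound[of _ c2])
        (auto simp: b2 intro!: measurable_compose[OF lse_measurable g_meas(2)] sum_meas)
  qed
  have low: "c * g2 (lse s) - \<kappa> / 2 * M \<le> (\<integral>x. diff1 g1 (\<lambda>j. s j + v x j) (v x) \<partial>P)" for s
  proof -
    have "c * g2 (lse s) = g2 (lse s) * (\<Sum>j\<in>J. weight s j * c)"
      by (simp add: sum_distrib_right[symmetric] sum_weight)
    also have "\<dots> \<le> g2 (lse s) * (\<Sum>j\<in>J. weight s j * (\<integral>x. v x j * v x j \<partial>P))"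
      by (intro mult_left_mono sum_mono var weight_nonneg g2)
    also have "\<dots> = (\<integral>x. g2 (lse s) * mom 2 s (v x) \<partial>P)"
      unfolding mom_def power2_eq_square using v_int2 by (simp add: Bochner_Integration.integral_sum)
    also have "\<dots> \<le> (\<integral>x. diff2 g1 g2 s (v x) \<partial>P)"
    proof (rule integral_mono)
      show "integrable P (\<lambda>x. g2 (lse s) * mom 2 s (v x))"
        unfolding mom_def power2_eq_square using v_int2 by (intro integrable_mult_right Bochner_Integration.integrable_sum) auto
      fix x
      \<comment> \<open>The Gibbs variance of \<open>v x\<close> is nonnegative, so its coefficient
        may be raised from \<open>g2\<close> to \<beta> \<open>g1\<close>; adding \<open>g2\<close>
        times the squared mean turns the right-hand side into \<open>diff2\<close>.\<close>
      have "g2 (lse s) * (mom 2 s (v x) - (mom 1 s (v x))\<^sup>2) \<le> \<beta> * g1 (lse s) * (mom 2 s (v x) - (mom 1 s (v x))\<^sup>2)"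
        using mom2_ge[of s "v x"] by (intro mult_right_mono g2) auto
      then show "g2 (lse s) * mom 2 s (v x) \<le> diff2 g1 g2 s (v x)"
        unfolding diff2_def by (simp add: algebra_simps)
    qed (rule diff2_int)
    finally show ?thesis using diff1_expectation[of s] by linarith
  qed
  have term_int: "integrable (iid ?I P) (\<lambda>\<omega>. diff1 g1 (\<lambda>j. \<Sum>i\<in>?I. v (\<omega> i) j) (v (\<omega> i)))" if "i \<in> ?I" for i
  proof (rule Bochner_Integration.integrable_bound)
    have "integrable (iid ?I P) (\<lambda>\<omega>. v (\<omega> i) j)" if "j \<in> J" for j
    proof -
      have "integrable (distr (iid ?I P) P (\<lambda>\<omega>. \<omega> i)) (\<lambda>x. v x j)"
        using \<open>i \<in> ?I\<close> v_int[OF that] by (subst distr_PiM_component) (auto intro: prob_space_axioms)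
      then show ?thesis using \<open>i \<in> ?I\<close> by (subst (asm) integrable_distr_eq) (auto intro: v_meas that)
    qed
    then show "integrable (iid ?I P) (\<lambda>\<omega>. c1 * (\<Sum>j\<in>J. \<bar>v (\<omega> i) j\<bar>))"
      by (intro integrable_mult_right Bochner_Integration.integrable_sum) auto
    show "(\<lambda>\<omega>. diff1 g1 (\<lambda>j. \<Sum>i\<in>?I. v (\<omega> i) j) (v (\<omega> i))) \<in> borel_measurable (iid ?I P)"
      unfolding diff1_def
      by (intro borel_measurable_times measurable_compose[OF lse_measurable g_meas(1)] mom_measurable
        sum_meas v_comp_meas measurable_component_singleton that)
    show "AE \<omega> in iid ?I P. norm (diff1 g1 (\<lambda>j. \<Sum>i\<in>?I. v (\<omega> i) j) (v (\<omega> i))) \<le> norm (c1 * (\<Sum>j\<in>J. \<bar>v (\<omega> i) j\<bar>))"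
      using b1 c_nonneg by (intro always_eventually allI) (auto simp: diff1_def abs_mult sum_nonneg simp del: One_nat_def sum.lessThan_Suc intro!: mult_mono mom1_le_sum)
  qed
  have term_low: "c * (\<integral>\<omega>. g2 (lse (\<lambda>j. \<Sum>i<n. v (\<omega> i) j)) \<partial>iid {..<n} P) - \<kappa> / 2 * M
     \<le> (\<integral>\<omega>. diff1 g1 (\<lambda>j. \<Sum>i\<in>?I. v (\<omega> i) j) (v (\<omega> i)) \<partial>iid ?I P)" if i: "i \<in> ?I" for i
  proof -
    let ?K = "?I - {i}"
    have ins: "insert i ?K = ?I" using i by auto
    interpret K: prob_space "iid ?K P" by (rule prob_PiM)
    interpret PK: pair_prob_space P "iid ?K P" ..
    have upd: "(\<Sum>k\<in>?I. v ((x(i := y)) k) j) = (\<Sum>k\<in>?K. v (x k) j) + v y j" for x y j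
    proof -
      have "(\<Sum>k\<in>insert i ?K. v ((x(i := y)) k) j) = v y j + (\<Sum>k\<in>?K. v ((x(i := y)) k) j)"
        by (subst sum.insert) auto
      also have "(\<Sum>k\<in>?K. v ((x(i := y)) k) j) = (\<Sum>k\<in>?K. v (x k) j)" by (intro sum.cong) auto
      finally show ?thesis unfolding ins by (simp only: add.commute)
    qed
    have e: "(\<integral>\<omega>. diff1 g1 (\<lambda>j. \<Sum>i\<in>?I. v (\<omega> i) j) (v (\<omega> i)) \<partial>iid (insert i ?K) P) =
       (\<integral>x. \<integral>y. diff1 g1 (\<lambda>j. \<Sum>k\<in>?I. v ((x(i := y)) k) j) (v ((x(i:=y)) i)) \<partial>P \<partial>iid ?K P)"
      by (rule PI.product_integral_insert) (use term_int[OF i] ins in auto)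
    let ?L = "\<lambda>x. \<integral>y. diff1 g1 (\<lambda>j. (\<Sum>k\<in>?K. v (x k) j) + v y j) (v y) \<partial>P"
    have e': "(\<integral>\<omega>. diff1 g1 (\<lambda>j. \<Sum>i\<in>?I. v (\<omega> i) j) (v (\<omega> i)) \<partial>iid ?I P) = (\<integral>x. ?L x \<partial>iid ?K P)"
      using e unfolding upd fun_upd_same ins .
    have L_int: "integrable (iid ?K P) ?L"
    proof (rule PK.integrable_snd[of "\<lambda>y x. diff1 g1 (\<lambda>j. (\<Sum>k\<in>?K. v (x k) j) + v y j) (v y)"], unfold case_prod_beta,
        rule Bochner_Integration.integrable_bound)
      have "integrable (P \<Otimes>\<^sub>M iid ?K P) (\<lambda>z. v (fst z) j)" if "j \<in> J" for j
      proof -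
        have "integrable (distr (P \<Otimes>\<^sub>M iid ?K P) P fst) (\<lambda>x. v x j)"
          using v_int[OF that] by (simp add: K.distr_pair_fst)
        then show ?thesis by (subst (asm) integrable_distr_eq) (auto intro: v_meas that)
      qed
      then show "integrable (P \<Otimes>\<^sub>M iid ?K P) (\<lambda>z. c1 * (\<Sum>j\<in>J. \<bar>v (fst z) j\<bar>))"
        by (intro integrable_mult_right Bochner_Integration.integrable_sum) auto
      show "(\<lambda>z. diff1 g1 (\<lambda>j. (\<Sum>k\<in>?K. v (snd z k) j) + v (fst z) j) (v (fst z))) \<in> borel_measurable (P \<Otimes>\<^sub>M iid ?K P)"
        unfolding diff1_def
        by (intro borel_measurable_times measurable_compose[OF lse_measurable g_meas(1)] mom_measurable
          borel_measurable_add borel_measurable_sum v_comp_meas measurable_fst measurable_compose[OF measurable_snd]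
          measurable_component_singleton)
      show "AE z in P \<Otimes>\<^sub>M iid ?K P. norm (diff1 g1 (\<lambda>j. (\<Sum>k\<in>?K. v (snd z k) j) + v (fst z) j) (v (fst z)))
          \<le> norm (c1 * (\<Sum>j\<in>J. \<bar>v (fst z) j\<bar>))"
        using b1 c_nonneg by (intro always_eventually allI) (auto simp: diff1_def abs_mult sum_nonneg simp del: One_nat_def sum.lessThan_Suc intro!: mult_mono mom1_le_sum)
    qed
    \<comment> \<open>The sum with the i-th term left out has the law of the sum over
      \<open>{..<n}\<close>, so all \<open>Suc n\<close> terms receive the same lower bound.\<close>
    have "c * (\<integral>\<omega>. g2 (lse (\<lambda>j. \<Sum>i<n. v (\<omega> i) j)) \<partial>iid {..<n} P) - \<kappa> / 2 * M =
       c * (\<integral>\<omega>. g2 (lse (\<lambda>j. \<Sum>i\<in>?K. v (\<omega> i) j)) \<partial>iid ?K P) - \<kappa> / 2 * M"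
    proof -
      have "(\<lambda>\<omega>. g2 (lse (\<lambda>j. \<Sum>i<n. v (\<omega> i) j))) \<in> borel_measurable (iid {..<n} P)"
        using g2_int by (rule borel_measurable_integrable)
      then show ?thesis
        using integral_PiM_reindex_sum[of P ?K "{..<n}" "\<lambda>s. g2 (lse s)" v] i by (simp add: prob_space_axioms)
    qed
    also have "\<dots> = (\<integral>\<omega>. c * g2 (lse (\<lambda>j. \<Sum>i\<in>?K. v (\<omega> i) j)) - \<kappa> / 2 * M \<partial>iid ?K P)"
      using g2_int by (simp add: K.prob_space)
    also have "\<dots> \<le> (\<integral>x. ?L x \<partial>iid ?K P)"
      using g2_int by (intro integral_mono L_int low) auto
    finally show ?thesis unfolding e' .
  qed
  have "real (Suc n) * (c * (\<integral>\<omega>. g2 (lse (\<lambda>j. \<Sum>i<n. v (\<omega> i) j)) \<partial>iid {..<n} P) - \<kappa> / 2 * M)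
    = (\<Sum>i\<in>?I. c * (\<integral>\<omega>. g2 (lse (\<lambda>j. \<Sum>i<n. v (\<omega> i) j)) \<partial>iid {..<n} P) - \<kappa> / 2 * M)" by simp
  also have "\<dots> \<le> (\<Sum>i\<in>?I. \<integral>\<omega>. diff1 g1 (\<lambda>j. \<Sum>i\<in>?I. v (\<omega> i) j) (v (\<omega> i)) \<partial>iid ?I P)"
    by (intro sum_mono term_low)
  also have "\<dots> = (\<integral>\<omega>. (\<Sum>i\<in>?I. diff1 g1 (\<lambda>j. \<Sum>i\<in>?I. v (\<omega> i) j) (v (\<omega> i))) \<partial>iid ?I P)"
    by (rule Bochner_Integration.integral_sum[symmetric]) (rule term_int)
  also have "\<dots> = (\<integral>\<omega>. diff1 g1 (\<lambda>j. \<Sum>i\<in>?I. v (\<omega> i) j) (\<lambda>j. \<Sum>i\<in>?I. v (\<omega> i) j) \<partial>iid ?I P)"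
    unfolding diff1_def mom1_sum sum_distrib_left ..
  finally show ?thesis .
qed

end

section \<open>Anti-concentration and comparison of maxima\<close>

context summand begin

lemma exp_sum_expectation:
  fixes l a :: real
  assumes I: "finite I" and j: "j \<in> J" and int: "integrable P (\<lambda>x. exp (l * v x j))"
    and le: "(\<integral>x. exp (l * v x j) \<partial>P) \<le> exp a"
  shows "integrable (iid I P) (\<lambda>\<omega>. exp (l * (\<Sum>i\<in>I. v (\<omega> i) j)))"
    and "(\<integral>\<omega>. exp (l * (\<Sum>i\<in>I. v (\<omega> i) j)) \<partial>iid I P) \<le> exp (card I * a)"
proof -
  interpret PI: product_sigma_finite "\<lambda>_. P" by (rule psf)
  have eq: "exp (l * (\<Sum>i\<in>I. v (\<omega> i) j)) = (\<Prod>i\<in>I. exp (l * v (\<omega> i) j))" for \<omega>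
    using I by (simp add: sum_distrib_left exp_sum)
  show "integrable (iid I P) (\<lambda>\<omega>. exp (l * (\<Sum>i\<in>I. v (\<omega> i) j)))"
    unfolding eq by (rule PI.product_integrable_prod[OF I int])
  have "(\<integral>\<omega>. exp (l * (\<Sum>i\<in>I. v (\<omega> i) j)) \<partial>iid I P) = (\<Prod>i\<in>I. \<integral>x. exp (l * v x j) \<partial>P)"
    unfolding eq by (rule PI.product_integral_prod[OF I int])
  also have "\<dots> \<le> (\<Prod>i\<in>I. exp a)" using le by (intro prod_mono) auto
  also have "\<dots> = exp (card I * a)" by (simp add: exp_of_nat_mult)
  finally show "(\<integral>\<omega>. exp (l * (\<Sum>i\<in>I. v (\<omega> i) j)) \<partial>iid I P) \<le> exp (card I * a)" .
qed

end

context summand_test begin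

text \<open>A maximal inequality through exponential moments: each
  \<open>exp (l * \<bar>S j\<bar>)\<close> is at most the random sum \<open>E\<close>, and the
  tangent line of the logarithm at \<open>K\<close> plays the part of Jensen's inequality. Its value
  depends on the size of \<open>J\<close> only logarithmically.\<close>

lemma diff1_sum_upper:
  fixes l a :: real
  assumes l: "l > 0"
    and int: "\<And>j. j \<in> J \<Longrightarrow> integrable P (\<lambda>x. exp (l * v x j))" "\<And>j. j \<in> J \<Longrightarrow> integrable P (\<lambda>x. exp (- l * v x j))"
    and le: "\<And>j. j \<in> J \<Longrightarrow> (\<integral>x. exp (l * v x j) \<partial>P) \<le> exp a" "\<And>j. j \<in> J \<Longrightarrow> (\<integral>x. exp (- l * v x j) \<partial>P) \<le> exp a"
    and I: "finite I"
  shows "(\<integral>\<omega>. diff1 g1 (\<lambda>j. \<Sum>i\<in>I. v (\<omega> i) j) (\<lambda>j. \<Sum>i\<in>I. v (\<omega> i) j) \<partial>iid I P)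
    \<le> c1 / l * (ln (2 * card J) + card I * a)"
proof -
  interpret S: prob_space "iid I P" by (rule prob_PiM)
  let ?S = "\<lambda>\<omega> j. \<Sum>i\<in>I. v (\<omega> i) j"
  define E where "E \<omega> = (\<Sum>j\<in>J. exp (l * ?S \<omega> j) + exp (- l * ?S \<omega> j))" for \<omega>
  define K where "K = 2 * card J * exp (card I * a)"
  have cJ: "real (card J) > 0" using finite_J J_ne by (simp add: card_gt_0_iff)
  then have K0: "K > 0" by (simp add: K_def)
  have lnK: "ln K = ln (2 * card J) + card I * a" using cJ by (simp add: K_def ln_mult)
  have E_int: "integrable (iid I P) E"
    unfolding E_def
    by (intro Bochner_Integration.integrable_sum Bochner_Integration.integrable_add exp_sum_expectation(1)[OF I _ int(1) le(1)] exp_sum_expectation(1)[OF I _ int(2) le(2)])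
  have E_le: "(\<integral>\<omega>. E \<omega> \<partial>iid I P) \<le> K"
  proof -
    have "(\<integral>\<omega>. E \<omega> \<partial>iid I P) = (\<Sum>j\<in>J. (\<integral>\<omega>. exp (l * ?S \<omega> j) \<partial>iid I P) + (\<integral>\<omega>. exp (- l * ?S \<omega> j) \<partial>iid I P))"
      unfolding E_def
      using exp_sum_expectation(1)[OF I _ int(1) le(1)] exp_sum_expectation(1)[OF I _ int(2) le(2)] by simp
    also have "\<dots> \<le> (\<Sum>j\<in>J. exp (card I * a) + exp (card I * a))"
      by (intro sum_mono add_mono exp_sum_expectation(2)[OF I _ int(1) le(1)] exp_sum_expectation(2)[OF I _ int(2) le(2)])
    finally show ?thesis by (simp add: K_def)
  qed
  have pt: "diff1 g1 (?S \<omega>) (?S \<omega>) \<le> c1 / l * (ln K + E \<omega> / K - 1)" for \<omega>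
  proof -
    have "l * \<bar>?S \<omega> j\<bar> \<le> ln K + E \<omega> / K - 1" if j: "j \<in> J" for j
    proof -
      have "exp (l * \<bar>?S \<omega> j\<bar>) \<le> exp (l * ?S \<omega> j) + exp (- l * ?S \<omega> j)"
        by (cases "?S \<omega> j \<ge> 0") auto
      also have "\<dots> \<le> E \<omega>" unfolding E_def
        using member_le_sum[OF j, of "\<lambda>j. exp (l * ?S \<omega> j) + exp (- l * ?S \<omega> j)"] finite_J by (auto simp: add_nonneg_nonneg)
      finally have "exp (l * \<bar>?S \<omega> j\<bar> - ln K) \<le> E \<omega> / K"
        using K0 by (simp add: exp_diff divide_right_mono)
      then show ?thesis using exp_ge_add_one_self[of "l * \<bar>?S \<omega> j\<bar> - ln K"] by linarith
    qed
    then have "(\<Sum>j\<in>J. weight (?S \<omega>) j * (l * \<bar>?S \<omega> j\<bar>)) \<le> (\<Sum>j\<in>J. weight (?S \<omega>) j * (ln K + E \<omega> / K - 1))"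
      by (intro sum_mono mult_left_mono weight_nonneg)
    also have "\<dots> = ln K + E \<omega> / K - 1" by (simp add: sum_distrib_right[symmetric] sum_weight)
    finally have *: "l * (\<Sum>j\<in>J. weight (?S \<omega>) j * \<bar>?S \<omega> j\<bar>) \<le> ln K + E \<omega> / K - 1"
      by (simp add: sum_distrib_left mult_ac)
    have "diff1 g1 (?S \<omega>) (?S \<omega>) \<le> \<bar>g1 (lse (?S \<omega>))\<bar> * \<bar>mom 1 (?S \<omega>) (?S \<omega>)\<bar>"
      unfolding diff1_def abs_mult[symmetric] by (rule abs_ge_self)
    also have "\<dots> \<le> c1 * (\<Sum>j\<in>J. weight (?S \<omega>) j * \<bar>?S \<omega> j\<bar>)"
    proof (intro mult_mono b1)
      show "\<bar>mom 1 (?S \<omega>) (?S \<omega>)\<bar> \<le> (\<Sum>j\<in>J. weight (?S \<omega>) j * \<bar>?S \<omega> j\<bar>)"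
        unfolding mom_def by (rule sum_abs[THEN order_trans]) (simp add: abs_mult weight_nonneg)
    qed (use c_nonneg in auto)
    also have "\<dots> \<le> c1 * ((ln K + E \<omega> / K - 1) / l)"
      using * l c_nonneg by (intro mult_left_mono) (auto simp: pos_le_divide_eq mult.commute)
    finally show ?thesis by simp
  qed
  have "(\<integral>\<omega>. diff1 g1 (?S \<omega>) (?S \<omega>) \<partial>iid I P) \<le> (\<integral>\<omega>. c1 / l * (ln K + E \<omega> / K - 1) \<partial>iid I P)"
  proof (cases "integrable (iid I P) (\<lambda>\<omega>. diff1 g1 (?S \<omega>) (?S \<omega>))")
    case True
    then show ?thesis using E_int by (intro integral_mono pt) auto
  next
    case False
    \<comment> \<open>A nonintegrable function has integral 0 by convention, so nonnegativity of the
      majorant suffices. It follows from ln z \<le> z - 1 at z = E / K together with E \<ge>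
      1.\<close>
    have "0 \<le> c1 / l * (ln K + E \<omega> / K - 1)" for \<omega>
    proof -
      have "1 + (ln (E \<omega> / K)) \<le> E \<omega> / K"
      proof -
        have "E \<omega> > 0" unfolding E_def using finite_J J_ne by (intro sum_pos) (auto simp: add_pos_pos)
        then show ?thesis using ln_le_minus_one[of "E \<omega> / K"] K0 by simp
      qed
      moreover have E1: "1 \<le> E \<omega>"
      proof -
        obtain j where j: "j \<in> J" using J_ne by auto
        have "1 \<le> exp (l * ?S \<omega> j) + exp (- l * ?S \<omega> j)"
          using exp_ge_add_one_self[of "l * ?S \<omega> j"] exp_ge_add_one_self[of "- l * ?S \<omega> j"] by linarith
        also have "\<dots> \<le> E \<omega>" unfolding E_def
          using member_le_sum[OF j, of "\<lambda>j. exp (l * ?S \<omega> j) + exp (- l * ?S \<omega> j)"] finite_J by (auto simp: add_nonneg_nonneg)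
        finally show ?thesis .
      qed
      moreover have "ln (E \<omega> / K) = ln (E \<omega>) - ln K"
        using K0 E1 by (simp add: ln_div)
      ultimately have "0 \<le> ln K + E \<omega> / K - 1"
        using ln_ge_zero[of "E \<omega>"] by linarith
      then show ?thesis using l c_nonneg by simp
    qed
    then have "0 \<le> (\<integral>\<omega>. c1 / l * (ln K + E \<omega> / K - 1) \<partial>iid I P)" by (intro Bochner_Integration.integral_nonneg) auto
    then show ?thesis unfolding not_integrable_integral_eq[OF False] .
  qed
  also have "\<dots> = c1 / l * (ln K + (\<integral>\<omega>. E \<omega> \<partial>iid I P) / K - 1)"
    using E_int by (simp add: S.prob_space)
  also have "\<dots> \<le> c1 / l * (ln K + 1 - 1)"
    using E_le K0 l c_nonneg by (intro mult_left_mono diff_mono add_mono) (auto simp: divide_le_eq_1)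
  finally show ?thesis by (simp add: lnK)
qed

end

lemma spline_scaled_deriv:
  "((\<lambda>x. spline (Suc (Suc k)) (\<psi> * (x - t))) has_real_derivative \<psi> * spline (Suc k) (\<psi> * (x - t))) (at x)"
  by (rule DERIV_cong[OF DERIV_chain2[OF spline_deriv]]) (auto intro!: derivative_eq_intros)

context summand begin

lemma sum_lse_meas: "(\<lambda>\<omega>. lse (\<lambda>j. \<Sum>i\<in>I. v (\<omega> i) j)) \<in> borel_measurable (iid I P)"
  by (intro lse_measurable sum_meas)

text \<open>The same expectation is bounded below by the mass of the window (Stein) and above by the
  size of the maximum. The bound \<open>1 / \<beta> + 1 / \<psi>\<close> on the test function makes
  the main term the window width times that size.\<close>

lemma anticoncentration:
  fixes l a c \<psi> t :: real and n :: nat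
  assumes l: "l > 0" and n: "n > 0" and psi: "\<psi> > 0"
    and int: "\<And>j. j \<in> J \<Longrightarrow> integrable P (\<lambda>x. exp (l * v x j))" "\<And>j. j \<in> J \<Longrightarrow> integrable P (\<lambda>x. exp (- l * v x j))"
    and le: "\<And>j. j \<in> J \<Longrightarrow> (\<integral>x. exp (l * v x j) \<partial>P) \<le> exp a" "\<And>j. j \<in> J \<Longrightarrow> (\<integral>x. exp (- l * v x j) \<partial>P) \<le> exp a"
    and var: "\<And>j. j \<in> J \<Longrightarrow> c \<le> (\<integral>x. v x j * v x j \<partial>P)" and c: "c \<ge> 0"
  shows "n * c * measure (iid {..<n} P)
      {\<omega>\<in>space (iid {..<n} P). t \<le> lse (\<lambda>j. \<Sum>i<n. v (\<omega> i) j) \<and> lse (\<lambda>j. \<Sum>i<n. v (\<omega> i) j) \<le> t + 2 / \<psi>}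
    \<le> 12 * ((1 / \<beta> + 1 / \<psi>) / l * (ln (2 * card J) + Suc n * a)
       + n * (2 * \<psi> + 6 * \<beta> + 6 * \<beta>\<^sup>2 * (1 / \<beta> + 1 / \<psi>)) * M)"
proof -
  \<comment> \<open>Starting one unit of \<open>1 / \<psi>\<close> before \<open>t\<close> puts the
    window onto the interval from 1 to 3 in the spline variable, where \<open>spline3_ge\<close>
    applies.\<close>
  let ?u = "t - 1 / \<psi>"
  \<comment> \<open>The offset \<open>1 / \<beta>\<close> gives \<beta> \<open>?g1\<close> \<ge> 1,
    hence \<beta> \<open>?g1\<close> \<ge> \<open>?g2\<close> as the Stein bound requires, also to
    the left of the step.\<close>
  let ?g1 = "\<lambda>x. 1 / \<beta> + spline 4 (\<psi> * (x - ?u)) / \<psi>"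
  let ?g2 = "\<lambda>x. spline 3 (\<psi> * (x - ?u))"
  let ?g3 = "\<lambda>x. \<psi> * spline 2 (\<psi> * (x - ?u))"
  interpret T: test_fun ?g1 ?g2 ?g3 "1 / \<beta> + 1 / \<psi>" 1 "2 * \<psi>"
  proof
    fix x
    show "(?g1 has_real_derivative ?g2 x) (at x)"
      using spline_scaled_deriv[of 2 \<psi> ?u x] psi
      by (auto intro!: derivative_eq_intros simp: numeral_eq_Suc)
    show "(?g2 has_real_derivative ?g3 x) (at x)"
      using spline_scaled_deriv[of 1 \<psi> ?u x] by (simp add: numeral_eq_Suc)
    show "\<bar>?g1 x\<bar> \<le> 1 / \<beta> + 1 / \<psi>"
      using psi beta_pos spline4_bounds[of "\<psi> * (x - ?u)"] by (simp add: abs_of_nonneg divide_right_mono)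
    show "\<bar>?g2 x\<bar> \<le> 1"
      using spline3_le spline3_nonneg by (simp add: abs_of_nonneg)
    show "\<bar>?g3 x\<bar> \<le> 2 * \<psi>"
      using mult_left_mono[OF spline2_bound[of "\<psi> * (x - ?u)"], of \<psi>] psi by (simp add: abs_mult)
  qed
  interpret ST: summand_test J \<beta> P v M ?g1 ?g2 ?g3 "1 / \<beta> + 1 / \<psi>" 1 "2 * \<psi>" ..
  let ?F = "\<lambda>\<omega>. lse (\<lambda>j. \<Sum>i<n. v (\<omega> i) j)"
  let ?Pn = "iid {..<n} P"
  interpret Pn: prob_space ?Pn by (rule prob_PiM)
  have k: "ST.\<kappa> = 2 * \<psi> + 6 * \<beta> + 6 * \<beta>\<^sup>2 * (1 / \<beta> + 1 / \<psi>)" by simp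
  have "?g2 x \<le> \<beta> * ?g1 x" for x
  proof -
    have "\<beta> * ?g1 x = 1 + \<beta> * spline 4 (\<psi> * (x - ?u)) / \<psi>" using beta_pos by (simp add: distrib_left)
    moreover have "0 \<le> \<beta> * spline 4 (\<psi> * (x - ?u)) / \<psi>" using beta_pos psi spline4_bounds by simp
    ultimately show ?thesis using spline3_le[of "\<psi> * (x - ?u)"] by linarith
  qed
  then have "real (Suc n) * (c * (\<integral>\<omega>. ?g2 (?F \<omega>) \<partial>?Pn) - ST.\<kappa> / 2 * M)
     \<le> (1 / \<beta> + 1 / \<psi>) / l * (ln (2 * card J) + card {..<Suc n} * a)"
    by (intro order_trans[OF ST.stein_lower_bound ST.diff1_sum_upper[OF l]] spline3_nonneg var int le finite_lessThan)
  then have *: "real (Suc n) * (c * (\<integral>\<omega>. ?g2 (?F \<omega>) \<partial>?Pn)) \<le> (1 / \<beta> + 1 / \<psi>) / l * (ln (2 * card J) + Suc n * a) + Suc n * (ST.\<kappa> / 2 * M)"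
    unfolding card_lessThan right_diff_distrib by linarith
  have I0: "0 \<le> c * (\<integral>\<omega>. ?g2 (?F \<omega>) \<partial>?Pn)" using c spline3_nonneg by (intro mult_nonneg_nonneg Bochner_Integration.integral_nonneg) auto
  have h1: "n * (c * (\<integral>\<omega>. ?g2 (?F \<omega>) \<partial>?Pn)) \<le> Suc n * (c * (\<integral>\<omega>. ?g2 (?F \<omega>) \<partial>?Pn))"
    using I0 by (intro mult_right_mono) auto
  \<comment> \<open>Bounding \<open>Suc n\<close> by twice n absorbs the extra summand; the factor 2
    cancels the 1 / 2 of the Stein remainder.\<close>
  have h2: "Suc n * (ST.\<kappa> / 2 * M) \<le> (2 * n) * (ST.\<kappa> / 2 * M)"
    using n ST.kappa_nonneg M_nonneg by (intro mult_right_mono) auto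
  note h1
  also note *
  also note add_left_mono[OF h2]
  also have "real (2 * n) * (ST.\<kappa> / 2 * M) = n * ST.\<kappa> * M" by simp
  finally have 1: "n * (c * (\<integral>\<omega>. ?g2 (?F \<omega>) \<partial>?Pn)) \<le> (1 / \<beta> + 1 / \<psi>) / l * (ln (2 * card J) + Suc n * a) + n * ST.\<kappa> * M" .
  let ?A = "{\<omega>\<in>space ?Pn. t \<le> ?F \<omega> \<and> ?F \<omega> \<le> t + 2 / \<psi>}"
  have mA: "?A \<in> sets ?Pn"
    using sum_lse_meas[of "{..<n}"] by measurable
  have "measure ?Pn ?A / 12 = (\<integral>\<omega>. indicator ?A \<omega> / 12 \<partial>?Pn)"
    using mA by (simp add: Pn.emeasure_eq_measure)
  also have "\<dots> \<le> (\<integral>\<omega>. ?g2 (?F \<omega>) \<partial>?Pn)"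
  proof (rule integral_mono)
    show "integrable ?Pn (\<lambda>\<omega>. indicator ?A \<omega> / 12 :: real)" using mA by (simp add: Pn.emeasure_eq_measure)
    show "integrable ?Pn (\<lambda>\<omega>. ?g2 (?F \<omega>))"
      by (rule Pn.integrable_const_bound[of _ 1])
        (auto intro!: measurable_compose[OF sum_lse_meas T.g_meas(2)] AE_I2 T.b2)
    fix \<omega>
    show "indicator ?A \<omega> / 12 \<le> ?g2 (?F \<omega>)"
    proof (cases "\<omega> \<in> ?A")
      case True
      then have "1 \<le> \<psi> * (?F \<omega> - ?u)" "\<psi> * (?F \<omega> - ?u) \<le> 3"
      proof -
        have e: "\<psi> * (?F \<omega> - ?u) = \<psi> * (?F \<omega> - t) + 1"
          using psi by (simp add: right_diff_distrib)
        have "0 \<le> \<psi> * (?F \<omega> - t)"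
          using True psi by auto
        moreover have "\<psi> * (?F \<omega> - t) \<le> \<psi> * (2 / \<psi>)"
          by (rule mult_left_mono) (use True psi in auto)
        ultimately show "1 \<le> \<psi> * (?F \<omega> - ?u)" "\<psi> * (?F \<omega> - ?u) \<le> 3"
          unfolding e using psi by auto
      qed
      from spline3_ge[OF this] True show ?thesis by simp
    qed (simp add: spline3_nonneg)
  qed
  finally have "n * c * (measure ?Pn ?A / 12) \<le> n * c * (\<integral>\<omega>. ?g2 (?F \<omega>) \<partial>?Pn)"
    using c by (intro mult_left_mono) auto
  then show ?thesis using 1 unfolding k by (simp add: mult.assoc)
qed

end

section \<open>From smooth test functions to distribution functions\<close>

context softmax begin

text \<open>The smooth step equals 1 up to \<open>t\<close> and vanishes from
  \<open>t + 4 / \<psi>\<close> on, so it lies between two indicators. One inequality is enough, as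
  the two laws can be exchanged.\<close>

lemma lindeberg_prob:
  fixes v :: "'a \<Rightarrow> 'j \<Rightarrow> real" and w :: "'b \<Rightarrow> 'j \<Rightarrow> real" and n :: nat
  assumes P: "summand J \<beta> P v M" and Q: "summand J \<beta> Q w M'"
    and cov: "\<And>j k. j \<in> J \<Longrightarrow> k \<in> J \<Longrightarrow> (\<integral>x. v x j * v x k \<partial>P) = (\<integral>x. w x j * w x k \<partial>Q)"
    and psi: "\<psi> > 0"
  shows "measure (iid {..<n} P) {\<omega>\<in>space (iid {..<n} P). lse (\<lambda>j. \<Sum>i<n. v (\<omega> i) j) \<le> t}
    \<le> measure (iid {..<n} Q) {\<omega>\<in>space (iid {..<n} Q). lse (\<lambda>j. \<Sum>i<n. w (\<omega> i) j) \<le> t + 4 / \<psi>}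
      + n * ((2 * \<psi>^3 + 12 * \<beta> * \<psi>\<^sup>2 + 6 * \<beta>\<^sup>2 * \<psi>) / 6 * (M + M'))"
proof -
  interpret P: summand J \<beta> P v M by fact
  interpret Q: summand J \<beta> Q w M' by fact
  let ?g0 = "\<lambda>x. 1 - spline 4 (\<psi> * (x - t))"
  let ?g1 = "\<lambda>x. - (\<psi> * spline 3 (\<psi> * (x - t)))"
  let ?g2 = "\<lambda>x. - (\<psi>\<^sup>2 * spline 2 (\<psi> * (x - t)))"
  let ?g3 = "\<lambda>x. - (\<psi>^3 * spline 1 (\<psi> * (x - t)))"
  have T: "test_fun ?g1 ?g2 ?g3 \<psi> (2 * \<psi>\<^sup>2) (2 * \<psi>^3)"
  proof
    fix x
    show "(?g1 has_real_derivative ?g2 x) (at x)"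
      using DERIV_minus[OF DERIV_cmult[OF spline_scaled_deriv[of 1 \<psi> t x], of \<psi>]]
      by (simp add: numeral_eq_Suc mult_ac)
    show "(?g2 has_real_derivative ?g3 x) (at x)"
      using DERIV_minus[OF DERIV_cmult[OF spline_scaled_deriv[of 0 \<psi> t x], of "\<psi>\<^sup>2"]]
      by (simp add: numeral_eq_Suc mult_ac)
    show "\<bar>?g1 x\<bar> \<le> \<psi>"
      using mult_left_mono[OF spline3_le[of "\<psi> * (x - t)"], of \<psi>] psi spline3_nonneg[of "\<psi> * (x - t)"] by (simp add: abs_mult)
    show "\<bar>?g2 x\<bar> \<le> 2 * \<psi>\<^sup>2"
      using mult_left_mono[OF spline2_bound[of "\<psi> * (x - t)"], of "\<psi>\<^sup>2"] psi by (simp add: abs_mult)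
    show "\<bar>?g3 x\<bar> \<le> 2 * \<psi>^3"
      using mult_left_mono[OF spline1_bound[of "\<psi> * (x - t)"], of "\<psi>^3"] psi by (simp add: abs_mult)
  qed
  have d0: "(?g0 has_real_derivative ?g1 x) (at x)" for x
    using DERIV_diff[OF DERIV_const[of 1] spline_scaled_deriv[of 2 \<psi> t x]] by (simp add: numeral_eq_Suc)
  have b0: "\<bar>?g0 x\<bar> \<le> 1" for x using spline4_bounds[of "\<psi> * (x - t)"] by simp
  have g0m: "?g0 \<in> borel_measurable borel"
    using d0 by (auto intro!: borel_measurable_continuous_onI continuous_at_imp_continuous_on intro: DERIV_isCont)
  let ?Pn = "iid {..<n} P" and ?Qn = "iid {..<n} Q"
  interpret Pn: prob_space ?Pn by (rule P.prob_PiM)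
  interpret Qn: prob_space ?Qn by (rule Q.prob_PiM)
  let ?F = "\<lambda>\<omega>. lse (\<lambda>j. \<Sum>i<n. v (\<omega> i) j)" and ?G = "\<lambda>\<omega>. lse (\<lambda>j. \<Sum>i<n. w (\<omega> i) j)"
  let ?A = "{\<omega>\<in>space ?Pn. ?F \<omega> \<le> t}" and ?B = "{\<omega>\<in>space ?Qn. ?G \<omega> \<le> t + 4 / \<psi>}"
  have mA: "?A \<in> sets ?Pn" using P.sum_lse_meas[of "{..<n}"] by measurable
  have mB: "?B \<in> sets ?Qn" using Q.sum_lse_meas[of "{..<n}"] by measurable
  have "measure ?Pn ?A = (\<integral>\<omega>. indicator ?A \<omega> \<partial>?Pn)"
    using mA by simp
  also have "\<dots> \<le> (\<integral>\<omega>. ?g0 (?F \<omega>) \<partial>?Pn)"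
  proof (rule integral_mono)
    show "integrable ?Pn (\<lambda>\<omega>. indicator ?A \<omega> :: real)" using mA by (simp add: Pn.emeasure_eq_measure)
    show "integrable ?Pn (\<lambda>\<omega>. ?g0 (?F \<omega>))"
      by (rule Pn.integrable_const_bound[of _ 1])
        (use b0 in \<open>auto intro!: measurable_compose[OF P.sum_lse_meas g0m] AE_I2\<close>)
    fix \<omega>
    show "indicator ?A \<omega> \<le> ?g0 (?F \<omega>)"
    proof (cases "\<omega> \<in> ?A")
      case True
      then have "\<psi> * (?F \<omega> - t) \<le> 0" using psi by (simp add: mult_le_0_iff)
      with True show ?thesis by (simp add: spline_zero)
    qed (use spline4_bounds in simp)
  qed
  also have "\<dots> \<le> (\<integral>\<omega>. ?g0 (?G \<omega>) \<partial>?Qn) + n * ((2 * \<psi>^3 + 12 * \<beta> * \<psi>\<^sup>2 + 6 * \<beta>\<^sup>2 * \<psi>) / 6 * (M + M'))"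
    proof -
    have keq: "2 * \<psi>^3 + 6 * \<beta> * (2 * \<psi>\<^sup>2) + 6 * \<beta>\<^sup>2 * \<psi> = 2 * \<psi>^3 + 12 * \<beta> * \<psi>\<^sup>2 + 6 * \<beta>\<^sup>2 * \<psi>"
      by simp
    show ?thesis
      using lindeberg_sum[OF P Q T cov d0 b0 finite_lessThan[of n], of "\<lambda>_. 0"]
      unfolding keq add_0 card_lessThan by linarith
  qed
  also have "(\<integral>\<omega>. ?g0 (?G \<omega>) \<partial>?Qn) \<le> (\<integral>\<omega>. indicator ?B \<omega> \<partial>?Qn)"
  proof (rule integral_mono)
    show "integrable ?Qn (\<lambda>\<omega>. indicator ?B \<omega> :: real)" using mB by (simp add: Qn.emeasure_eq_measure)
    show "integrable ?Qn (\<lambda>\<omega>. ?g0 (?G \<omega>))"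
      by (rule Qn.integrable_const_bound[of _ 1])
        (use b0 in \<open>auto intro!: measurable_compose[OF Q.sum_lse_meas g0m] AE_I2\<close>)
    fix \<omega> assume w: "\<omega> \<in> space ?Qn"
    show "?g0 (?G \<omega>) \<le> indicator ?B \<omega>"
    proof (cases "\<omega> \<in> ?B")
      case False
      then have "4 \<le> \<psi> * (?G \<omega> - t)" using psi w by (simp add: field_simps)
      with False show ?thesis by (simp add: spline4_one)
    qed (use spline4_bounds in simp)
  qed
  also have "(\<integral>\<omega>. indicator ?B \<omega> \<partial>?Qn) = measure ?Qn ?B" using mB by simp
  finally show ?thesis by simp
qed

text \<open>In both directions the whole loss (approximation, bias of the soft maximum, smoothing)
  is spent as a shift on the \<open>Q\<close> side. Anti-concentration is therefore demanded of
  \<open>Q\<close> only, which will be the Gaussian side, and \<open>T\<close> need only be close to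
  the sum outside \<open>R\<close>.\<close>

lemma max_comparison:
  fixes v :: "'a \<Rightarrow> 'j \<Rightarrow> real" and w :: "'b \<Rightarrow> 'j \<Rightarrow> real" and n :: nat
  assumes P: "summand J \<beta> P v M" and Q: "summand J \<beta> Q w M'"
    and cov: "\<And>j k. j \<in> J \<Longrightarrow> k \<in> J \<Longrightarrow> (\<integral>x. v x j * v x k \<partial>P) = (\<integral>x. w x j * w x k \<partial>Q)"
    and psi: "\<psi> > 0" and R: "R \<in> sets (iid {..<n} P)"
    and R_close: "\<And>\<omega> j. \<omega> \<in> space (iid {..<n} P) - R \<Longrightarrow> j \<in> J \<Longrightarrow> \<bar>T \<omega> j - (\<Sum>i<n. v (\<omega> i) j)\<bar> \<le> \<Delta>"
    and T: "\<And>j. j \<in> J \<Longrightarrow> (\<lambda>\<omega>. T \<omega> j) \<in> borel_measurable (iid {..<n} P)"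
    and width: "\<Delta> + ln (card J) / \<beta> + 4 / \<psi> \<le> \<delta>"
    and ac: "\<And>t. measure (iid {..<n} Q) {\<omega>\<in>space (iid {..<n} Q). t \<le> lse (\<lambda>j. \<Sum>i<n. w (\<omega> i) j)
        \<and> lse (\<lambda>j. \<Sum>i<n. w (\<omega> i) j) \<le> t + \<delta>} \<le> \<epsilon>"
  shows "\<bar>measure (iid {..<n} P) {\<omega>\<in>space (iid {..<n} P). \<forall>j\<in>J. T \<omega> j \<le> t}
      - measure (iid {..<n} Q) {\<omega>\<in>space (iid {..<n} Q). \<forall>j\<in>J. (\<Sum>i<n. w (\<omega> i) j) \<le> t}\<bar>
    \<le> n * ((2 * \<psi>^3 + 12 * \<beta> * \<psi>\<^sup>2 + 6 * \<beta>\<^sup>2 * \<psi>) / 6 * (M + M')) + \<epsilon> + measure (iid {..<n} P) R"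
proof -
  interpret P: summand J \<beta> P v M by fact
  interpret Q: summand J \<beta> Q w M' by fact
  let ?Pn = "iid {..<n} P" and ?Qn = "iid {..<n} Q"
  interpret Pn: prob_space ?Pn by (rule P.prob_PiM)
  interpret Qn: prob_space ?Qn by (rule Q.prob_PiM)
  let ?F = "\<lambda>\<omega>. lse (\<lambda>j. \<Sum>i<n. v (\<omega> i) j)" and ?G = "\<lambda>\<omega>. lse (\<lambda>j. \<Sum>i<n. w (\<omega> i) j)"
  let ?ell = "ln (card J) / \<beta>"
  let ?A = "{\<omega>\<in>space ?Pn. \<forall>j\<in>J. T \<omega> j \<le> t}" and ?B = "{\<omega>\<in>space ?Qn. \<forall>j\<in>J. (\<Sum>i<n. w (\<omega> i) j) \<le> t}"
  let ?FA = "\<lambda>t. {\<omega>\<in>space ?Pn. ?F \<omega> \<le> t}" and ?GB = "\<lambda>t. {\<omega>\<in>space ?Qn. ?G \<omega> \<le> t}"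
  let ?W = "\<lambda>t. {\<omega>\<in>space ?Qn. t \<le> ?G \<omega> \<and> ?G \<omega> \<le> t + \<delta>}"
  let ?err = "n * ((2 * \<psi>^3 + 12 * \<beta> * \<psi>\<^sup>2 + 6 * \<beta>\<^sup>2 * \<psi>) / 6 * (M + M'))"
  have mT: "?A \<in> sets ?Pn"
  proof -
    have "{\<omega>\<in>space ?Pn. T \<omega> j \<le> t} \<in> sets ?Pn" if "j \<in> J" for j
      using T[OF that] by measurable
    then show ?thesis using finite_J by (intro sets.sets_Collect_finite_All) auto
  qed
  have mB: "?B \<in> sets ?Qn"
  proof -
    have "{\<omega>\<in>space ?Qn. (\<Sum>i<n. w (\<omega> i) j) \<le> t} \<in> sets ?Qn" if "j \<in> J" for j
      using Q.sum_meas[OF that, of "{..<n}"] by measurable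
    then show ?thesis using finite_J by (intro sets.sets_Collect_finite_All) auto
  qed
  have mF: "?FA t \<in> sets ?Pn" for t using P.sum_lse_meas[of "{..<n}"] by measurable
  have mG: "?GB t \<in> sets ?Qn" for t using Q.sum_lse_meas[of "{..<n}"] by measurable
  have mW: "?W t \<in> sets ?Qn" for t using Q.sum_lse_meas[of "{..<n}"] by measurable
  have "?A \<subseteq> ?FA (t + \<Delta> + ?ell) \<union> R"
  proof
    fix \<omega> assume w: "\<omega> \<in> ?A"
    show "\<omega> \<in> ?FA (t + \<Delta> + ?ell) \<union> R"
    proof (cases "\<omega> \<in> R")
      case False
      have "(\<Sum>i<n. v (\<omega> i) j) \<le> t + \<Delta>" if "j \<in> J" for j
        using R_close[of \<omega> j] False w that by (force simp: abs_le_iff)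
      then show ?thesis using w lse_le[of "\<lambda>j. \<Sum>i<n. v (\<omega> i) j" "t + \<Delta>"] by auto
    qed simp
  qed
  then have "measure ?Pn ?A \<le> measure ?Pn (?FA (t + \<Delta> + ?ell)) + measure ?Pn R"
    using mF R by (intro order_trans[OF Pn.finite_measure_mono measure_Un_le]) auto
  also have "measure ?Pn (?FA (t + \<Delta> + ?ell)) \<le> measure ?Qn (?GB (t + \<Delta> + ?ell + 4 / \<psi>)) + ?err"
    by (rule lindeberg_prob[OF P Q cov psi])
  also have "measure ?Qn (?GB (t + \<Delta> + ?ell + 4 / \<psi>)) \<le> measure ?Qn ?B + measure ?Qn (?W t)"
  proof -
    have "?GB (t + \<Delta> + ?ell + 4 / \<psi>) \<subseteq> ?B \<union> ?W t"
    proof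
      fix \<omega> assume w: "\<omega> \<in> ?GB (t + \<Delta> + ?ell + 4 / \<psi>)"
      show "\<omega> \<in> ?B \<union> ?W t"
      proof (cases "?G \<omega> \<le> t")
        case True
        then show ?thesis using w le_lse[of _ "\<lambda>j. \<Sum>i<n. w (\<omega> i) j"] by (auto intro: order_trans)
      next
        case False
        then show ?thesis using w width by auto
      qed
    qed
    then show ?thesis using mB mW by (intro order_trans[OF Qn.finite_measure_mono measure_Un_le]) auto
  qed
  finally have up: "measure ?Pn ?A \<le> measure ?Qn ?B + \<epsilon> + ?err + measure ?Pn R" using ac[of t] by linarith
  \<comment> \<open>Starting this low leaves \<open>4 / \<psi>\<close> for the smoothing and
    \<Delta> for the approximation, so that the return to the \<open>P\<close> side ends at the
    level \<open>t\<close>.\<close>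
  let ?t = "t - \<Delta> - 4 / \<psi>"
  have "?B \<subseteq> ?GB ?t \<union> ?W ?t"
  proof
    fix \<omega> assume w: "\<omega> \<in> ?B"
    then have "?G \<omega> \<le> t + ?ell" by (intro lse_le) auto
    then show "\<omega> \<in> ?GB ?t \<union> ?W ?t" using w width by auto
  qed
  then have "measure ?Qn ?B \<le> measure ?Qn (?GB ?t) + measure ?Qn (?W ?t)"
    using mG mW by (intro order_trans[OF Qn.finite_measure_mono measure_Un_le]) auto
  also have "measure ?Qn (?GB ?t) \<le> measure ?Pn (?FA (?t + 4 / \<psi>)) + n * ((2 * \<psi>^3 + 12 * \<beta> * \<psi>\<^sup>2 + 6 * \<beta>\<^sup>2 * \<psi>) / 6 * (M' + M))"
    using cov by (intro lindeberg_prob[OF Q P _ psi]) simp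
  also have "measure ?Pn (?FA (?t + 4 / \<psi>)) \<le> measure ?Pn ?A + measure ?Pn R"
  proof -
    have "?FA (?t + 4 / \<psi>) \<subseteq> ?A \<union> R"
    proof
      fix \<omega> assume w: "\<omega> \<in> ?FA (?t + 4 / \<psi>)"
      show "\<omega> \<in> ?A \<union> R"
      proof (cases "\<omega> \<in> R")
        case False
        have "T \<omega> j \<le> t" if "j \<in> J" for j
          using R_close[of \<omega> j] le_lse[OF that, of "\<lambda>j. \<Sum>i<n. v (\<omega> i) j"] False w that
          by (force simp: abs_le_iff)
        then show ?thesis using w by auto
      qed simp
    qed
    then show ?thesis using mT R by (intro order_trans[OF Pn.finite_measure_mono measure_Un_le]) auto
  qed
  finally have "measure ?Qn ?B \<le> measure ?Pn ?A + \<epsilon> + ?err + measure ?Pn R"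
    using ac[of ?t] by (simp add: add.commute[of M' M])
  with up show ?thesis by linarith
qed

end

section \<open>Even moments of martingales\<close>

text \<open>From k to k + 1 the left side is multiplied by (m - k) (2m - 2k - 1) / ((k + 1) (2k +
  1)) and the right side by 2m (m - k) / (k + 1). The comparison is made so that the even part of a
  binomial power can be dominated by a power of a sum of squares.\<close>

lemma choose_even_le: "(2 * m) choose (2 * k) \<le> (m choose k) * (2 * m) ^ k"
proof (induction k)
  case 0 show ?case by simp
next
  case (Suc k)
  have ab: "Suc k * (n choose Suc k) = (n - k) * (n choose k)" for n k
    by (metis binomial_absorb_comp binomial_absorption)
  have e: "2 * Suc k = Suc (2*k+1)" by simp
  have "Suc (2*k+1) * (Suc (2*k) * ((2*m) choose (2 * Suc k))) = Suc (2*k) * (Suc (2*k+1) * ((2*m) choose Suc (2*k+1)))"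
    unfolding e by (rule mult.left_commute)
  also have "\<dots> = Suc (2*k) * ((2*m - (2*k+1)) * ((2*m) choose Suc (2*k)))" unfolding ab by simp
  also have "\<dots> = (2*m - (2*k+1)) * (Suc (2*k) * ((2*m) choose Suc (2*k)))" by (simp only: mult_ac)
  also have "\<dots> = (2*m - (2*k+1)) * ((2*m - 2*k) * ((2*m) choose (2*k)))" unfolding ab ..
  also have "\<dots> \<le> (2*m) * ((2*m - 2*k) * ((m choose k) * (2*m)^k))"
    by (intro mult_mono Suc.IH) auto
  also have "\<dots> = 2 * ((m - k) * (m choose k)) * (2*m) ^ Suc k" by (simp add: algebra_simps)
  also have "\<dots> = 2 * (Suc k * (m choose Suc k)) * (2*m) ^ Suc k" unfolding ab ..
  also have "\<dots> = (2 * Suc k) * ((m choose Suc k) * (2*m) ^ Suc k)" by (simp only: mult_ac)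
  also have "2 * Suc k = Suc (2*k+1)" by simp
  finally have "Suc (2*k) * ((2*m) choose (2 * Suc k)) \<le> (m choose Suc k) * (2*m) ^ Suc k"
    unfolding e by (rule mult_left_le_imp_le) simp
  then show ?case by (simp only: mult_Suc)
qed

text \<open>The term linear in \<open>b\<close> is isolated because it integrates to zero for a
  martingale increment. Adding (a - b)^(2m) removes all odd powers; that summand is then bounded
  from below by its tangent, which is Bernoulli's inequality.\<close>

lemma even_power_add_le:
  fixes a b :: real
  assumes m: "m \<ge> 1"
  shows "(a + b) ^ (2 * m) \<le> 2 * real m * a ^ (2 * m - 1) * b + (a\<^sup>2 + 4 * real m * b\<^sup>2) ^ m"
proof -
  have tangent: "a ^ (2 * m) - 2 * real m * a ^ (2 * m - 1) * b \<le> (a - b) ^ (2 * m)"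
  proof (cases "a = 0")
    case True then show ?thesis using m by (simp add: power_0_left)
  next
    case False
    have "1 + real (2 * m) * (- b / a) \<le> (1 + (- b / a)) ^ (2 * m)" by (rule Bernoulli_inequality_even) simp
    then have "a ^ (2 * m) * (1 + real (2 * m) * (- b / a)) \<le> a ^ (2 * m) * (1 + (- b / a)) ^ (2 * m)"
      by (intro mult_left_mono) auto
    also have "\<dots> = (a - b) ^ (2 * m)"
    proof -
      have "a * (1 + (- b / a)) = a - b" using False by (simp add: field_simps)
      then show ?thesis unfolding power_mult_distrib[symmetric] by (rule arg_cong)
    qed
    also have "a ^ (2 * m) * (1 + real (2 * m) * (- b / a)) = a ^ (2 * m) - 2 * real m * (a ^ (2 * m) / a) * b"
      by (simp add: algebra_simps)
    also have "a ^ (2 * m) / a = a ^ (2 * m - 1)" using False m by (simp add: power_diff)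
    finally show ?thesis .
  qed
  have "(a + b) ^ (2 * m) + (a - b) ^ (2 * m) = (\<Sum>k\<le>2*m. real ((2*m) choose k) * (b ^ k + (- b) ^ k) * a ^ (2*m - k))"
    using binomial_ring[of b a "2*m"] binomial_ring[of "-b" a "2*m"]
    by (simp add: sum.distrib[symmetric] algebra_simps)
  also have "\<dots> = (\<Sum>k\<in>(*) 2 ` {..m}. real ((2*m) choose k) * (b ^ k + (- b) ^ k) * a ^ (2*m - k))"
  proof (rule sum.mono_neutral_right)
    show "\<forall>k\<in>{..2 * m} - (*) 2 ` {..m}. real (2 * m choose k) * (b ^ k + (- b) ^ k) * a ^ (2 * m - k) = 0"
    proof
      fix k assume k: "k \<in> {..2 * m} - (*) 2 ` {..m}"
      have "odd k"
      proof
        assume "even k" then obtain i where "k = 2 * i" by blast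
        with k show False by auto
      qed
      then show "real (2 * m choose k) * (b ^ k + (- b) ^ k) * a ^ (2 * m - k) = 0" by simp
    qed
  qed auto
  also have "\<dots> = (\<Sum>k\<le>m. real ((2*m) choose (2*k)) * (b ^ (2*k) + (- b) ^ (2*k)) * a ^ (2*m - 2*k))"
    by (subst sum.reindex) (auto simp: inj_on_def)
  also have "\<dots> = (\<Sum>k\<le>m. 2 * real ((2*m) choose (2*k)) * ((b\<^sup>2) ^ k * (a\<^sup>2) ^ (m - k)))"
  proof (intro sum.cong refl)
    fix k
    have "a ^ (2*m - 2*k) = (a\<^sup>2) ^ (m - k)" by (simp add: power_mult[symmetric] diff_mult_distrib2)
    then show "real ((2*m) choose (2*k)) * (b ^ (2*k) + (- b) ^ (2*k)) * a ^ (2*m - 2*k)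
      = 2 * real ((2*m) choose (2*k)) * ((b\<^sup>2) ^ k * (a\<^sup>2) ^ (m - k))"
      by (simp add: power_mult)
  qed
  \<comment> \<open>For k > 0 the factor 2 is at most 2^k and turns (2m)^k into (4m)^k. For k = 0 it
    is split as 1 + 1, and the surplus a^(2m) is cancelled by the tangent bound.\<close>
  also have "\<dots> \<le> (\<Sum>k\<le>m. (real (m choose k) * (4 * real m) ^ k + (if k = 0 then 1 else 0)) * ((b\<^sup>2) ^ k * (a\<^sup>2) ^ (m - k)))"
  proof (intro sum_mono mult_right_mono)
    fix k
    have "2 * real ((2*m) choose (2*k)) \<le> real (m choose k) * (4 * real m) ^ k" if "k > 0"
    proof -
      have "2 * ((2*m) choose (2*k)) \<le> 2 * ((m choose k) * (2*m)^k)"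
        using choose_even_le[of m k] by simp
      also have "\<dots> = (m choose k) * (2 * (2*m)^k)" by (rule mult.left_commute)
      also have "\<dots> \<le> (m choose k) * (2^k * (2*m)^k)"
        using that by (intro mult_left_mono mult_right_mono) (auto simp: self_le_power)
      also have "2^k * (2*m)^k = (4*m)^k" unfolding power_mult_distrib[symmetric] by simp
      finally have "real (2 * ((2*m) choose (2*k))) \<le> real ((m choose k) * (4*m)^k)" by (rule of_nat_mono)
      then show ?thesis by simp
    qed
    then show "2 * real ((2*m) choose (2*k)) \<le> real (m choose k) * (4 * real m) ^ k + (if k = 0 then 1 else 0)"
      by (cases "k = 0") auto
  qed auto
  also have "\<dots> = (\<Sum>k\<le>m. real (m choose k) * ((4 * real m) * b\<^sup>2) ^ k * (a\<^sup>2) ^ (m - k)) + a ^ (2 * m)"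
  proof -
    have "(real (m choose k) * (4 * real m) ^ k + (if k = 0 then 1 else 0)) * ((b\<^sup>2) ^ k * (a\<^sup>2) ^ (m - k))
      = real (m choose k) * ((4 * real m) * b\<^sup>2) ^ k * (a\<^sup>2) ^ (m - k) + (if k = 0 then a ^ (2 * m) else 0)" for k
      by (cases "k = 0") (simp_all add: power_mult power_mult_distrib distrib_right)
    then show ?thesis by (simp only: sum.distrib) simp
  qed
  also have "(\<Sum>k\<le>m. real (m choose k) * ((4 * real m) * b\<^sup>2) ^ k * (a\<^sup>2) ^ (m - k)) = (4 * real m * b\<^sup>2 + a\<^sup>2) ^ m"
    by (simp add: binomial_ring)
  finally show ?thesis using tangent by (simp add: add.commute)
qed

text \<open>Convexity with weights N / (N + 1) and 1 / (N + 1). Taking N to be the current number of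
  steps makes the constants telescope in \<open>martingale_even_moment\<close>.\<close>

lemma power_add_weighted_le:
  fixes A B N :: real
  assumes "A \<ge> 0" "B \<ge> 0" "N > 0" "m \<ge> 1"
  shows "(A + B) ^ m \<le> (1 + 1 / N) ^ (m - 1) * A ^ m + (N + 1) ^ (m - 1) * B ^ m"
proof -
  have cv: "convex_on {0..} (\<lambda>x::real. x ^ m)"
    by (cases "even m") (auto intro: convex_power_odd convex_on_subset[OF convex_power_even])
  let ?t = "1 / (N + 1)"
  have "1 - ?t = N / (N + 1)" "1 + 1 / N = (N + 1) / N" using assms by (simp_all add: field_simps)
  then have e: "(1 - ?t) * (1 + 1 / N) = 1" "?t * (N + 1) = 1" using assms by simp_all
  have "(A + B) = (1 - ?t) *\<^sub>R ((1 + 1 / N) * A) + ?t *\<^sub>R ((N + 1) * B)"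
    unfolding real_scaleR_def mult.assoc[symmetric] e by simp
  moreover have "((1 - ?t) *\<^sub>R ((1 + 1 / N) * A) + ?t *\<^sub>R ((N + 1) * B)) ^ m
      \<le> (1 - ?t) * ((1 + 1 / N) * A) ^ m + ?t * ((N + 1) * B) ^ m"
    by (rule convex_onD[OF cv]) (use assms in auto)
  ultimately have "(A + B) ^ m \<le> (1 - ?t) * ((1 + 1 / N) * A) ^ m + ?t * ((N + 1) * B) ^ m"
    by (simp only:)
  also have "(1 - ?t) * ((1 + 1 / N) * A) ^ m = ((1 - ?t) * (1 + 1 / N)) * (1 + 1 / N) ^ (m - 1) * A ^ m"
    using assms by (cases m) (auto simp: power_mult_distrib)
  also note e(1)
  also have "?t * ((N + 1) * B) ^ m = (?t * (N + 1)) * (N + 1) ^ (m - 1) * B ^ m"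
    using assms by (cases m) (auto simp: power_mult_distrib)
  also note e(2)
  finally show ?thesis by simp
qed

lemma even_moment_step:
  fixes a N :: real and b :: "'a \<Rightarrow> real"
  assumes "prob_space P" and b: "b \<in> borel_measurable P" "(\<integral>y. b y \<partial>P) = 0"
    and m: "m \<ge> 1" and N: "N > 0"
  shows "(\<integral>\<^sup>+y. ennreal ((a + b y) ^ (2 * m)) \<partial>P) \<le>
    ennreal ((1 + 1 / N) ^ (m - 1)) * ennreal (a ^ (2 * m)) + ennreal ((N + 1) ^ (m - 1) * (4 * real m) ^ m) * (\<integral>\<^sup>+y. ennreal (b y ^ (2 * m)) \<partial>P)"
proof -
  interpret prob_space P by fact
  let ?k = "(1 + 1 / N) ^ (m - 1)" and ?l = "(N + 1) ^ (m - 1) * (4 * real m) ^ m"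
  have k: "?k \<ge> 0" "?l > 0" using N m by simp_all
  show ?thesis
  proof (cases "(\<integral>\<^sup>+y. ennreal (b y ^ (2 * m)) \<partial>P) = \<infinity>")
    case True
    have "ennreal l * \<infinity> = \<infinity>" if "l > 0" for l
      using that by (simp add: ennreal_mult_top)
    from this[OF k(2)] show ?thesis unfolding True by simp
  next
    case False
    have ib: "integrable P (\<lambda>y. b y ^ (2 * m))"
      using False b by (intro integrableI_nonneg) (auto simp: top.not_eq_extremum)
    have i1: "integrable P b"
    proof (rule Bochner_Integration.integrable_bound)
      show "integrable P (\<lambda>y. 1 + b y ^ (2 * m))" using ib by simp
      have "\<bar>z\<bar> \<le> 1 + z ^ (2 * m)" for z :: real
      proof (cases "\<bar>z\<bar> \<le> 1")
        case True then show ?thesis by (simp add: add_increasing2)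
      next
        case False
        then have "\<bar>z\<bar> ^ 1 \<le> \<bar>z\<bar> ^ (2 * m)" using m by (intro power_increasing) auto
        then show ?thesis by (simp add: power_even_abs)
      qed
      then show "AE y in P. norm (b y) \<le> norm (1 + b y ^ (2 * m))" by (auto simp: add_nonneg_nonneg)
    qed (use b in simp)
    have pt: "(a + z) ^ (2 * m) \<le> 2 * real m * a ^ (2 * m - 1) * z + (?k * a ^ (2 * m) + ?l * z ^ (2 * m))" for z
    proof -
      have "(a\<^sup>2 + 4 * real m * z\<^sup>2) ^ m \<le> ?k * (a\<^sup>2) ^ m + (N + 1) ^ (m - 1) * (4 * real m * z\<^sup>2) ^ m"
        using N m by (intro power_add_weighted_le) auto
      also have "\<dots> = ?k * a ^ (2 * m) + ?l * z ^ (2 * m)"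
        by (simp add: power_mult_distrib power_mult)
      finally show ?thesis using even_power_add_le[OF m, of a z] by linarith
    qed
    have "(\<integral>\<^sup>+y. ennreal ((a + b y) ^ (2 * m)) \<partial>P) \<le>
       (\<integral>\<^sup>+y. ennreal (2 * real m * a ^ (2 * m - 1) * b y + (?k * a ^ (2 * m) + ?l * b y ^ (2 * m))) \<partial>P)"
      by (intro nn_integral_mono ennreal_leI pt)
    also have "\<dots> = ennreal (\<integral>y. 2 * real m * a ^ (2 * m - 1) * b y + (?k * a ^ (2 * m) + ?l * b y ^ (2 * m)) \<partial>P)"
    proof (rule nn_integral_eq_integral)
      show "AE y in P. 0 \<le> 2 * real m * a ^ (2 * m - 1) * b y + (?k * a ^ (2 * m) + ?l * b y ^ (2 * m))"
        using order_trans[OF _ pt] by (intro AE_I2) (auto simp: zero_le_even_power)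
    qed (use ib i1 in auto)
    also have "(\<integral>y. 2 * real m * a ^ (2 * m - 1) * b y + (?k * a ^ (2 * m) + ?l * b y ^ (2 * m)) \<partial>P)
      = ?k * a ^ (2 * m) + ?l * (\<integral>y. b y ^ (2 * m) \<partial>P)"
      using ib i1 b by (simp add: prob_space)
    also have "ennreal \<dots> = ennreal ?k * ennreal (a ^ (2 * m)) + ennreal ?l * ennreal (\<integral>y. b y ^ (2 * m) \<partial>P)"
      using k by (simp add: ennreal_plus ennreal_mult zero_le_even_power)
    also have "ennreal (\<integral>y. b y ^ (2 * m) \<partial>P) = (\<integral>\<^sup>+y. ennreal (b y ^ (2 * m)) \<partial>P)"
      using ib by (intro nn_integral_eq_integral[symmetric]) (auto simp: zero_le_even_power)
    finally show ?thesis .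
  qed
qed

text \<open>With N = n the weighted step multiplies n^m by (1 + 1/n)^(m - 1), giving (n + 1)^(m - 1)
  n, and the new increment adds (n + 1)^(m - 1). Together these are exactly (n + 1)^m, so the growth
  n^m is kept without loss.\<close>

lemma martingale_even_moment:
  fixes D :: "nat \<Rightarrow> (nat \<Rightarrow> 'a) \<Rightarrow> real" and b :: "nat \<Rightarrow> (nat \<Rightarrow> 'a) \<Rightarrow> 'a \<Rightarrow> real"
  assumes P: "prob_space P" and m: "m \<ge> 1"
    and D0: "\<And>x. D 0 x = 0"
    and DS: "\<And>N x y. D (Suc N) (x(N := y)) = D N x + b N x y"
    and Dm: "\<And>N. D N \<in> borel_measurable (iid {..<N} P)"
    and bm: "\<And>N. (\<lambda>(x, y). b N x y) \<in> borel_measurable (iid {..<N} P \<Otimes>\<^sub>M P)"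
    and b0: "\<And>N. AE x in iid {..<N} P. (\<integral>y. b N x y \<partial>P) = 0"
    and s: "\<And>N. N < n \<Longrightarrow> (\<integral>\<^sup>+x. \<integral>\<^sup>+y. ennreal (b N x y ^ (2 * m)) \<partial>P \<partial>iid {..<N} P) \<le> \<sigma>"
  shows "(\<integral>\<^sup>+x. ennreal (D n x ^ (2 * m)) \<partial>iid {..<n} P) \<le> ennreal ((4 * real m * real n) ^ m) * \<sigma>"
  using s
proof (induction n)
  case 0
  show ?case using m by (simp add: D0 power_0_left)
next
  case (Suc n)
  interpret P: prob_space P by fact
  interpret PI: product_sigma_finite "\<lambda>_. P" by (simp add: product_sigma_finite_def P.sigma_finite_measure_axioms)
  let ?S = "iid {..<n} P"
  have [measurable]: "(\<lambda>(x, y). b n x y) \<in> borel_measurable (?S \<Otimes>\<^sub>M P)" "D n \<in> borel_measurable ?S"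
    by (fact bm Dm)+
  \<comment> \<open>At n = 0 the weight 1 / N needs a dummy value; there the previous sum is 0, and
    its term is dropped by the case distinction below.\<close>
  define N where "N = (if n = 0 then 1 else real n)"
  have N: "N > 0" by (simp add: N_def)
  have IH: "(\<integral>\<^sup>+x. ennreal (D n x ^ (2 * m)) \<partial>?S) \<le> ennreal ((4 * real m * real n) ^ m) * \<sigma>"
    using Suc.prems by (intro Suc.IH) auto
  have "(\<integral>\<^sup>+x. ennreal (D (Suc n) x ^ (2 * m)) \<partial>iid {..<Suc n} P)
     = (\<integral>\<^sup>+x. \<integral>\<^sup>+y. ennreal (D (Suc n) (x(n := y)) ^ (2 * m)) \<partial>P \<partial>?S)"
    using Dm[of "Suc n"] unfolding lessThan_Suc by (intro PI.product_nn_integral_insert) auto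
  also have "\<dots> = (\<integral>\<^sup>+x. \<integral>\<^sup>+y. ennreal ((D n x + b n x y) ^ (2 * m)) \<partial>P \<partial>?S)" unfolding DS ..
  also have "\<dots> \<le> (\<integral>\<^sup>+x. (if n = 0 then 0 else ennreal ((1 + 1 / N) ^ (m - 1)) * ennreal (D n x ^ (2 * m)))
       + ennreal ((real n + 1) ^ (m - 1) * (4 * real m) ^ m) * (\<integral>\<^sup>+y. ennreal (b n x y ^ (2 * m)) \<partial>P) \<partial>?S)"
  proof (intro nn_integral_mono_AE, use b0[of n] AE_space in eventually_elim)
    case (elim x)
    show ?case
    proof (cases "n = 0")
      case True
      have "1 \<le> (4 * real m) ^ m" by (rule one_le_power) (use m in simp)
      from ennreal_leI[OF this] have "1 \<le> ennreal ((4 * real m) ^ m)" by (simp only: ennreal_1)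
      then have "1 * (\<integral>\<^sup>+y. ennreal (b n x y ^ (2 * m)) \<partial>P) \<le> ennreal ((4 * real m) ^ m) * (\<integral>\<^sup>+y. ennreal (b n x y ^ (2 * m)) \<partial>P)"
        by (intro mult_right_mono) auto
      then show ?thesis using True by (simp add: D0)
    next
      case False
      have "(\<lambda>y. b n x y) \<in> borel_measurable P" using elim(2) by measurable
      then show ?thesis using even_moment_step[OF P _ elim(1) m N, of "D n x"] False by (simp add: N_def)
    qed
  qed
  also have "\<dots> = (\<integral>\<^sup>+x. (if n = 0 then 0 else ennreal ((1 + 1 / N) ^ (m - 1)) * ennreal (D n x ^ (2 * m))) \<partial>?S)
       + ennreal ((real n + 1) ^ (m - 1) * (4 * real m) ^ m) * (\<integral>\<^sup>+x. \<integral>\<^sup>+y. ennreal (b n x y ^ (2 * m)) \<partial>P \<partial>?S)"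
    by (subst nn_integral_add) (auto simp: nn_integral_cmult)
  also have "(\<integral>\<^sup>+x. (if n = 0 then 0 else ennreal ((1 + 1 / N) ^ (m - 1)) * ennreal (D n x ^ (2 * m))) \<partial>?S)
     \<le> ennreal ((real n + 1) ^ (m - 1) * (4 * real m) ^ m * n) * \<sigma>"
  proof (cases "n = 0")
    case False
    have "(\<integral>\<^sup>+x. (if n = 0 then 0 else ennreal ((1 + 1 / N) ^ (m - 1)) * ennreal (D n x ^ (2 * m))) \<partial>?S)
      = ennreal ((1 + 1 / N) ^ (m - 1)) * (\<integral>\<^sup>+x. ennreal (D n x ^ (2 * m)) \<partial>?S)"
      using False by (simp add: nn_integral_cmult)
    also have "\<dots> \<le> ennreal ((1 + 1 / N) ^ (m - 1)) * (ennreal ((4 * real m * real n) ^ m) * \<sigma>)"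
      by (intro mult_left_mono IH) auto
    also have "\<dots> = ennreal ((1 + 1 / N) ^ (m - 1) * (4 * real m * real n) ^ m) * \<sigma>"
      using N by (simp add: ennreal_mult mult.assoc)
    also have "(1 + 1 / N) ^ (m - 1) * (4 * real m * real n) ^ m = (real n + 1) ^ (m - 1) * (4 * real m) ^ m * n"
    proof -
      have "(4 * real m * real n) ^ m = (4 * real m) ^ m * real n ^ (m - 1) * n"
        using m by (cases m) (auto simp: power_mult_distrib)
      moreover have "(1 + 1 / N) ^ (m - 1) * real n ^ (m - 1) = (real n + 1) ^ (m - 1)"
      proof -
        have "(1 + 1 / N) * real n = real n + 1" using False by (simp add: N_def field_simps)
        then show ?thesis unfolding power_mult_distrib[symmetric] by (rule arg_cong)
      qed
      ultimately show ?thesis by (simp add: mult_ac)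
    qed
    finally show ?thesis .
  qed simp
  also have "(\<integral>\<^sup>+x. \<integral>\<^sup>+y. ennreal (b n x y ^ (2 * m)) \<partial>P \<partial>?S) \<le> \<sigma>"
    by (rule Suc.prems) simp
  also have "ennreal ((real n + 1) ^ (m - 1) * (4 * real m) ^ m * n) * \<sigma> + ennreal ((real n + 1) ^ (m - 1) * (4 * real m) ^ m) * \<sigma>
    = ennreal ((real n + 1) ^ (m - 1) * (4 * real m) ^ m * n + (real n + 1) ^ (m - 1) * (4 * real m) ^ m) * \<sigma>"
    by (simp add: distrib_right ennreal_plus)
  also have "(real n + 1) ^ (m - 1) * (4 * real m) ^ m * n + (real n + 1) ^ (m - 1) * (4 * real m) ^ m = (4 * real m * real (Suc n)) ^ m"
  proof -
    have "(real n + 1) ^ (m - 1) * (4 * real m) ^ m * n + (real n + 1) ^ (m - 1) * (4 * real m) ^ m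
       = (4 * real m) ^ m * ((real n + 1) * (real n + 1) ^ (m - 1))" by (simp add: algebra_simps)
    also have "(real n + 1) * (real n + 1) ^ (m - 1) = (real n + 1) ^ m"
      using m by (simp add: power_Suc[symmetric] del: power_Suc)
    finally show ?thesis by (simp add: power_mult_distrib add.commute)
  qed
  finally show ?case by (simp add: add_mono mult_left_mono)
qed

section \<open>Canonical U-statistics\<close>

lemma power_div_fact_le_exp:
  fixes x :: real assumes "x \<ge> 0" shows "x ^ n / fact n \<le> exp x"
proof -
  have "(\<Sum>i\<in>{n}. inverse (fact i) *\<^sub>R x ^ i) \<le> exp x"
    unfolding exp_def using assms by (intro sum_le_suminf summable_exp_generic) auto
  then show ?thesis by (simp add: divide_inverse mult.commute)
qed

text \<open>The minimum at 0 covers nonintegrable \<open>u\<close>: its integral is 0 by convention,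
  and the inequality then compares \<phi> with its least value.\<close>

lemma (in prob_space) nn_jensen:
  fixes \<phi> :: "real \<Rightarrow> real"
  assumes cv: "convex_on UNIV \<phi>" and nn: "\<And>x. 0 \<le> \<phi> x" and min: "\<And>x. \<phi> 0 \<le> \<phi> x"
    and m: "\<phi> \<in> borel_measurable borel" and u: "u \<in> borel_measurable M"
  shows "ennreal (\<phi> (\<integral>x. u x \<partial>M)) \<le> (\<integral>\<^sup>+x. ennreal (\<phi> (u x)) \<partial>M)"
proof (cases "integrable M u")
  case True
  show ?thesis
  proof (cases "(\<integral>\<^sup>+x. ennreal (\<phi> (u x)) \<partial>M) = \<infinity>")
    case False
    have i: "integrable M (\<lambda>x. \<phi> (u x))"
      using False m u nn by (intro integrableI_nonneg) (auto simp: top.not_eq_extremum)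
    have "\<phi> (\<integral>x. u x \<partial>M) \<le> (\<integral>x. \<phi> (u x) \<partial>M)"
      by (rule jensens_inequality[OF True _ _ i cv, of _ _]) auto
    also have "ennreal \<dots> = (\<integral>\<^sup>+x. ennreal (\<phi> (u x)) \<partial>M)"
      using i nn by (intro nn_integral_eq_integral[symmetric]) auto
    finally show ?thesis by (simp add: ennreal_leI)
  qed simp
next
  case False
  have "ennreal (\<phi> 0) = (\<integral>\<^sup>+x. ennreal (\<phi> 0) \<partial>M)" by (simp add: emeasure_space_1)
  also have "\<dots> \<le> (\<integral>\<^sup>+x. ennreal (\<phi> (u x)) \<partial>M)" by (intro nn_integral_mono ennreal_leI min)
  finally show ?thesis using False by (simp add: not_integrable_integral_eq)
qed

lemma (in prob_space) nn_jensen_power: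
  assumes "u \<in> borel_measurable M" "q > 0"
  shows "ennreal (\<bar>\<integral>x. u x \<partial>M\<bar> ^ q) \<le> (\<integral>\<^sup>+x. ennreal (\<bar>u x\<bar> ^ q) \<partial>M)"
proof -
  have "convex_on UNIV (\<lambda>x::real. \<bar>x\<bar> ^ q)"
  proof (rule convex_onI)
    fix t x y :: real assume t: "0 < t" "t < 1"
    have "\<bar>(1 - t) *\<^sub>R x + t *\<^sub>R y\<bar> \<le> (1 - t) *\<^sub>R \<bar>x\<bar> + t *\<^sub>R \<bar>y\<bar>"
      using t by (simp add: abs_mult order_trans[OF abs_triangle_ineq])
    then have "\<bar>(1 - t) *\<^sub>R x + t *\<^sub>R y\<bar> ^ q \<le> ((1 - t) *\<^sub>R \<bar>x\<bar> + t *\<^sub>R \<bar>y\<bar>) ^ q"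
      by (intro power_mono) auto
    also have "\<dots> \<le> (1 - t) * \<bar>x\<bar> ^ q + t * \<bar>y\<bar> ^ q"
    proof -
      have "convex_on {0..} (\<lambda>x::real. x ^ q)"
        by (cases "even q") (auto intro: convex_power_odd convex_on_subset[OF convex_power_even])
      then show ?thesis using t by (intro convex_onD) auto
    qed
    finally show "\<bar>(1 - t) *\<^sub>R x + t *\<^sub>R y\<bar> ^ q \<le> (1 - t) * \<bar>x\<bar> ^ q + t * \<bar>y\<bar> ^ q" .
  qed simp
  from nn_jensen[OF this, of u] assms show ?thesis by (simp add: power_0_left)
qed

lemma (in prob_space) nn_jensen_exp:
  assumes "u \<in> borel_measurable M" "B > 0"
  shows "ennreal (exp (\<bar>\<integral>x. u x \<partial>M\<bar> / B)) \<le> (\<integral>\<^sup>+x. ennreal (exp (\<bar>u x\<bar> / B)) \<partial>M)"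
proof -
  have "convex_on UNIV (\<lambda>x::real. exp (\<bar>x\<bar> / B))"
  proof (rule convex_onI)
    fix t x y :: real assume t: "0 < t" "t < 1"
    have "\<bar>(1 - t) *\<^sub>R x + t *\<^sub>R y\<bar> \<le> (1 - t) * \<bar>x\<bar> + t * \<bar>y\<bar>"
      using t by (simp add: abs_mult order_trans[OF abs_triangle_ineq])
    then have "\<bar>(1 - t) *\<^sub>R x + t *\<^sub>R y\<bar> / B \<le> (1 - t) *\<^sub>R (\<bar>x\<bar> / B) + t *\<^sub>R (\<bar>y\<bar> / B)"
      using assms(2) by (simp add: field_simps)
    then have "exp (\<bar>(1 - t) *\<^sub>R x + t *\<^sub>R y\<bar> / B) \<le> exp ((1 - t) *\<^sub>R (\<bar>x\<bar> / B) + t *\<^sub>R (\<bar>y\<bar> / B))" by simp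
    also have "\<dots> \<le> (1 - t) * exp (\<bar>x\<bar> / B) + t * exp (\<bar>y\<bar> / B)"
      using t by (intro convex_onD[OF exp_convex]) auto
    finally show "exp (\<bar>(1 - t) *\<^sub>R x + t *\<^sub>R y\<bar> / B) \<le> (1 - t) * exp (\<bar>x\<bar> / B) + t * exp (\<bar>y\<bar> / B)" .
  qed simp
  from nn_jensen[OF this, of u] assms show ?thesis by simp
qed

lemma sum_pairs_swap:
  fixes f :: "nat \<Rightarrow> nat \<Rightarrow> real"
  shows "(\<Sum>i<n. \<Sum>j\<in>{i<..<n}. f i j) = (\<Sum>j<n. \<Sum>i<j. f i j)"
  by (subst sum.Sigma, simp, simp, subst sum.Sigma, simp, simp,
      rule sum.reindex_bij_witness[of _ "\<lambda>(j, i). (i, j)" "\<lambda>(i, j). (j, i)"]) auto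

section \<open>Hoeffding's decomposition of a symmetric kernel\<close>

locale sym_kernel = prob_space F for F :: "'a measure" +
  fixes k :: "'a \<Rightarrow> 'a \<Rightarrow> real" and B :: real
  assumes k_meas [measurable]: "(\<lambda>(x, y). k x y) \<in> borel_measurable (F \<Otimes>\<^sub>M F)"
    and k_sym: "\<And>x y. x \<in> space F \<Longrightarrow> y \<in> space F \<Longrightarrow> k x y = k y x"
    and B_pos: "B > 0"
    and k_exp: "(\<integral>\<^sup>+z. ennreal (exp (\<bar>k (fst z) (snd z)\<bar> / B)) \<partial>(F \<Otimes>\<^sub>M F)) \<le> 2"
begin

sublocale FF: pair_prob_space F F ..

definition proj :: "'a \<Rightarrow> real" where "proj x = (\<integral>y. k x y \<partial>F)"
definition mean :: real where "mean = (\<integral>z. k (fst z) (snd z) \<partial>(F \<Otimes>\<^sub>M F))"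
text \<open>The completely degenerate second-order term of Hoeffding's decomposition: averaging over
  either variable gives 0 for almost every value of the other.\<close>

definition canon :: "'a \<Rightarrow> 'a \<Rightarrow> real" where "canon x y = k x y - proj x - proj y + mean"

lemma k_meas' [measurable]: "(\<lambda>z. k (fst z) (snd z)) \<in> borel_measurable (F \<Otimes>\<^sub>M F)"
  using k_meas by (simp add: case_prod_beta')

lemma proj_meas [measurable]: "proj \<in> borel_measurable F"
  unfolding proj_def by measurable

lemma canon_meas [measurable]: "(\<lambda>(x, y). canon x y) \<in> borel_measurable (F \<Otimes>\<^sub>M F)"
  unfolding canon_def by measurable

text \<open>A single term of the exponential series gives q! B^q, and q! is bounded by q^q to keep a
  pure q-th power.\<close>

lemma k_moment: "(\<integral>\<^sup>+z. ennreal (\<bar>k (fst z) (snd z)\<bar> ^ q) \<partial>(F \<Otimes>\<^sub>M F)) \<le> ennreal (2 * (q * B) ^ q)"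
proof -
  have pt: "\<bar>z\<bar> ^ q \<le> (q * B) ^ q * exp (\<bar>z\<bar> / B)" for z
  proof -
    have "\<bar>z\<bar> ^ q = B ^ q * (\<bar>z\<bar> / B) ^ q" using B_pos by (simp add: power_divide)
    also have "\<dots> \<le> B ^ q * (fact q * exp (\<bar>z\<bar> / B))"
      using power_div_fact_le_exp[of "\<bar>z\<bar> / B" q] B_pos
      by (intro mult_left_mono) (auto simp: pos_divide_le_eq mult.commute)
    also have "\<dots> \<le> B ^ q * (real q ^ q * exp (\<bar>z\<bar> / B))"
      using B_pos fact_le_power[of q, where ?'a = real] by (intro mult_left_mono mult_right_mono) auto
    finally show ?thesis by (simp add: power_mult_distrib mult_ac)
  qed
  have "(\<integral>\<^sup>+z. ennreal (\<bar>k (fst z) (snd z)\<bar> ^ q) \<partial>(F \<Otimes>\<^sub>M F))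
    \<le> (\<integral>\<^sup>+z. ennreal ((q * B) ^ q) * ennreal (exp (\<bar>k (fst z) (snd z)\<bar> / B)) \<partial>(F \<Otimes>\<^sub>M F))"
    using B_pos pt by (intro nn_integral_mono) (simp add: ennreal_mult[symmetric] ennreal_leI)
  also have "\<dots> = ennreal ((q * B) ^ q) * (\<integral>\<^sup>+z. ennreal (exp (\<bar>k (fst z) (snd z)\<bar> / B)) \<partial>(F \<Otimes>\<^sub>M F))"
    by (rule nn_integral_cmult) simp
  also have "\<dots> \<le> ennreal ((q * B) ^ q) * 2" by (intro mult_left_mono k_exp) simp
  also have "\<dots> = ennreal (2 * (q * B) ^ q)"
    using B_pos by (simp add: ennreal_mult mult.commute)
  finally show ?thesis .
qed

lemma k_integrable: "integrable (F \<Otimes>\<^sub>M F) (\<lambda>z. k (fst z) (snd z))"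
proof (rule integrableI_bounded)
  show "(\<integral>\<^sup>+z. ennreal (norm (k (fst z) (snd z))) \<partial>(F \<Otimes>\<^sub>M F)) < \<infinity>"
    using le_less_trans[OF k_moment[of 1]] by simp
qed simp

lemma proj_integrable: "integrable F proj" and proj_mean: "(\<integral>x. proj x \<partial>F) = mean"
  using FF.integrable_fst'[OF k_integrable] FF.integral_fst'[OF k_integrable]
  unfolding proj_def mean_def by auto

text \<open>Fubini gives integrable sections only off a null set, so degeneracy holds almost
  everywhere; this is why the martingale lemma allows exceptional pasts.\<close>

lemma AE_canon_degenerate: "AE x in F. (\<integral>y. canon x y \<partial>F) = 0 \<and> integrable F (canon x)"
proof -
  have "AE x in F. integrable F (\<lambda>y. k x y)"
    using FF.AE_integrable_fst'[OF k_integrable] by simp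
  then show ?thesis
  proof eventually_elim
    case (elim x)
    have "integrable F (canon x)" unfolding canon_def using elim proj_integrable by auto
    moreover have "(\<integral>y. canon x y \<partial>F) = 0"
      unfolding canon_def using elim proj_integrable by (simp add: prob_space proj_mean proj_def[symmetric])
    ultimately show ?case by simp
  qed
qed

lemma canon_sym: "x \<in> space F \<Longrightarrow> y \<in> space F \<Longrightarrow> canon x y = canon y x"
  unfolding canon_def using k_sym by simp

lemma power_add4_le:
  fixes a b c d :: real
  shows "(a + b + c + d) ^ (2 * m) \<le> 4 ^ (2 * m) * (\<bar>a\<bar> ^ (2 * m) + \<bar>b\<bar> ^ (2 * m) + \<bar>c\<bar> ^ (2 * m) + \<bar>d\<bar> ^ (2 * m))"
proof -
  define e where "e = Max {\<bar>a\<bar>, \<bar>b\<bar>, \<bar>c\<bar>, \<bar>d\<bar>}"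
  have e: "e \<in> {\<bar>a\<bar>, \<bar>b\<bar>, \<bar>c\<bar>, \<bar>d\<bar>}" unfolding e_def by (rule Max_in) auto
  have le: "\<bar>a\<bar> \<le> e" "\<bar>b\<bar> \<le> e" "\<bar>c\<bar> \<le> e" "\<bar>d\<bar> \<le> e" unfolding e_def by (rule Max_ge; simp)+
  have "(a + b + c + d) ^ (2 * m) = \<bar>a + b + c + d\<bar> ^ (2 * m)" by (simp add: power_even_abs)
  also have "\<dots> \<le> (4 * e) ^ (2 * m)" using le by (intro power_mono) auto
  also have "\<dots> = 4 ^ (2 * m) * e ^ (2 * m)" by (rule power_mult_distrib)
  also have "e ^ (2 * m) \<le> \<bar>a\<bar> ^ (2 * m) + \<bar>b\<bar> ^ (2 * m) + \<bar>c\<bar> ^ (2 * m) + \<bar>d\<bar> ^ (2 * m)"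
    using e zero_le_power[of "\<bar>a\<bar>" "2*m"] zero_le_power[of "\<bar>b\<bar>" "2*m"] zero_le_power[of "\<bar>c\<bar>" "2*m"] zero_le_power[of "\<bar>d\<bar>" "2*m"]
    by auto
  finally show ?thesis by simp
qed

text \<open>Jensen's inequality bounds the moments of \<open>proj\<close> and \<open>mean\<close> by
  that of \<open>k\<close>. Four terms of size 2 (2mB)^(2m), with the factor 4^(2m) for splitting
  the power, give the constant.\<close>

lemma canon_moment:
  assumes m: "m \<ge> 1"
  shows "(\<integral>\<^sup>+y. \<integral>\<^sup>+x. ennreal (canon x y ^ (2 * m)) \<partial>F \<partial>F) \<le> ennreal (8 * (8 * real m * B) ^ (2 * m))"
proof -
  let ?q = "2 * m"
  let ?K = "\<integral>\<^sup>+z. ennreal (\<bar>k (fst z) (snd z)\<bar> ^ ?q) \<partial>(F \<Otimes>\<^sub>M F)"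
  have fub: "(\<integral>\<^sup>+x. \<integral>\<^sup>+y. ennreal (\<bar>k x y\<bar> ^ ?q) \<partial>F \<partial>F) = ?K"
    by (subst nn_integral_fst[symmetric]) auto
  have pr: "(\<integral>\<^sup>+x. ennreal (\<bar>proj x\<bar> ^ ?q) \<partial>F) \<le> ?K"
  proof -
    have "(\<integral>\<^sup>+x. ennreal (\<bar>proj x\<bar> ^ ?q) \<partial>F) \<le> (\<integral>\<^sup>+x. \<integral>\<^sup>+y. ennreal (\<bar>k x y\<bar> ^ ?q) \<partial>F \<partial>F)"
      unfolding proj_def using m by (intro nn_integral_mono nn_jensen_power) auto
    then show ?thesis unfolding fub .
  qed
  have mn: "ennreal (\<bar>mean\<bar> ^ ?q) \<le> ?K"
    unfolding mean_def using m by (intro FF.P.nn_jensen_power) auto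
  have "(\<integral>\<^sup>+y. \<integral>\<^sup>+x. ennreal (canon x y ^ ?q) \<partial>F \<partial>F) = (\<integral>\<^sup>+z. ennreal (canon (fst z) (snd z) ^ ?q) \<partial>(F \<Otimes>\<^sub>M F))"
    by (subst FF.nn_integral_snd[symmetric]) auto
  also have "\<dots> \<le> (\<integral>\<^sup>+z. ennreal (4 ^ ?q) * (ennreal (\<bar>k (fst z) (snd z)\<bar> ^ ?q) + ennreal (\<bar>proj (fst z)\<bar> ^ ?q)
      + ennreal (\<bar>proj (snd z)\<bar> ^ ?q) + ennreal (\<bar>mean\<bar> ^ ?q)) \<partial>(F \<Otimes>\<^sub>M F))"
  proof (intro nn_integral_mono)
    fix z
    have "canon (fst z) (snd z) ^ ?q \<le> 4 ^ ?q * (\<bar>k (fst z) (snd z)\<bar> ^ ?q + \<bar>proj (fst z)\<bar> ^ ?q + \<bar>proj (snd z)\<bar> ^ ?q + \<bar>mean\<bar> ^ ?q)"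
      using power_add4_le[of "k (fst z) (snd z)" "- proj (fst z)" "- proj (snd z)" mean m] by (simp add: canon_def)
    from ennreal_leI[OF this] show "ennreal (canon (fst z) (snd z) ^ ?q) \<le> ennreal (4 ^ ?q) * (ennreal (\<bar>k (fst z) (snd z)\<bar> ^ ?q) + ennreal (\<bar>proj (fst z)\<bar> ^ ?q)
      + ennreal (\<bar>proj (snd z)\<bar> ^ ?q) + ennreal (\<bar>mean\<bar> ^ ?q))"
      by (simp add: ennreal_mult ennreal_plus del: ennreal_power)
  qed
  also have "\<dots> = ennreal (4 ^ ?q) * (?K + (\<integral>\<^sup>+z. ennreal (\<bar>proj (fst z)\<bar> ^ ?q) \<partial>(F \<Otimes>\<^sub>M F))
      + (\<integral>\<^sup>+z. ennreal (\<bar>proj (snd z)\<bar> ^ ?q) \<partial>(F \<Otimes>\<^sub>M F)) + ennreal (\<bar>mean\<bar> ^ ?q))"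
    by (simp add: nn_integral_cmult nn_integral_add FF.P.emeasure_space_1)
  also have "(\<integral>\<^sup>+z. ennreal (\<bar>proj (fst z)\<bar> ^ ?q) \<partial>(F \<Otimes>\<^sub>M F)) = (\<integral>\<^sup>+x. ennreal (\<bar>proj x\<bar> ^ ?q) \<partial>F)"
    by (subst nn_integral_fst[symmetric]) (auto simp: emeasure_space_1)
  also have "(\<integral>\<^sup>+z. ennreal (\<bar>proj (snd z)\<bar> ^ ?q) \<partial>(F \<Otimes>\<^sub>M F)) = (\<integral>\<^sup>+x. ennreal (\<bar>proj x\<bar> ^ ?q) \<partial>F)"
    by (subst nn_integral_fst[symmetric]) (auto simp: emeasure_space_1)
  also have "ennreal (4 ^ ?q) * (?K + (\<integral>\<^sup>+x. ennreal (\<bar>proj x\<bar> ^ ?q) \<partial>F) + (\<integral>\<^sup>+x. ennreal (\<bar>proj x\<bar> ^ ?q) \<partial>F) + ennreal (\<bar>mean\<bar> ^ ?q))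
    \<le> ennreal (4 ^ ?q) * (ennreal (2 * (real ?q * B) ^ ?q) + ennreal (2 * (real ?q * B) ^ ?q) + ennreal (2 * (real ?q * B) ^ ?q) + ennreal (2 * (real ?q * B) ^ ?q))"
    using k_moment[of ?q] by (intro mult_left_mono add_mono order_trans[OF pr] order_trans[OF mn]) auto
  also have "\<dots> = ennreal (4 ^ ?q * (8 * (real ?q * B) ^ ?q))"
    using B_pos by (simp add: ennreal_plus[symmetric] ennreal_mult[symmetric] del: ennreal_plus ennreal_power)
  also have "4 ^ ?q * (8 * (real ?q * B) ^ ?q) = 8 * (8 * real m * B) ^ ?q"
  proof -
    have "(8 * real m * B) ^ ?q = (4 * (real ?q * B)) ^ ?q" by (simp add: mult_ac)
    then show ?thesis by (simp only: power_mult_distrib[of 4] mult.left_commute)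
  qed
  finally show ?thesis .
qed

text \<open>The double sum grows by the row of all pairs with the newest observation, whose
  conditional mean is 0. With that observation fixed, the row is itself a sum of independent centred
  terms. Each of the two levels contributes (4mn)^m, so the sum has size n rather than
  n^(3/2).\<close>

lemma canon_ustat_moment:
  fixes n m :: nat
  assumes m: "m \<ge> 1"
  shows "(\<integral>\<^sup>+x. ennreal ((\<Sum>j<n. \<Sum>i<j. canon (x i) (x j)) ^ (2 * m)) \<partial>iid {..<n} F)
    \<le> ennreal (8 * (32 * (real m)\<^sup>2 * real n * B) ^ (2 * m))"
proof -
  have P: "prob_space F" by (rule prob_space_axioms)
  let ?s0 = "ennreal (8 * (8 * real m * B) ^ (2 * m))"
  have cm: "(\<lambda>x. canon (f x) (g x)) \<in> borel_measurable N" if "f \<in> measurable N F" "g \<in> measurable N F" for f g and N :: "'z measure"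
    using measurable_compose[OF measurable_Pair[OF that] canon_meas] by simp
  have "(\<integral>\<^sup>+x. ennreal ((\<Sum>j<n. \<Sum>i<j. canon (x i) (x j)) ^ (2 * m)) \<partial>iid {..<n} F)
     \<le> ennreal ((4 * real m * real n) ^ m) * (ennreal ((4 * real m * real n) ^ m) * ?s0)"
  proof (rule martingale_even_moment[where b = "\<lambda>N x y. \<Sum>i<N. canon (x i) y", OF P m])
    show "(\<Sum>j<Suc N. \<Sum>i<j. canon ((x(N := y)) i) ((x(N := y)) j)) = (\<Sum>j<N. \<Sum>i<j. canon (x i) (x j)) + (\<Sum>i<N. canon (x i) y)" for N x y
      by (auto intro!: arg_cong2[where f="(+)"] sum.cong)
    show "(\<lambda>x. \<Sum>j<N. \<Sum>i<j. canon (x i) (x j)) \<in> borel_measurable (iid {..<N} F)" for N :: nat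
      by (intro borel_measurable_sum cm measurable_component_singleton) (meson lessThan_iff less_trans)+
    show "(\<lambda>(x, y). \<Sum>i<N. canon (x i) y) \<in> borel_measurable (iid {..<N} F \<Otimes>\<^sub>M F)" for N :: nat
      unfolding case_prod_beta
      by (intro borel_measurable_sum cm measurable_snd measurable_compose[OF measurable_fst measurable_component_singleton]) auto
    show "AE x in iid {..<N} F. (\<integral>y. (\<Sum>i<N. canon (x i) y) \<partial>F) = 0" for N :: nat
    proof -
      have "AE x in iid {..<N} F. \<forall>i\<in>{..<N}. (\<integral>y. canon (x i) y \<partial>F) = 0 \<and> integrable F (canon (x i))"
        by (intro AE_finite_allI finite_lessThan AE_PiM_component P AE_canon_degenerate) auto
      then show ?thesis
      proof eventually_elim
        case (elim x)
        then show ?case by (subst Bochner_Integration.integral_sum) auto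
      qed
    qed
    fix N assume N: "N < n"
    interpret SN: prob_space "iid {..<N} F" by (intro prob_space_PiM P)
    interpret SF: pair_sigma_finite "iid {..<N} F" F ..
    have "(\<integral>\<^sup>+x. \<integral>\<^sup>+y. ennreal ((\<Sum>i<N. canon (x i) y) ^ (2 * m)) \<partial>F \<partial>iid {..<N} F)
      = (\<integral>\<^sup>+y. \<integral>\<^sup>+x. ennreal ((\<Sum>i<N. canon (x i) y) ^ (2 * m)) \<partial>iid {..<N} F \<partial>F)"
    proof (rule SF.Fubini'[symmetric])
      have "(\<lambda>z. \<Sum>i<N. canon (fst z i) (snd z)) \<in> borel_measurable (iid {..<N} F \<Otimes>\<^sub>M F)"
        by (intro borel_measurable_sum cm measurable_snd measurable_compose[OF measurable_fst measurable_component_singleton]) auto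
      then show "(\<lambda>(x, y). ennreal ((\<Sum>i<N. canon (x i) y) ^ (2 * m))) \<in> borel_measurable (iid {..<N} F \<Otimes>\<^sub>M F)"
        unfolding case_prod_beta by measurable
    qed
    also have "\<dots> \<le> (\<integral>\<^sup>+y. ennreal ((4 * real m * real N) ^ m) * (\<integral>\<^sup>+z. ennreal (canon z y ^ (2 * m)) \<partial>F) \<partial>F)"
    proof (intro nn_integral_mono_AE, use AE_canon_degenerate AE_space in eventually_elim)
      case (elim y)
      have cy: "(\<lambda>z. canon z y) \<in> borel_measurable F" using elim by (intro cm) auto
      \<comment> \<open>Degeneracy was shown in the second argument; symmetry transfers it to the
        first, over which the row sum runs.\<close>
      have "(\<integral>z. canon z y \<partial>F) = (\<integral>z. canon y z \<partial>F)"
        using elim by (intro Bochner_Integration.integral_cong refl canon_sym)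
      then have z: "(\<integral>z. canon z y \<partial>F) = 0" using elim by simp
      show ?case
      proof (rule martingale_even_moment[where b = "\<lambda>N x z. canon z y", OF P m])
        show "(\<Sum>i<Suc N. canon ((x(N := z)) i) y) = (\<Sum>i<N. canon (x i) y) + canon z y" for N x z
          by (auto intro!: sum.cong)
        show "(\<lambda>x. \<Sum>i<N. canon (x i) y) \<in> borel_measurable (iid {..<N} F)" for N :: nat
          by (intro borel_measurable_sum measurable_compose[OF _ cy] measurable_component_singleton)
        show "(\<lambda>(x, z). canon z y) \<in> borel_measurable (iid {..<N} F \<Otimes>\<^sub>M F)" for N :: nat
          unfolding case_prod_beta by (intro measurable_compose[OF _ cy] measurable_snd)
        show "(\<integral>\<^sup>+x. \<integral>\<^sup>+z. ennreal (canon z y ^ (2 * m)) \<partial>F \<partial>iid {..<N'} F) \<le> (\<integral>\<^sup>+z. ennreal (canon z y ^ (2 * m)) \<partial>F)" for N'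
        proof -
          interpret S: prob_space "iid {..<N'} F" by (intro prob_space_PiM P)
          show ?thesis by (simp add: S.emeasure_space_1)
        qed
      qed (use z in auto)
    qed
    also have "\<dots> = ennreal ((4 * real m * real N) ^ m) * (\<integral>\<^sup>+y. \<integral>\<^sup>+z. ennreal (canon z y ^ (2 * m)) \<partial>F \<partial>F)"
    proof (rule nn_integral_cmult)
      have "(\<lambda>z. ennreal (canon (snd z) (fst z) ^ (2 * m))) \<in> borel_measurable (F \<Otimes>\<^sub>M F)"
      proof -
        have [measurable]: "(\<lambda>z. canon (snd z) (fst z)) \<in> borel_measurable (F \<Otimes>\<^sub>M F)"
          by (intro cm measurable_snd measurable_fst)
        show ?thesis by measurable
      qed
      then show "(\<lambda>y. \<integral>\<^sup>+z. ennreal (canon z y ^ (2 * m)) \<partial>F) \<in> borel_measurable F"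
        by (intro borel_measurable_nn_integral) (simp add: case_prod_beta)
    qed
    also have "\<dots> \<le> ennreal ((4 * real m * real n) ^ m) * ?s0"
      using N by (intro mult_mono canon_moment[OF m] ennreal_leI power_mono mult_left_mono) auto
    finally show "(\<integral>\<^sup>+x. \<integral>\<^sup>+y. ennreal ((\<Sum>i<N. canon (x i) y) ^ (2 * m)) \<partial>F \<partial>iid {..<N} F)
      \<le> ennreal ((4 * real m * real n) ^ m) * ?s0" .
  qed simp
  also have "\<dots> = ennreal ((4 * real m * real n) ^ m * ((4 * real m * real n) ^ m * (8 * (8 * real m * B) ^ (2 * m))))"
    using B_pos by (simp add: ennreal_mult del: ennreal_power)
  also have "(4 * real m * real n) ^ m * ((4 * real m * real n) ^ m * (8 * (8 * real m * B) ^ (2 * m)))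
     = 8 * ((4 * real m * real n) * (8 * real m * B)) ^ (2 * m)"
  proof -
    have sq: "X ^ m * (X ^ m * (8 * Z)) = 8 * (X ^ (2 * m) * Z)" for X Z :: real
      by (simp add: mult_2 power_add)
    show ?thesis unfolding sq power_mult_distrib[symmetric] ..
  qed
  also have "(4 * real m * real n) * (8 * real m * B) = 32 * (real m)\<^sup>2 * real n * B" by (simp add: power2_eq_square)
  finally show ?thesis .
qed

text \<open>Each observation lies in n - 1 pairs, so its projection is counted that often. After
  normalisation the linear part is the Hajek projection and only the canonical sum remains as
  error.\<close>

lemma ustat_pair_sum:
  fixes n :: nat
  shows "(\<Sum>i<n. \<Sum>j\<in>{i<..<n}. k (x i) (x j)) - real (n choose 2) * mean
    = (real n - 1) * (\<Sum>i<n. proj (x i) - mean) + (\<Sum>j<n. \<Sum>i<j. canon (x i) (x j))"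
proof -
  have "(\<Sum>j<n. \<Sum>i<j. k (x i) (x j)) - real (n choose 2) * mean
    = (real n - 1) * (\<Sum>i<n. proj (x i) - mean) + (\<Sum>j<n. \<Sum>i<j. canon (x i) (x j))"
  proof (induction n)
    case 0 then show ?case by simp
  next
    case (Suc n)
    have c: "(\<Sum>i<n. canon (x i) (x n)) = (\<Sum>i<n. k (x i) (x n)) - (\<Sum>i<n. proj (x i) - mean) - n * proj (x n)"
      unfolding canon_def by (simp add: sum.distrib sum_subtractf)
    have ch: "real (Suc n choose 2) = real (n choose 2) + n" by (simp add: numeral_2_eq_2)
    show ?case
      unfolding sum.lessThan_Suc c ch using Suc.IH by (simp add: algebra_simps)
  qed
  then show ?thesis unfolding sum_pairs_swap .
qed

lemma distr_sample_pair:
  fixes n :: nat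
  assumes ij: "i < n" "j < n" "i \<noteq> j"
  shows "distr (iid {..<n} F) (F \<Otimes>\<^sub>M F) (\<lambda>\<omega>. (\<omega> i, \<omega> j)) = F \<Otimes>\<^sub>M F"
proof (rule pair_measure_eqI[symmetric])
  interpret PI: product_sigma_finite "\<lambda>_. F" by (simp add: product_sigma_finite_def sigma_finite_measure_axioms)
  have t: "(\<lambda>\<omega>. (\<omega> i, \<omega> j)) \<in> measurable (iid {..<n} F) (F \<Otimes>\<^sub>M F)"
    using ij by (intro measurable_Pair measurable_component_singleton) auto
  fix A C assume A: "A \<in> sets F" and C: "C \<in> sets F"
  let ?E = "\<lambda>l. if l = i then A else if l = j then C else space F"
  have "emeasure (distr (iid {..<n} F) (F \<Otimes>\<^sub>M F) (\<lambda>\<omega>. (\<omega> i, \<omega> j))) (A \<times> C) =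
     emeasure (iid {..<n} F) ((\<lambda>\<omega>. (\<omega> i, \<omega> j)) -` (A \<times> C) \<inter> space (iid {..<n} F))"
    using A C by (intro emeasure_distr t) auto
  also have "(\<lambda>\<omega>. (\<omega> i, \<omega> j)) -` (A \<times> C) \<inter> space (iid {..<n} F) = (\<Pi>\<^sub>E l\<in>{..<n}. ?E l)"
    using ij A[THEN sets.sets_into_space] C[THEN sets.sets_into_space]
    by (auto simp: space_PiM PiE_iff split: if_splits) (metis lessThan_iff subsetD)+
  also have "emeasure (iid {..<n} F) \<dots> = (\<Prod>l<n. emeasure F (?E l))"
    by (intro PI.emeasure_PiM finite_lessThan) (use A C in auto)
  also have "\<dots> = emeasure F A * (\<Prod>l\<in>{..<n} - {i}. emeasure F (?E l))"
    using ij by (subst prod.remove[of _ i]) auto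
  also have "(\<Prod>l\<in>{..<n} - {i}. emeasure F (?E l)) = emeasure F C * (\<Prod>l\<in>{..<n} - {i} - {j}. emeasure F (?E l))"
    using ij by (subst prod.remove[of _ j]) auto
  also have "(\<Prod>l\<in>{..<n} - {i} - {j}. emeasure F (?E l)) = 1"
    by (intro prod.neutral) (auto simp: emeasure_space_1)
  finally show "emeasure F A * emeasure F C = emeasure (distr (iid {..<n} F) (F \<Otimes>\<^sub>M F) (\<lambda>\<omega>. (\<omega> i, \<omega> j))) (A \<times> C)"
    by simp
qed (auto intro: sigma_finite_measure_axioms)

lemma ustat_mean:
  fixes n :: nat
  assumes n: "n \<ge> 2"
  shows "(\<integral>x. (\<Sum>i<n. \<Sum>j\<in>{i<..<n}. k (x i) (x j)) / real (n choose 2) \<partial>iid {..<n} F) = mean"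
proof -
  have *: "has_bochner_integral (iid {..<n} F) (\<lambda>x. k (x i) (x j)) mean" if "i < n" "j < n" "i \<noteq> j" for i j
  proof -
    have t: "(\<lambda>\<omega>. (\<omega> i, \<omega> j)) \<in> measurable (iid {..<n} F) (F \<Otimes>\<^sub>M F)"
      using that by (intro measurable_Pair measurable_component_singleton) auto
    have "has_bochner_integral (distr (iid {..<n} F) (F \<Otimes>\<^sub>M F) (\<lambda>\<omega>. (\<omega> i, \<omega> j))) (\<lambda>z. k (fst z) (snd z)) mean"
      unfolding distr_sample_pair[OF that] mean_def using k_integrable by (rule has_bochner_integral_integrable)
    then show ?thesis using t by (simp add: has_bochner_integral_iff integrable_distr_eq integral_distr)
  qed
  have "has_bochner_integral (iid {..<n} F) (\<lambda>x. (\<Sum>j<n. \<Sum>i<j. k (x i) (x j)) / real (n choose 2))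
     ((\<Sum>j<n. \<Sum>i<j. mean) / real (n choose 2))"
    by (intro has_bochner_integral_divide_zero has_bochner_integral_sum *) auto
  moreover have "(\<Sum>j<n. \<Sum>i<j. mean) = real (n choose 2) * mean" for n
    by (induction n) (simp_all add: numeral_2_eq_2 distrib_right)
  moreover have "n choose 2 > 0" using n by (simp add: zero_less_binomial_iff)
  ultimately show ?thesis unfolding sum_pairs_swap by (simp add: has_bochner_integral_iff)
qed

end

section \<open>Subexponential vectors\<close>

text \<open>Where the exponent is at most 1 the weight costs only a factor e, and the true third
  moment survives. Elsewhere the spare exponential integrability yields
  \<open>exp (-\<sigma>)\<close>, small enough to pay for the sum over \<open>J\<close> and for b^3.
  The constant 48 is 3! times 2^3.\<close>

lemma exp_vmax_cube_le:
  fixes y :: "'j \<Rightarrow> real"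
  assumes J: "finite J" "j \<in> J" and b: "b > 0" and s: "\<sigma> \<ge> 0" and rho: "\<rho> * (1 + \<sigma>) = 1 / (2 * b)"
  shows "exp (\<rho> * vmax J y) * \<bar>y j\<bar> ^ 3 \<le> exp 1 * \<bar>y j\<bar> ^ 3 + exp (-\<sigma>) * 48 * b ^ 3 * (\<Sum>k\<in>J. exp (\<bar>y k\<bar> / b))"
proof -
  let ?V = "vmax J y"
  have V: "\<bar>y j\<bar> \<le> ?V" by (rule le_vmax[OF J])
  then have V0: "?V \<ge> 0" by linarith
  have S0: "0 \<le> (\<Sum>k\<in>J. exp (\<bar>y k\<bar> / b))" by (intro sum_nonneg) simp
  show ?thesis
  proof (cases "\<rho> * ?V \<le> 1")
    case True
    then have "exp (\<rho> * ?V) * \<bar>y j\<bar> ^ 3 \<le> exp 1 * \<bar>y j\<bar> ^ 3" by (intro mult_right_mono) auto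
    moreover have "0 \<le> exp (-\<sigma>) * 48 * b ^ 3 * (\<Sum>k\<in>J. exp (\<bar>y k\<bar> / b))" using S0 b by simp
    ultimately show ?thesis by linarith
  next
    case False
    \<comment> \<open>As \<rho> V exceeds 1, adding \<sigma> (\<rho> V - 1) only increases it. The
      resulting rate is 1 / (2b); the other half of the available exponent 1 / b pays for the
      cube.\<close>
    have "\<rho> * ?V \<le> \<rho> * ?V + \<sigma> * (\<rho> * ?V - 1)" using False s by simp
    also have "\<dots> = (\<rho> * (1 + \<sigma>)) * ?V - \<sigma>" by (simp add: algebra_simps)
    finally have 1: "exp (\<rho> * ?V) \<le> exp (?V / (2 * b)) * exp (-\<sigma>)"
      unfolding rho exp_add[symmetric] by simp
    have "(?V / (2 * b)) ^ 3 / fact 3 \<le> exp (?V / (2 * b))"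
      by (rule power_div_fact_le_exp) (use V0 b in simp)
    then have "?V ^ 3 \<le> 48 * b ^ 3 * exp (?V / (2 * b))"
      using b by (simp add: fact_numeral power_divide power_mult_distrib field_simps)
    then have 2: "\<bar>y j\<bar> ^ 3 \<le> 48 * b ^ 3 * exp (?V / (2 * b))"
      using power_mono[OF V, of 3] by simp
    have "?V \<in> (\<lambda>k. \<bar>y k\<bar>) ` J" unfolding vmax_def using J by (intro Max_in) auto
    then obtain k where k: "k \<in> J" "?V = \<bar>y k\<bar>" by auto
    have 3: "exp (?V / b) \<le> (\<Sum>k\<in>J. exp (\<bar>y k\<bar> / b))"
      unfolding k(2) using member_le_sum[OF k(1), of "\<lambda>k. exp (\<bar>y k\<bar> / b)"] J by auto
    have "exp (\<rho> * ?V) * \<bar>y j\<bar> ^ 3 \<le> (exp (?V / (2 * b)) * exp (-\<sigma>)) * (48 * b ^ 3 * exp (?V / (2 * b)))"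
      by (intro mult_mono 1 2) auto
    also have "\<dots> = exp (-\<sigma>) * 48 * b ^ 3 * (exp (?V / (2 * b)) * exp (?V / (2 * b)))"
      by (simp only: mult_ac)
    also have "exp (?V / (2 * b)) * exp (?V / (2 * b)) = exp (?V / b)"
      unfolding exp_add[symmetric] using b by (simp add: field_simps)
    also have "exp (-\<sigma>) * 48 * b ^ 3 * exp (?V / b) \<le> exp (-\<sigma>) * 48 * b ^ 3 * (\<Sum>k\<in>J. exp (\<bar>y k\<bar> / b))"
      using 3 b by (intro mult_left_mono) auto
    finally show ?thesis by (simp add: add_increasing)
  qed
qed

text \<open>The tails alone would only give third moments of order \<open>B ^ 3\<close>.\<close>
locale subexp_vector = prob_space P for P :: "'a measure" +
  fixes J :: "'j set" and Y :: "'a \<Rightarrow> 'j \<Rightarrow> real" and B K :: real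
  assumes J_fin: "finite J" and J_nonempty: "J \<noteq> {}" and B_pos: "B > 0"
    and Y_meas: "\<And>j. j \<in> J \<Longrightarrow> (\<lambda>x. Y x j) \<in> borel_measurable P"
    and Y_mean: "\<And>j. j \<in> J \<Longrightarrow> (\<integral>x. Y x j \<partial>P) = 0"
    and Y_exp: "\<And>j. j \<in> J \<Longrightarrow> (\<integral>\<^sup>+x. ennreal (exp (\<bar>Y x j\<bar> / B)) \<partial>P) \<le> ennreal K"
    and Y_cube: "\<And>j. j \<in> J \<Longrightarrow> (\<integral>\<^sup>+x. ennreal (\<bar>Y x j\<bar> ^ 3) \<partial>P) \<le> ennreal (K * B)"
begin

lemma K_ge_1: "K \<ge> 1"
proof -
  obtain j where j: "j \<in> J" using J_nonempty by auto
  have "1 = (\<integral>\<^sup>+x. 1 \<partial>P)" by (simp add: emeasure_space_1)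
  also have "\<dots> \<le> (\<integral>\<^sup>+x. ennreal (exp (\<bar>Y x j\<bar> / B)) \<partial>P)"
    using B_pos by (intro nn_integral_mono) simp
  also have "\<dots> \<le> ennreal K" by (rule Y_exp[OF j])
  finally show ?thesis using ennreal_le_iff2[of 1 K] by simp
qed

lemma exp_int: "j \<in> J \<Longrightarrow> integrable P (\<lambda>x. exp (\<bar>Y x j\<bar> / B))"
  and exp_le: "j \<in> J \<Longrightarrow> (\<integral>x. exp (\<bar>Y x j\<bar> / B) \<partial>P) \<le> K"
proof -
  assume j: "j \<in> J"
  note [measurable] = Y_meas[OF j]
  show i: "integrable P (\<lambda>x. exp (\<bar>Y x j\<bar> / B))"
    using le_less_trans[OF Y_exp[OF j]] by (intro integrableI_nonneg) auto
  have "ennreal (\<integral>x. exp (\<bar>Y x j\<bar> / B) \<partial>P) \<le> ennreal K"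
    using Y_exp[OF j] i by (subst (asm) nn_integral_eq_integral) auto
  then show "(\<integral>x. exp (\<bar>Y x j\<bar> / B) \<partial>P) \<le> K" using K_ge_1 by (simp add: ennreal_le_iff)
qed

lemma cube_int: "j \<in> J \<Longrightarrow> integrable P (\<lambda>x. \<bar>Y x j\<bar> ^ 3)"
  and cube_le: "j \<in> J \<Longrightarrow> (\<integral>x. \<bar>Y x j\<bar> ^ 3 \<partial>P) \<le> K * B"
proof -
  assume j: "j \<in> J"
  note [measurable] = Y_meas[OF j]
  show i: "integrable P (\<lambda>x. \<bar>Y x j\<bar> ^ 3)"
    using le_less_trans[OF Y_cube[OF j]] by (intro integrableI_nonneg) auto
  have "ennreal (\<integral>x. \<bar>Y x j\<bar> ^ 3 \<partial>P) \<le> ennreal (K * B)"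
    using Y_cube[OF j] i by (subst (asm) nn_integral_eq_integral) auto
  then show "(\<integral>x. \<bar>Y x j\<bar> ^ 3 \<partial>P) \<le> K * B" using K_ge_1 B_pos by (simp add: ennreal_le_iff)
qed

lemma power_int:
  assumes j: "j \<in> J" and q: "q \<le> 3"
  shows "integrable P (\<lambda>x. \<bar>Y x j\<bar> ^ q)"
proof (rule Bochner_Integration.integrable_bound)
  show "integrable P (\<lambda>x. 1 + \<bar>Y x j\<bar> ^ 3)" using cube_int[OF j] by simp
  have *: "z ^ q \<le> 1 + z ^ 3" if "z \<ge> 0" for z :: real
  proof (cases "z \<le> 1")
    case True then show ?thesis using that power_le_one[of z q] zero_le_power[of z 3] by linarith
  next
    case False then show ?thesis using power_increasing[OF q, of z] by linarith
  qed
  show "AE x in P. norm (\<bar>Y x j\<bar> ^ q) \<le> norm (1 + \<bar>Y x j\<bar> ^ 3)"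
  proof (intro AE_I2)
    fix x
    have "norm (\<bar>Y x j\<bar> ^ q) = \<bar>Y x j\<bar> ^ q" by simp
    also have "\<dots> \<le> 1 + \<bar>Y x j\<bar> ^ 3" by (rule *) simp
    also have "\<dots> \<le> norm (1 + \<bar>Y x j\<bar> ^ 3)" unfolding real_norm_def by (rule abs_ge_self)
    finally show "norm (\<bar>Y x j\<bar> ^ q) \<le> norm (1 + \<bar>Y x j\<bar> ^ 3)" .
  qed
qed (intro borel_measurable_power borel_measurable_abs Y_meas j)

lemma Y_int: "j \<in> J \<Longrightarrow> integrable P (\<lambda>x. Y x j)"
proof -
  assume j: "j \<in> J"
  have "integrable P (\<lambda>x. \<bar>Y x j\<bar> ^ 1)" by (rule power_int[OF j]) simp
  then have "integrable P (\<lambda>x. \<bar>Y x j\<bar>)" by (simp only: power_one_right)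
  then show ?thesis using Y_meas[OF j] by (rule integrable_abs_cancel)
qed

lemma Y_int2:
  assumes "j \<in> J" "k \<in> J" shows "integrable P (\<lambda>x. Y x j * Y x k)"
proof (rule Bochner_Integration.integrable_bound)
  show "integrable P (\<lambda>x. \<bar>Y x j\<bar> ^ 2 + \<bar>Y x k\<bar> ^ 2)" using power_int[of _ 2] assms by simp
  show "AE x in P. norm (Y x j * Y x k) \<le> norm (\<bar>Y x j\<bar> ^ 2 + \<bar>Y x k\<bar> ^ 2)"
  proof (intro AE_I2)
    fix x
    have "\<bar>a * b\<bar> \<le> \<bar>a\<bar>^2 + \<bar>b\<bar>^2" for a b :: real
    proof -
      have "0 \<le> (\<bar>a\<bar> - \<bar>b\<bar>)^2 + \<bar>a\<bar>^2 + \<bar>b\<bar>^2" by simp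
      then have "2 * (\<bar>a\<bar> * \<bar>b\<bar>) \<le> 2 * (\<bar>a\<bar>^2 + \<bar>b\<bar>^2)" by (simp add: power2_diff algebra_simps)
      then show ?thesis by (simp add: abs_mult)
    qed
    then show "norm (Y x j * Y x k) \<le> norm (\<bar>Y x j\<bar> ^ 2 + \<bar>Y x k\<bar> ^ 2)" by (simp add: add_nonneg_nonneg)
  qed
qed (intro borel_measurable_times Y_meas assms)

lemma weighted_cube:
  assumes j: "j \<in> J" and s: "\<sigma> \<ge> 0" and rho: "\<rho> * (1 + \<sigma>) = 1 / (2 * B)"
  shows "integrable P (\<lambda>x. exp (\<rho> * vmax J (Y x)) * \<bar>Y x j\<bar> ^ 3)"
    and "(\<integral>x. exp (\<rho> * vmax J (Y x)) * \<bar>Y x j\<bar> ^ 3 \<partial>P) \<le> exp 1 * (K * B) + exp (-\<sigma>) * 48 * B ^ 3 * (card J * K)"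
proof -
  let ?r = "\<lambda>x. exp 1 * \<bar>Y x j\<bar> ^ 3 + exp (-\<sigma>) * 48 * B ^ 3 * (\<Sum>k\<in>J. exp (\<bar>Y x k\<bar> / B))"
  have ir: "integrable P ?r"
    using cube_int[OF j] exp_int by (intro Bochner_Integration.integrable_add integrable_mult_right Bochner_Integration.integrable_sum) auto
  note pt = exp_vmax_cube_le[OF J_fin j B_pos s rho]
  have m: "(\<lambda>x. vmax J (Y x)) \<in> borel_measurable P" "(\<lambda>x. Y x j) \<in> borel_measurable P"
    using vmax_measurable[of J Y P] J_fin J_nonempty Y_meas j by auto
  have "norm (exp (\<rho> * vmax J (Y x)) * \<bar>Y x j\<bar> ^ 3) \<le> norm (?r x)" for x
    using pt[of "Y x"] abs_ge_self[of "?r x"] by simp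
  then show i: "integrable P (\<lambda>x. exp (\<rho> * vmax J (Y x)) * \<bar>Y x j\<bar> ^ 3)"
    by (intro Bochner_Integration.integrable_bound[OF ir] AE_I2 borel_measurable_times borel_measurable_power
        borel_measurable_abs borel_measurable_const borel_measurable_exp[THEN measurable_compose[rotated]] m)
  have "(\<integral>x. exp (\<rho> * vmax J (Y x)) * \<bar>Y x j\<bar> ^ 3 \<partial>P) \<le> (\<integral>x. ?r x \<partial>P)"
    by (intro integral_mono i ir pt)
  also have "\<dots> = exp 1 * (\<integral>x. \<bar>Y x j\<bar> ^ 3 \<partial>P) + exp (-\<sigma>) * 48 * B ^ 3 * (\<Sum>k\<in>J. \<integral>x. exp (\<bar>Y x k\<bar> / B) \<partial>P)"
    using cube_int[OF j] exp_int by simp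
  also have "\<dots> \<le> exp 1 * (K * B) + exp (-\<sigma>) * 48 * B ^ 3 * (\<Sum>k\<in>J. K)"
    using B_pos by (intro add_mono mult_left_mono sum_mono cube_le[OF j] exp_le) auto
  finally show "(\<integral>x. exp (\<rho> * vmax J (Y x)) * \<bar>Y x j\<bar> ^ 3 \<partial>P) \<le> exp 1 * (K * B) + exp (-\<sigma>) * 48 * B ^ 3 * (card J * K)"
    by simp
qed

lemma vmax_scale: "r > 0 \<Longrightarrow> vmax J (\<lambda>j. y j / r) = vmax J y / r"
proof -
  assume r: "r > 0"
  have "vmax J y / r = Max ((\<lambda>z. z / r) ` (\<lambda>j. \<bar>y j\<bar>) ` J)"
    unfolding vmax_def using r J_fin J_nonempty by (intro mono_Max_commute) (auto intro!: monoI divide_right_mono)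
  then show ?thesis unfolding vmax_def image_image using r by (simp add: abs_divide)
qed

text \<open>The condition \<open>small\<close> reduces the tail part to 48 K B, and e \<le> 3 bounds
  the main part by 3 K B; hence 51, and a third moment linear in \<open>B\<close>.\<close>

lemma summand_scaled:
  assumes r: "r > 0" and beta: "\<beta> > 0" and s: "\<sigma> \<ge> 0" and rho: "2 * \<beta> / r * (1 + \<sigma>) = 1 / (2 * B)"
    and small: "B\<^sup>2 * card J * exp (-\<sigma>) \<le> 1"
  shows "summand J \<beta> P (\<lambda>x j. Y x j / r) (51 * K * B / r ^ 3)"
proof
  show "finite J" "J \<noteq> {}" "\<beta> > 0" by (fact J_fin J_nonempty beta)+
  fix j assume j: "j \<in> J"
  have eq: "exp (2 * \<beta> * vmax J (\<lambda>j. Y x j / r)) * \<bar>Y x j / r\<bar> ^ 3 = (exp (2 * \<beta> / r * vmax J (Y x)) * \<bar>Y x j\<bar> ^ 3) / r ^ 3" for x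
    using r by (simp add: vmax_scale abs_divide power_divide)
  show "(\<lambda>x. Y x j / r) \<in> borel_measurable P" "integrable P (\<lambda>x. Y x j / r)"
    using Y_meas[OF j] Y_int[OF j] by auto
  show "(\<integral>x. Y x j / r \<partial>P) = 0" using Y_mean[OF j] by simp
  show "integrable P (\<lambda>x. exp (2 * \<beta> * vmax J (\<lambda>j. Y x j / r)) * \<bar>Y x j / r\<bar> ^ 3)"
    unfolding eq using weighted_cube(1)[OF j s rho] by simp
  have "exp (-\<sigma>) * 48 * B ^ 3 * (card J * K) = 48 * K * B * (B\<^sup>2 * card J * exp (-\<sigma>))"
    by (simp add: power2_eq_square power3_eq_cube)
  also have "\<dots> \<le> 48 * K * B * 1" using K_ge_1 B_pos by (intro mult_left_mono small) auto
  finally have 1: "exp (-\<sigma>) * 48 * B ^ 3 * (card J * K) \<le> 48 * K * B" by simp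
  have "exp 1 * (K * B) \<le> 3 * (K * B)" using exp_le K_ge_1 B_pos by (intro mult_right_mono) (auto simp: Transcendental.exp_le)
  with 1 weighted_cube(2)[OF j s rho]
  have "(\<integral>x. exp (2 * \<beta> / r * vmax J (Y x)) * \<bar>Y x j\<bar> ^ 3 \<partial>P) \<le> 51 * K * B" by linarith
  then show "(\<integral>x. exp (2 * \<beta> * vmax J (\<lambda>j. Y x j / r)) * \<bar>Y x j / r\<bar> ^ 3 \<partial>P) \<le> 51 * K * B / r ^ 3"
    unfolding eq using r by (simp add: divide_right_mono)
next
  fix j k assume "j \<in> J" "k \<in> J"
  from Y_int2[OF this] show "integrable P (\<lambda>x. Y x j / r * (Y x k / r))" by (simp add: times_divide_times_eq)
qed

end

section \<open>Rates\<close>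

lemma max_comparison_rate:
  fixes x u B K c t :: real and n p :: nat
    and Y :: "'a \<Rightarrow> 'j \<Rightarrow> real" and W :: "'b \<Rightarrow> 'j \<Rightarrow> real"
  assumes P: "subexp_vector P J Y B K" and Q: "subexp_vector Q J W B K"
    and cov: "\<And>j k. j \<in> J \<Longrightarrow> k \<in> J \<Longrightarrow> (\<integral>x. Y x j * Y x k \<partial>P) = (\<integral>x. W x j * W x k \<partial>Q)"
    and c: "c > 0" and var: "\<And>j. j \<in> J \<Longrightarrow> c \<le> (\<integral>x. W x j * W x j \<partial>Q)"
    and mgf_int: "\<And>j l. j \<in> J \<Longrightarrow> integrable Q (\<lambda>x. exp (l * W x j))"
    and mgf: "\<And>j l. j \<in> J \<Longrightarrow> (\<integral>x. exp (l * W x j) \<partial>Q) \<le> exp (l\<^sup>2)"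
    and n: "n \<ge> 2" and p: "p \<ge> 1" and cJ: "card J \<le> p\<^sup>2"
    and x: "x \<ge> 1" "x\<^sup>2 = ln (real p * real n)" and u: "u > 0" "12 * u ^ 3 \<le> 1"
    and B: "B / sqrt n = u ^ 4 / x ^ 7"
    and R: "R \<in> sets (iid {..<n} P)"
    and R_close: "\<And>\<omega> j. \<omega> \<in> space (iid {..<n} P) - R \<Longrightarrow> j \<in> J \<Longrightarrow> \<bar>T \<omega> j - (\<Sum>i<n. Y (\<omega> i) j / sqrt n)\<bar> \<le> u / x"
    and T: "\<And>j. j \<in> J \<Longrightarrow> (\<lambda>\<omega>. T \<omega> j) \<in> borel_measurable (iid {..<n} P)"
  shows "\<bar>measure (iid {..<n} P) {\<omega>\<in>space (iid {..<n} P). \<forall>j\<in>J. T \<omega> j \<le> t}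
      - measure (iid {..<n} Q) {\<omega>\<in>space (iid {..<n} Q). \<forall>j\<in>J. (\<Sum>i<n. W (\<omega> i) j / sqrt n) \<le> t}\<bar>
    \<le> (340 * K + 12 / c * (20 + 1887 * K)) * u + measure (iid {..<n} P) R"
proof -
  interpret P: subexp_vector P J Y B K by fact
  interpret Q: subexp_vector Q J W B K by fact
  let ?r = "sqrt (real n)"
  \<comment> \<open>The bias of the soft maximum, at most 2 x^2 / \<beta>, becomes 2 u / x, of the
    same order as the smoothing width.\<close>
  define \<beta> where "\<beta> = x ^ 3 / u"
  define \<psi> where "\<psi> = x / u"
  \<comment> \<open>A second, coarser scale for anti-concentration: its window
    \<open>2 / \<psi>2\<close> = 8 u / x must hold the total shift of 7 u / x, namely 1 for the
    approximation, 2 for the bias and 4 for the smoothing.\<close>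
  define \<psi>2 where "\<psi>2 = x / (4 * u)"
  \<comment> \<open>Solved from the equation \<open>rho\<close> below. The hypothesis 12 u^3 \<le> 1
    then makes it at least 2 x^2.\<close>
  define \<sigma> where "\<sigma> = x ^ 4 / (4 * u ^ 3) - 1"
  define M where "M = 51 * K * B / ?r ^ 3"
  have K1: "K \<ge> 1" by (rule P.K_ge_1)
  have r: "?r > 0" "?r\<^sup>2 = real n" using n by auto
  have pos: "\<beta> > 0" "\<psi> > 0" "\<psi>2 > 0" "x > 0" using x u by (auto simp: \<beta>_def \<psi>_def \<psi>2_def)
  have pn: "real p * real n > 0" using n p by simp
  have x2: "1 \<le> x\<^sup>2" using x(1) by simp
  have u1: "u \<le> 1"
  proof (rule ccontr)
    assume "\<not> u \<le> 1" then have "1 \<le> u ^ 3" by (intro one_le_power) simp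
    with u(2) show False by simp
  qed
  have "3 * x ^ 4 * (4 * u ^ 3) \<le> x ^ 4 * 1"
  proof -
    have "x ^ 4 * (12 * u ^ 3) \<le> x ^ 4 * 1" using u(2) by (intro mult_left_mono) auto
    then show ?thesis by simp
  qed
  then have "3 * x ^ 4 \<le> x ^ 4 / (4 * u ^ 3)"
    using u by (subst pos_le_divide_eq) auto
  moreover have "x\<^sup>2 * 1 \<le> x\<^sup>2 * x\<^sup>2" using x2 by (intro mult_left_mono) auto
  then have "x\<^sup>2 \<le> x ^ 4" by (simp add: power2_eq_square power4_eq_xxxx mult.assoc)
  ultimately have sig: "\<sigma> \<ge> 2 * x\<^sup>2" unfolding \<sigma>_def using x2 by linarith
  have sig0: "\<sigma> \<ge> 0" using sig x2 by linarith
  have Br: "B = ?r * (u ^ 4 / x ^ 7)" using B r(1) by (simp add: field_simps)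
  have rho: "2 * \<beta> / ?r * (1 + \<sigma>) = 1 / (2 * B)"
    unfolding Br \<beta>_def \<sigma>_def using r(1) u pos by (simp add: field_simps eval_nat_numeral)
  have Bn: "B\<^sup>2 \<le> n"
  proof -
    have "u ^ 4 / x ^ 7 \<le> 1" using u u1 x by (simp add: divide_le_eq_1 power_le_one one_le_power order_trans[of "u^4" 1])
    then have "B \<le> ?r * 1" unfolding Br using r by (intro mult_left_mono) auto
    then have "B\<^sup>2 \<le> ?r\<^sup>2" using P.B_pos by (intro power_mono) auto
    then show ?thesis using r by simp
  qed
  \<comment> \<open>\<open>exp (-\<sigma>)\<close> is at most (pn)^(-2), while the squared
    \<open>B\<close> is at most n and \<open>card J\<close> at most p^2.\<close>
  have small: "B\<^sup>2 * card J * exp (-\<sigma>) \<le> 1"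
  proof -
    have "exp (-\<sigma>) \<le> exp (- (2 * x\<^sup>2))" using sig by simp
    also have "\<dots> = 1 / (real p * real n)\<^sup>2"
    proof -
      have "exp (2 * x\<^sup>2) = (real p * real n)\<^sup>2"
        unfolding x(2) exp_double using pn by simp
      then show ?thesis by (simp add: exp_minus inverse_eq_divide)
    qed
    finally have "B\<^sup>2 * card J * exp (-\<sigma>) \<le> (n * (real p)\<^sup>2) * (1 / (real p * real n)\<^sup>2)"
      using Bn cJ by (intro mult_mono) (auto simp: of_nat_power[symmetric] simp del: of_nat_power)
    also have "\<dots> = 1 / n" using n p by (simp add: power2_eq_square field_simps)
    also have "\<dots> \<le> 1" using n by simp
    finally show ?thesis .
  qed
  have SP: "summand J \<beta> P (\<lambda>z j. Y z j / ?r) M" and SQ: "summand J \<beta> Q (\<lambda>z j. W z j / ?r) M"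
    unfolding M_def using P.summand_scaled[OF r(1) pos(1) sig0 rho small] Q.summand_scaled[OF r(1) pos(1) sig0 rho small] .
  interpret SP: summand J \<beta> P "\<lambda>z j. Y z j / ?r" M by (rule SP)
  interpret SQ: summand J \<beta> Q "\<lambda>z j. W z j / ?r" M by (rule SQ)
  have nM: "n * M = 51 * K * (u ^ 4 / x ^ 7)"
  proof -
    have "n * M = 51 * K * (B / ?r) * (real n / ?r\<^sup>2)" unfolding M_def by (simp add: power2_eq_square power3_eq_cube)
    then show ?thesis unfolding B r(2) using n by simp
  qed
  have lnJ: "ln (card J) \<le> 2 * x\<^sup>2" "ln (2 * card J) \<le> 2 * x\<^sup>2"
  proof -
    have c0: "card J > 0" using P.J_fin P.J_nonempty by (simp add: card_gt_0_iff)
    have "real (2 * card J) \<le> 2 * (real p)\<^sup>2" using cJ by (simp add: of_nat_power[symmetric] del: of_nat_power)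
    also have "\<dots> \<le> (real n)\<^sup>2 * (real p)\<^sup>2" using n power_mono[of 2 "real n" 2] by (intro mult_right_mono) auto
    finally have "real (2 * card J) \<le> (real p * real n)\<^sup>2" by (simp add: power_mult_distrib mult.commute)
    then have "ln (real (2 * card J)) \<le> ln ((real p * real n)\<^sup>2)" using c0 n p by (subst ln_le_cancel_iff) auto
    also have "\<dots> = 2 * x\<^sup>2" unfolding x(2) using pn by (subst ln_realpow) auto
    finally show 1: "ln (2 * card J) \<le> 2 * x\<^sup>2" by simp
    have "ln (card J) \<le> ln (2 * card J)" using c0 by simp
    with 1 show "ln (card J) \<le> 2 * x\<^sup>2" by simp
  qed
  have ac: "measure (iid {..<n} Q) {\<omega>\<in>space (iid {..<n} Q). s \<le> SP.lse (\<lambda>j. \<Sum>i<n. W (\<omega> i) j / ?r)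
        \<and> SP.lse (\<lambda>j. \<Sum>i<n. W (\<omega> i) j / ?r) \<le> s + 2 / \<psi>2} \<le> 12 / c * (20 + 1887 * K) * u" (is "?m \<le> _") for s
  proof -
    have e: "exp (x * (W z j / ?r)) = exp ((x / ?r) * W z j)" "exp (- x * (W z j / ?r)) = exp ((- x / ?r) * W z j)" for z j by simp_all
    have m: "(\<integral>z. exp (x / ?r * W z j) \<partial>Q) \<le> exp (x\<^sup>2 / n)" "(\<integral>z. exp (- x / ?r * W z j) \<partial>Q) \<le> exp (x\<^sup>2 / n)" if "j \<in> J" for j
      using mgf[OF that, of "x / ?r"] mgf[OF that, of "- x / ?r"] r(2) by (simp_all add: power_divide)
    have mi: "integrable Q (\<lambda>z. exp (x / ?r * W z j))" "integrable Q (\<lambda>z. exp (- x / ?r * W z j))" if "j \<in> J" for j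
      using mgf_int[OF that] by blast+
    \<comment> \<open>The exponential parameter is l = x: the logarithm of the cardinality and the
      log moment generating function of the sum are then both at most 2 x^2, and dividing by l gives
      a maximum of order x.\<close>
    have "n * (c / n) * ?m \<le> 12 * ((1 / \<beta> + 1 / \<psi>2) / x * (ln (2 * card J) + Suc n * (x\<^sup>2 / n))
       + n * (2 * \<psi>2 + 6 * \<beta> + 6 * \<beta>\<^sup>2 * (1 / \<beta> + 1 / \<psi>2)) * M)"
    proof (rule SQ.anticoncentration[OF pos(4) _ pos(3)])
      fix j assume j: "j \<in> J"
      have "(\<integral>z. W z j / ?r * (W z j / ?r) \<partial>Q) = (\<integral>z. W z j * W z j \<partial>Q) / n"
        using r(2) by (simp add: power2_eq_square)
      then show "c / n \<le> (\<integral>z. W z j / ?r * (W z j / ?r) \<partial>Q)" using var[OF j] by (simp add: divide_right_mono)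
    qed (unfold e, use n c mi m in auto)
    \<comment> \<open>Here 20 = 5 * 4, from 5 u / x for the test function and 4 x^2 for the two
      logarithmic terms; 1887 = 37 * 51, from the derivative bound and the constant in
      \<open>M\<close>.\<close>
    also have "\<dots> \<le> 12 * (20 * u + 1887 * K * u)"
    proof (intro mult_left_mono add_mono)
      have ub: "1 / \<beta> + 1 / \<psi>2 \<le> 5 * u / x"
      proof -
        have "1 / \<beta> \<le> u / x"
        proof -
          have "x * 1 \<le> x * x\<^sup>2" using x2 pos by (intro mult_left_mono) auto
          then have "u / x ^ 3 \<le> u / x" using u pos by (intro divide_left_mono) (auto simp: power2_eq_square power3_eq_cube)
          then show ?thesis by (simp add: \<beta>_def)
        qed
        then show ?thesis by (simp add: \<psi>2_def add_divide_distrib)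
      qed
      have "Suc n * (x\<^sup>2 / n) \<le> 2 * x\<^sup>2"
      proof -
        have "real (Suc n) * x\<^sup>2 \<le> (2 * n) * x\<^sup>2" using n by (intro mult_right_mono) auto
        then show ?thesis using n by (simp add: field_simps)
      qed
      then have "(1 / \<beta> + 1 / \<psi>2) / x * (ln (2 * card J) + Suc n * (x\<^sup>2 / n)) \<le> (5 * u / x) / x * (4 * x\<^sup>2)"
      proof (intro mult_mono divide_right_mono ub)
        have "0 < card J" using P.J_fin P.J_nonempty by (simp add: card_gt_0_iff)
        then have "1 \<le> real (2 * card J)" by linarith
        then have "0 \<le> ln (2 * card J)" by (rule ln_ge_zero)
        then show "0 \<le> ln (2 * card J) + Suc n * (x\<^sup>2 / n)" by simp
      qed (use lnJ u pos in auto)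
      also have "\<dots> = 20 * u" using pos by (simp add: power2_eq_square)
      finally show "(1 / \<beta> + 1 / \<psi>2) / x * (ln (2 * card J) + Suc n * (x\<^sup>2 / n)) \<le> 20 * u" .
      have pw: "x ^ i \<le> x ^ 5" if "i \<le> 5" for i using x that by (intro power_increasing) auto
      have "2 * \<psi>2 + 6 * \<beta> + 6 * \<beta>\<^sup>2 * (1 / \<beta> + 1 / \<psi>2) \<le> 37 * (x ^ 5 / u)"
      proof -
        have "6 * \<beta>\<^sup>2 * (1 / \<beta> + 1 / \<psi>2) \<le> 6 * \<beta>\<^sup>2 * (5 * u / x)" by (intro mult_left_mono ub) auto
        also have "\<dots> = 30 * (x ^ 5 / u)" unfolding \<beta>_def using u pos by (simp add: field_simps eval_nat_numeral)
        finally have 1: "6 * \<beta>\<^sup>2 * (1 / \<beta> + 1 / \<psi>2) \<le> 30 * (x ^ 5 / u)" .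
        have 2: "\<beta> \<le> x ^ 5 / u" unfolding \<beta>_def using u by (intro divide_right_mono pw) auto
        have "2 * \<psi>2 = (x / u) / 2" by (simp add: \<psi>2_def)
        also have "x / u \<le> x ^ 5 / u" using u pw[of 1] by (intro divide_right_mono) auto
        finally have 3: "2 * \<psi>2 \<le> x ^ 5 / u" using u pos by simp
        from 1 2 3 show ?thesis by linarith
      qed
      then have "(2 * \<psi>2 + 6 * \<beta> + 6 * \<beta>\<^sup>2 * (1 / \<beta> + 1 / \<psi>2)) * (n * M) \<le> 37 * (x ^ 5 / u) * (n * M)"
        using SP.M_nonneg by (intro mult_right_mono) auto
      also have "\<dots> = 1887 * K * (u * (u\<^sup>2 / x\<^sup>2))" unfolding nM using u pos by (simp add: field_simps eval_nat_numeral)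
      also have "\<dots> \<le> 1887 * K * (u * 1)"
      proof (intro mult_left_mono)
        have "u\<^sup>2 \<le> 1" using u u1 by (simp add: power_le_one)
        then show "u\<^sup>2 / x\<^sup>2 \<le> 1" using x2 by (simp add: divide_le_eq_1)
      qed (use u K1 in auto)
      finally show "n * (2 * \<psi>2 + 6 * \<beta> + 6 * \<beta>\<^sup>2 * (1 / \<beta> + 1 / \<psi>2)) * M \<le> 1887 * K * u" by (simp add: mult_ac)
    qed simp
    finally have "c * ?m \<le> 12 * (20 * u + 1887 * K * u)" using n by simp
    then have "?m \<le> 12 * (20 * u + 1887 * K * u) / c" using c by (simp add: pos_le_divide_eq mult.commute)
    also have "\<dots> = 12 / c * (20 + 1887 * K) * u" by (simp add: distrib_left distrib_right add_divide_distrib)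
    finally show ?thesis .
  qed
  have width: "u / x + ln (card J) / \<beta> + 4 / \<psi> \<le> 2 / \<psi>2"
  proof -
    have "ln (card J) / \<beta> \<le> 2 * x\<^sup>2 / \<beta>" using lnJ pos by (intro divide_right_mono) auto
    also have "\<dots> = 2 * (u / x)" unfolding \<beta>_def using u pos by (simp add: field_simps eval_nat_numeral)
    finally have "ln (card J) / \<beta> \<le> 2 * (u / x)" .
    moreover have "4 / \<psi> = 4 * (u / x)" "2 / \<psi>2 = 8 * (u / x)" by (simp_all add: \<psi>_def \<psi>2_def)
    moreover have "0 \<le> u / x" using u pos by simp
    ultimately show ?thesis by linarith
  qed
  have "\<bar>measure (iid {..<n} P) {\<omega>\<in>space (iid {..<n} P). \<forall>j\<in>J. T \<omega> j \<le> t}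
      - measure (iid {..<n} Q) {\<omega>\<in>space (iid {..<n} Q). \<forall>j\<in>J. (\<Sum>i<n. W (\<omega> i) j / ?r) \<le> t}\<bar>
    \<le> n * ((2 * \<psi>^3 + 12 * \<beta> * \<psi>\<^sup>2 + 6 * \<beta>\<^sup>2 * \<psi>) / 6 * (M + M)) + 12 / c * (20 + 1887 * K) * u + measure (iid {..<n} P) R"
    by (rule SP.max_comparison[OF SP SQ _ pos(2) R R_close T width ac]) (use cov in auto)
  \<comment> \<open>The three terms are at most 20 x^7 / u^3 together, and 20 * 51 / 3 =
    340.\<close>
  also have "n * ((2 * \<psi>^3 + 12 * \<beta> * \<psi>\<^sup>2 + 6 * \<beta>\<^sup>2 * \<psi>) / 6 * (M + M)) \<le> 340 * K * u"
  proof -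
    have pw: "x ^ i / u ^ 3 \<le> x ^ 7 / u ^ 3" if "i \<le> 7" for i using x u that by (intro divide_right_mono power_increasing) auto
    have "2 * \<psi>^3 + 12 * \<beta> * \<psi>\<^sup>2 + 6 * \<beta>\<^sup>2 * \<psi> = 2 * (x ^ 3 / u ^ 3) + 12 * (x ^ 5 / u ^ 3) + 6 * (x ^ 7 / u ^ 3)"
      unfolding \<psi>_def \<beta>_def using u by (simp add: field_simps eval_nat_numeral)
    also have "\<dots> \<le> 20 * (x ^ 7 / u ^ 3)" using pw[of 3] pw[of 5] by linarith
    finally have "(2 * \<psi>^3 + 12 * \<beta> * \<psi>\<^sup>2 + 6 * \<beta>\<^sup>2 * \<psi>) * (n * M / 3) \<le> 20 * (x ^ 7 / u ^ 3) * (n * M / 3)"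
      using SP.M_nonneg by (intro mult_right_mono) auto
    also have "\<dots> = 340 * K * u" unfolding nM using u pos by (simp add: field_simps eval_nat_numeral)
    finally have "(2 * \<psi>^3 + 12 * \<beta> * \<psi>\<^sup>2 + 6 * \<beta>\<^sup>2 * \<psi>) * (n * M / 3) \<le> 340 * K * u" .
    moreover have "n * (A / 6 * (M + M)) = A * (n * M / 3)" for A by simp
    ultimately show ?thesis by (simp only:)
  qed
  finally show ?thesis by (simp add: algebra_simps)
qed

text \<open>Markov's inequality with the 2m-th moment of the canonical part. The order m stays free
  so that it can grow with ln (p n), which makes a union over all matrix entries affordable.\<close>

lemma (in sym_kernel) ustat_remainder_prob:
  fixes n m :: nat and D :: real
  assumes n: "n \<ge> 2" and m: "m \<ge> 1" and D: "D > 0"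
  defines "S \<equiv> iid {..<n} F"
  defines "E \<equiv> {\<omega> \<in> space S. D < \<bar>sqrt n * ((\<Sum>i<n. \<Sum>j\<in>{i<..<n}. k (\<omega> i) (\<omega> j)) / real (n choose 2) - mean) / 2
          - (\<Sum>i<n. (proj (\<omega> i) - mean) / sqrt n)\<bar>}"
  shows "E \<in> sets S" and "measure S E \<le> 8 * (64 * (real m)\<^sup>2 * (B / sqrt n) / D) ^ (2 * m)"
proof -
  interpret S: prob_space S unfolding S_def by (intro prob_space_PiM prob_space_axioms)
  let ?C = "\<lambda>\<omega>. \<Sum>j<n. \<Sum>i<j. canon (\<omega> i) (\<omega> j)"
  define a where "a = sqrt n / (real n * (real n - 1))"
  have a0: "a \<ge> 0" using n by (simp add: a_def)
  have ch: "real (n choose 2) = real n * (real n - 1) / 2"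
  proof -
    have "real (k choose 2) = real k * (real k - 1) / 2" for k
      by (induction k) (auto simp: numeral_2_eq_2 field_simps)
    then show ?thesis .
  qed
  have eq: "sqrt n * ((\<Sum>i<n. \<Sum>j\<in>{i<..<n}. k (\<omega> i) (\<omega> j)) / real (n choose 2) - mean) / 2
          - (\<Sum>i<n. (proj (\<omega> i) - mean) / sqrt n) = a * ?C \<omega>" for \<omega>
  proof -
    let ?G = "\<Sum>i<n. proj (\<omega> i) - mean"
    have c0: "real (n choose 2) \<noteq> 0" using n by (simp add: ch)
    have "(\<Sum>i<n. \<Sum>j\<in>{i<..<n}. k (\<omega> i) (\<omega> j)) / real (n choose 2) - mean
      = ((\<Sum>i<n. \<Sum>j\<in>{i<..<n}. k (\<omega> i) (\<omega> j)) - real (n choose 2) * mean) / real (n choose 2)"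
      using c0 by (simp add: diff_divide_distrib)
    also have "\<dots> = ((real n - 1) * ?G + ?C \<omega>) / real (n choose 2)" unfolding ustat_pair_sum ..
    finally have h: "(\<Sum>i<n. \<Sum>j\<in>{i<..<n}. k (\<omega> i) (\<omega> j)) / real (n choose 2) - mean
      = ((real n - 1) * ?G + ?C \<omega>) / real (n choose 2)" .
    have half: "s * (z / (b / 2)) / 2 = s * z / b" for s z b :: real by simp
    have "sqrt n * ((\<Sum>i<n. \<Sum>j\<in>{i<..<n}. k (\<omega> i) (\<omega> j)) / real (n choose 2) - mean) / 2
      = sqrt n * (real n - 1) * ?G / (real n * (real n - 1)) + sqrt n * ?C \<omega> / (real n * (real n - 1))"
      unfolding h unfolding ch half distrib_left add_divide_distrib mult.assoc ..
    also have "sqrt n * (real n - 1) * ?G / (real n * (real n - 1)) = ?G / sqrt n"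
    proof -
      have "real n = sqrt n * sqrt n" by simp
      then show ?thesis using n by (simp add: divide_simps)
    qed
    also have "?G / sqrt n = (\<Sum>i<n. (proj (\<omega> i) - mean) / sqrt n)" by (simp add: sum_divide_distrib)
    finally show ?thesis unfolding a_def times_divide_eq_left by linarith
  qed
  have cm: "?C \<in> borel_measurable S"
    unfolding S_def
    by (intro borel_measurable_sum measurable_compose[OF measurable_Pair canon_meas, simplified] measurable_component_singleton)
       (meson lessThan_iff less_trans)+
  have E: "E = {\<omega> \<in> space S. D < \<bar>a * ?C \<omega>\<bar>}" unfolding E_def eq ..
  show Em: "E \<in> sets S" unfolding E using cm by measurable
  have "emeasure S E = (\<integral>\<^sup>+\<omega>. indicator E \<omega> \<partial>S)" using Em by simp
  also have "\<dots> \<le> (\<integral>\<^sup>+\<omega>. ennreal ((a / D) ^ (2 * m)) * ennreal (?C \<omega> ^ (2 * m)) \<partial>S)"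
  proof (intro nn_integral_mono)
    fix \<omega> assume "\<omega> \<in> space S"
    show "indicator E \<omega> \<le> ennreal ((a / D) ^ (2 * m)) * ennreal (?C \<omega> ^ (2 * m))"
    proof (cases "\<omega> \<in> E")
      case True
      then have "1 \<le> \<bar>a * ?C \<omega>\<bar> / D" using D by (simp add: E)
      then have "1 \<le> (\<bar>a * ?C \<omega>\<bar> / D) ^ (2 * m)" by (rule one_le_power)
      also have "\<dots> = (a / D) ^ (2 * m) * ?C \<omega> ^ (2 * m)"
        using a0 by (simp add: power_divide abs_mult power_mult_distrib power_even_abs)
      finally have "1 \<le> (a / D) ^ (2 * m) * ?C \<omega> ^ (2 * m)" .
      then show ?thesis using True a0 D by (simp add: ennreal_mult[symmetric] zero_le_even_power del: ennreal_power)
    qed simp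
  qed
  also have "\<dots> = ennreal ((a / D) ^ (2 * m)) * (\<integral>\<^sup>+\<omega>. ennreal (?C \<omega> ^ (2 * m)) \<partial>S)"
    by (intro nn_integral_cmult measurable_compose[OF borel_measurable_power[OF cm] measurable_ennreal])
  also have "\<dots> \<le> ennreal ((a / D) ^ (2 * m)) * ennreal (8 * (32 * (real m)\<^sup>2 * real n * B) ^ (2 * m))"
    unfolding S_def by (intro mult_left_mono canon_ustat_moment m) auto
  also have "\<dots> = ennreal (8 * (a / D * (32 * (real m)\<^sup>2 * real n * B)) ^ (2 * m))"
    using a0 D B_pos unfolding power_mult_distrib[of "a / D"]
    by (simp add: ennreal_mult[symmetric] mult.left_commute del: ennreal_power)
  finally have "ennreal (measure S E) \<le> ennreal (8 * (a / D * (32 * (real m)\<^sup>2 * real n * B)) ^ (2 * m))"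
    by (simp add: S.emeasure_eq_measure)
  then have "measure S E \<le> 8 * (a / D * (32 * (real m)\<^sup>2 * real n * B)) ^ (2 * m)"
    by (subst (asm) ennreal_le_iff) (simp_all add: zero_le_even_power)
  also have "\<dots> \<le> 8 * (64 * (real m)\<^sup>2 * (B / sqrt n) / D) ^ (2 * m)"
  proof (intro mult_left_mono power_mono)
    \<comment> \<open>For n \<ge> 2, n - 1 is at least n / 2; this doubles 32 to 64.\<close>
    have "a * n \<le> 2 / sqrt n"
    proof -
      have "a * n = sqrt n / (real n - 1)" using n by (simp add: a_def)
      also have "\<dots> \<le> sqrt n / (real n / 2)" using n by (intro divide_left_mono) auto
      also have "\<dots> = 2 / sqrt n" using n by (simp add: real_div_sqrt field_simps)
      finally show ?thesis .
    qed
    then have "(32 * (real m)\<^sup>2 * B / D) * (a * n) \<le> (32 * (real m)\<^sup>2 * B / D) * (2 / sqrt n)"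
      using B_pos D by (intro mult_left_mono) auto
    then show "a / D * (32 * (real m)\<^sup>2 * real n * B) \<le> 64 * (real m)\<^sup>2 * (B / sqrt n) / D"
      by (simp add: mult_ac)
  qed (use a0 D B_pos in auto)
  finally show "measure S E \<le> 8 * (64 * (real m)\<^sup>2 * (B / sqrt n) / D) ^ (2 * m)" .
qed

section \<open>Gaussian vectors\<close>

context prob_space begin

context
  fixes X :: "'a \<Rightarrow> real" and \<sigma> :: real
  assumes X: "X \<in> borel_measurable M" and s: "\<sigma> > 0"
    and d: "distr M borel X = density lborel (normal_density 0 \<sigma>)"
begin

lemma normal_distributed: "distributed M lborel X (normal_density 0 \<sigma>)"
  unfolding distributed_def using X d by (simp add: distr_cong[OF refl sets_lborel[symmetric] refl])

text \<open>Completing the square turns the tilted density into a multiple of the normal density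
  shifted to l \<sigma>^2.\<close>

lemma normal_exp: "has_bochner_integral M (\<lambda>\<omega>. exp (l * X \<omega>)) (exp (l\<^sup>2 * \<sigma>\<^sup>2 / 2))"
proof -
  have eq: "normal_density 0 \<sigma> y * exp (l * y) = exp (l\<^sup>2 * \<sigma>\<^sup>2 / 2) * normal_density (l * \<sigma>\<^sup>2) \<sigma> y" for y
  proof -
    have "- (y - 0)\<^sup>2 / (2 * \<sigma>\<^sup>2) + l * y = l\<^sup>2 * \<sigma>\<^sup>2 / 2 + (- (y - l * \<sigma>\<^sup>2)\<^sup>2 / (2 * \<sigma>\<^sup>2))"
      using s by (simp add: field_simps power2_eq_square)
    then have "exp (- (y - 0)\<^sup>2 / (2 * \<sigma>\<^sup>2)) * exp (l * y) = exp (l\<^sup>2 * \<sigma>\<^sup>2 / 2) * exp (- (y - l * \<sigma>\<^sup>2)\<^sup>2 / (2 * \<sigma>\<^sup>2))"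
      unfolding exp_add[symmetric] by simp
    then show ?thesis unfolding normal_density_def by (simp add: mult.assoc mult.left_commute)
  qed
  have "has_bochner_integral lborel (\<lambda>y. exp (l\<^sup>2 * \<sigma>\<^sup>2 / 2) * normal_density (l * \<sigma>\<^sup>2) \<sigma> y) (exp (l\<^sup>2 * \<sigma>\<^sup>2 / 2) * 1)"
    using s by (intro has_bochner_integral_mult_right) (simp add: has_bochner_integral_iff)
  then have "has_bochner_integral lborel (\<lambda>y. normal_density 0 \<sigma> y *\<^sub>R exp (l * y)) (exp (l\<^sup>2 * \<sigma>\<^sup>2 / 2))"
    by (simp add: eq)
  then have "has_bochner_integral (distr M borel X) (\<lambda>y. exp (l * y)) (exp (l\<^sup>2 * \<sigma>\<^sup>2 / 2))"
    unfolding d by (intro has_bochner_integral_density) auto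
  then show ?thesis
    using X by (simp add: has_bochner_integral_iff integrable_distr_eq integral_distr)
qed

lemma normal_square: "has_bochner_integral M (\<lambda>\<omega>. (X \<omega>)\<^sup>2) (\<sigma>\<^sup>2)"
proof -
  have e0: "expectation X = 0" using normal_distributed_expectation[OF s normal_distributed] .
  have v: "variance X = \<sigma>\<^sup>2" using normal_distributed_variance[OF s normal_distributed] .
  have "expectation (\<lambda>\<omega>. (X \<omega>)\<^sup>2) = \<sigma>\<^sup>2" using v unfolding e0 by simp
  \<comment> \<open>A nonintegrable function would have integral 0, but the value found is
    positive.\<close>
  moreover from this have "integrable M (\<lambda>\<omega>. (X \<omega>)\<^sup>2)"
    using s not_integrable_integral_eq by force
  ultimately show ?thesis by (simp add: has_bochner_integral_iff)
qed

lemma normal_mean: "expectation X = 0"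
  using normal_distributed_expectation[OF s normal_distributed] .

lemma normal_exp_abs: "(\<integral>\<^sup>+\<omega>. ennreal (exp \<bar>X \<omega>\<bar>) \<partial>M) \<le> ennreal (2 * exp (\<sigma>\<^sup>2 / 2))"
proof -
  have "exp \<bar>z\<bar> \<le> exp (1 * z) + exp ((- 1) * z)" for z :: real by (cases "z \<ge> 0") auto
  then have "(\<integral>\<^sup>+\<omega>. ennreal (exp \<bar>X \<omega>\<bar>) \<partial>M) \<le> (\<integral>\<^sup>+\<omega>. ennreal (exp (1 * X \<omega>) + exp ((- 1) * X \<omega>)) \<partial>M)"
    by (intro nn_integral_mono ennreal_leI)
  also have "\<dots> = ennreal (\<integral>\<omega>. exp (1 * X \<omega>) + exp ((- 1) * X \<omega>) \<partial>M)"
    using normal_exp[of 1] normal_exp[of "- 1"]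
    by (intro nn_integral_eq_integral) (auto simp: has_bochner_integral_iff add_nonneg_nonneg)
  also have "(\<integral>\<omega>. exp (1 * X \<omega>) + exp ((- 1) * X \<omega>) \<partial>M) = 2 * exp (\<sigma>\<^sup>2 / 2)"
    using normal_exp[of 1] normal_exp[of "- 1"] by (simp add: has_bochner_integral_iff)
  finally show ?thesis .
qed

end

end

section \<open>Coordinates and covariances of a Gaussian vector given by its linear
  combinations\<close>

context
  fixes I :: "'i set" and \<Gamma> :: "'i \<Rightarrow> 'i \<Rightarrow> real" and G :: "('i \<Rightarrow> real) measure"
  assumes G: "centered_gaussian I \<Gamma> G" and I: "finite I"
    and sym: "\<And>i j. i \<in> I \<Longrightarrow> j \<in> I \<Longrightarrow> \<Gamma> i j = \<Gamma> j i" and diag: "\<And>i. i \<in> I \<Longrightarrow> \<Gamma> i i > 0"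
begin

lemma gaussian_prob: "prob_space G"
  using G by (simp add: centered_gaussian_def)

lemma gaussian_component_meas: "i \<in> I \<Longrightarrow> (\<lambda>w. w i) \<in> borel_measurable G"
proof -
  assume "i \<in> I"
  then have "(\<lambda>w. w i) \<in> borel_measurable (PiM I (\<lambda>_. borel :: real measure))" by (rule measurable_component_singleton)
  then show ?thesis using G by (simp add: centered_gaussian_def cong: measurable_cong_sets)
qed

lemma gaussian_linear:
  fixes a :: "'i \<Rightarrow> real"
  defines "v \<equiv> \<Sum>i\<in>I. \<Sum>j\<in>I. a i * a j * \<Gamma> i j"
  shows "(v = 0 \<and> distr G borel (\<lambda>w. \<Sum>i\<in>I. a i * w i) = return borel 0) \<or>
          (v > 0 \<and> distr G borel (\<lambda>w. \<Sum>i\<in>I. a i * w i) = density lborel (normal_density 0 (sqrt v)))"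
  using G unfolding centered_gaussian_def Let_def v_def by blast

lemma gaussian_linear_meas: "(\<lambda>w. \<Sum>i\<in>I. a i * w i) \<in> borel_measurable G"
  by (intro borel_measurable_sum borel_measurable_times borel_measurable_const gaussian_component_meas)

text \<open>Both alternatives have to be treated: the diagonal is positive, but \<Gamma> may be
  singular, so a combination of coordinates may be a point mass at 0.\<close>

lemma gaussian_linear_square:
  "(\<integral>w. (\<Sum>i\<in>I. a i * w i)\<^sup>2 \<partial>G) = (\<Sum>i\<in>I. \<Sum>j\<in>I. a i * a j * \<Gamma> i j)"
proof -
  interpret prob_space G by (rule gaussian_prob)
  let ?v = "\<Sum>i\<in>I. \<Sum>j\<in>I. a i * a j * \<Gamma> i j" and ?X = "\<lambda>w. \<Sum>i\<in>I. a i * w i"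
  from gaussian_linear[of a] show ?thesis
  proof (elim disjE conjE)
    assume v: "?v = 0" and d: "distr G borel ?X = return borel 0"
    have "(\<integral>w. (?X w)\<^sup>2 \<partial>G) = (\<integral>y. y\<^sup>2 \<partial>distr G borel ?X)"
      by (rule integral_distr[symmetric, OF gaussian_linear_meas]) simp
    also have "\<dots> = 0" unfolding d by (subst integral_return) auto
    finally show ?thesis using v by simp
  next
    assume v: "?v > 0" and d: "distr G borel ?X = density lborel (normal_density 0 (sqrt ?v))"
    show ?thesis
      using normal_square[OF gaussian_linear_meas _ d] v by (simp add: has_bochner_integral_iff)
  qed
qed

lemma gaussian_component_normal:
  assumes i: "i \<in> I"
  shows "distr G borel (\<lambda>w. w i) = density lborel (normal_density 0 (sqrt (\<Gamma> i i)))"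
proof -
  let ?a = "\<lambda>j. if j = i then 1 else 0 :: real"
  have 1: "(\<Sum>j\<in>I. ?a j * w j) = w i" for w using I i by (simp add: if_distrib[of "\<lambda>x. x * _"] cong: if_cong)
  have "(\<Sum>j\<in>I. \<Sum>k\<in>I. ?a j * ?a k * \<Gamma> j k) = (\<Sum>j\<in>I. ?a j * (\<Sum>k\<in>I. ?a k * \<Gamma> j k))"
    by (simp add: sum_distrib_left mult.assoc)
  also have "\<dots> = \<Gamma> i i" using I i by (simp add: if_distrib[of "\<lambda>x. x * _"] cong: if_cong)
  finally have 2: "(\<Sum>j\<in>I. \<Sum>k\<in>I. ?a j * ?a k * \<Gamma> j k) = \<Gamma> i i" .
  from gaussian_linear[of ?a] show ?thesis unfolding 1 2 using diag[OF i] by auto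
qed

text \<open>The definition speaks of single linear combinations only, so mixed moments are recovered
  by polarisation from \<open>w i + w j\<close>.\<close>

lemma gaussian_covariance:
  assumes ij: "i \<in> I" "j \<in> I"
  shows "(\<integral>w. w i * w j \<partial>G) = \<Gamma> i j"
proof -
  interpret prob_space G by (rule gaussian_prob)
  let ?a = "\<lambda>k. (if k = i then 1 else 0) + (if k = j then 1 else 0) :: real"
  have sel: "(\<Sum>k\<in>I. ?a k * f k) = f i + f j" for f :: "'i \<Rightarrow> real"
    using I ij by (simp add: distrib_right sum.distrib if_distrib[of "\<lambda>x. x * _"] cong: if_cong)
  have "(\<Sum>k\<in>I. \<Sum>l\<in>I. ?a k * ?a l * \<Gamma> k l) = (\<Sum>k\<in>I. ?a k * (\<Sum>l\<in>I. ?a l * \<Gamma> k l))"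
    by (simp only: sum_distrib_left mult.assoc)
  also have "\<dots> = \<Gamma> i i + \<Gamma> i j + (\<Gamma> j i + \<Gamma> j j)" unfolding sel ..
  finally have 1: "(\<integral>w. (w i + w j)\<^sup>2 \<partial>G) = \<Gamma> i i + \<Gamma> j j + 2 * \<Gamma> i j"
    using gaussian_linear_square[of ?a] sym[OF ij] unfolding sel by simp
  have sq: "has_bochner_integral G (\<lambda>w. (w k)\<^sup>2) (\<Gamma> k k)" if "k \<in> I" for k
    using normal_square[OF gaussian_component_meas[OF that] _ gaussian_component_normal[OF that]] diag[OF that] by simp
  have ip: "integrable G (\<lambda>w. w i * w j)"
  proof (rule Bochner_Integration.integrable_bound)
    show "integrable G (\<lambda>w. (w i)\<^sup>2 + (w j)\<^sup>2)" using sq ij by (simp add: has_bochner_integral_iff)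
    show "AE w in G. norm (w i * w j) \<le> norm ((w i)\<^sup>2 + (w j)\<^sup>2)"
    proof (intro AE_I2)
      fix w :: "'i \<Rightarrow> real"
      have "2 * \<bar>w i * w j\<bar> \<le> (w i)\<^sup>2 + (w j)\<^sup>2"
        using sum_squares_bound[of "\<bar>w i\<bar>" "\<bar>w j\<bar>"] by (simp add: abs_mult)
      then show "norm (w i * w j) \<le> norm ((w i)\<^sup>2 + (w j)\<^sup>2)" by simp
    qed
  qed (intro borel_measurable_times gaussian_component_meas ij)
  have "(\<integral>w. (w i + w j)\<^sup>2 \<partial>G) = (\<integral>w. (w i)\<^sup>2 + (w j)\<^sup>2 + 2 * (w i * w j) \<partial>G)"
    by (simp add: power2_sum mult.assoc)
  also have "\<dots> = \<Gamma> i i + \<Gamma> j j + 2 * (\<integral>w. w i * w j \<partial>G)"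
    using sq[OF ij(1)] sq[OF ij(2)] ip by (simp add: has_bochner_integral_iff)
  finally show ?thesis using 1 by simp
qed

lemma gaussian_mgf:
  assumes "i \<in> I" "\<Gamma> i i \<le> 2"
  shows "integrable G (\<lambda>w. exp (l * w i))" "(\<integral>w. exp (l * w i) \<partial>G) \<le> exp (l\<^sup>2)"
proof -
  interpret prob_space G by (rule gaussian_prob)
  have *: "has_bochner_integral G (\<lambda>w. exp (l * w i)) (exp (l\<^sup>2 * \<Gamma> i i / 2))"
    using normal_exp[OF gaussian_component_meas[OF assms(1)] _ gaussian_component_normal[OF assms(1)]] diag[OF assms(1)] by simp
  then show "integrable G (\<lambda>w. exp (l * w i))" by (simp add: has_bochner_integral_iff)
  have "l\<^sup>2 * \<Gamma> i i \<le> l\<^sup>2 * 2" using assms(2) by (intro mult_left_mono) auto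
  then show "(\<integral>w. exp (l * w i) \<partial>G) \<le> exp (l\<^sup>2)"
    using * by (simp add: has_bochner_integral_iff)
qed

text \<open>Variance at most 2 gives E exp |w| \<le> 2 e \<le> 6, and the cube costs another 3! = 6.
  The product 36 is used for both bounds so that the Gaussian vector and the projections share one
  constant.\<close>

lemma gaussian_subexp_vector:
  assumes ne: "I \<noteq> {}" and B: "B \<ge> 1" and var: "\<And>i. i \<in> I \<Longrightarrow> \<Gamma> i i \<le> 2"
  shows "subexp_vector G I (\<lambda>w. w) B 36"
proof -
  interpret prob_space G by (rule gaussian_prob)
  show ?thesis
  proof
    fix i assume i: "i \<in> I"
    note nd = gaussian_component_meas[OF i] _ gaussian_component_normal[OF i]
    show "(\<integral>w. w i \<partial>G) = 0" using normal_mean[OF nd] diag[OF i] by simp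
    have "exp (\<Gamma> i i / 2) \<le> exp 1" using var[OF i] by simp
    also have "\<dots> \<le> (3::real)" by (rule exp_le)
    finally have "2 * exp ((sqrt (\<Gamma> i i))\<^sup>2 / 2) \<le> 6" using diag[OF i] by simp
    moreover have "(\<integral>\<^sup>+w. ennreal (exp \<bar>w i\<bar>) \<partial>G) \<le> ennreal (2 * exp ((sqrt (\<Gamma> i i))\<^sup>2 / 2))"
      by (rule normal_exp_abs[OF nd]) (use diag[OF i] in simp)
    ultimately have e6: "(\<integral>\<^sup>+w. ennreal (exp \<bar>w i\<bar>) \<partial>G) \<le> ennreal 6"
      using ennreal_leI order_trans by blast
    have "(\<integral>\<^sup>+w. ennreal (exp (\<bar>w i\<bar> / B)) \<partial>G) \<le> (\<integral>\<^sup>+w. ennreal (exp \<bar>w i\<bar>) \<partial>G)"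
      using B by (intro nn_integral_mono ennreal_leI) (simp add: divide_le_eq mult_le_cancel_left1)
    also have "\<dots> \<le> ennreal 36" using e6 by (rule order_trans) (simp add: ennreal_leI)
    finally show "(\<integral>\<^sup>+w. ennreal (exp (\<bar>w i\<bar> / B)) \<partial>G) \<le> ennreal 36" .
    have "(\<integral>\<^sup>+w. ennreal (\<bar>w i\<bar> ^ 3) \<partial>G) \<le> (\<integral>\<^sup>+w. ennreal 6 * ennreal (exp \<bar>w i\<bar>) \<partial>G)"
    proof (intro nn_integral_mono)
      fix w :: "'i \<Rightarrow> real"
      have "\<bar>w i\<bar> ^ 3 \<le> 6 * exp \<bar>w i\<bar>" using power_div_fact_le_exp[of "\<bar>w i\<bar>" 3] by (simp add: fact_numeral)
      then show "ennreal (\<bar>w i\<bar> ^ 3) \<le> ennreal 6 * ennreal (exp \<bar>w i\<bar>)"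
        by (simp only: ennreal_mult[symmetric] exp_ge_zero zero_le_numeral) (rule ennreal_leI)
    qed
    also have "\<dots> = ennreal 6 * (\<integral>\<^sup>+w. ennreal (exp \<bar>w i\<bar>) \<partial>G)"
      by (intro nn_integral_cmult measurable_compose[OF _ measurable_ennreal] borel_measurable_exp[THEN measurable_compose[rotated]]
         borel_measurable_abs gaussian_component_meas i)
    also have "\<dots> \<le> ennreal 6 * ennreal 6" by (intro mult_left_mono e6) auto
    also have "\<dots> = ennreal 36" by (simp only: ennreal_mult[symmetric] zero_le_numeral) simp
    also have "\<dots> \<le> ennreal (36 * B)" using B by (intro ennreal_leI) simp
    finally show "(\<integral>\<^sup>+w. ennreal (\<bar>w i\<bar> ^ 3) \<partial>G) \<le> ennreal (36 * B)" .
  qed (use I ne B gaussian_component_meas in auto)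
qed

end

section \<open>Hajek projections and the main theorem\<close>

context sym_kernel begin

context
  assumes B1: "B \<ge> 1"
    and k2: "(\<integral>\<^sup>+z. ennreal (\<bar>k (fst z) (snd z)\<bar> ^ 2) \<partial>(F \<Otimes>\<^sub>M F)) \<le> 2"
    and k3: "(\<integral>\<^sup>+z. ennreal (\<bar>k (fst z) (snd z)\<bar> ^ 3) \<partial>(F \<Otimes>\<^sub>M F)) \<le> ennreal (2 * B)"
begin

lemma mean_moment: "q > 0 \<Longrightarrow> ennreal (\<bar>mean\<bar> ^ q) \<le> (\<integral>\<^sup>+z. ennreal (\<bar>k (fst z) (snd z)\<bar> ^ q) \<partial>(F \<Otimes>\<^sub>M F))"
  unfolding mean_def by (intro FF.P.nn_jensen_power) auto

lemma proj_moment: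
  assumes "q > 0"
  shows "(\<integral>\<^sup>+x. ennreal (\<bar>proj x\<bar> ^ q) \<partial>F) \<le> (\<integral>\<^sup>+z. ennreal (\<bar>k (fst z) (snd z)\<bar> ^ q) \<partial>(F \<Otimes>\<^sub>M F))"
proof -
  have "(\<integral>\<^sup>+x. ennreal (\<bar>proj x\<bar> ^ q) \<partial>F) \<le> (\<integral>\<^sup>+x. \<integral>\<^sup>+y. ennreal (\<bar>k x y\<bar> ^ q) \<partial>F \<partial>F)"
    unfolding proj_def using assms by (intro nn_integral_mono nn_jensen_power) auto
  also have "\<dots> = (\<integral>\<^sup>+z. ennreal (\<bar>k (fst z) (snd z)\<bar> ^ q) \<partial>(F \<Otimes>\<^sub>M F))"
    by (subst nn_integral_fst[symmetric]) auto
  finally show ?thesis .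
qed

text \<open>The second moment bounds the mean by 2, so centring costs at most exp 2 \<le> 9 since B
  \<ge> 1; Jensen's inequality handles the projection. The bound 2 on the exponential moment is
  relaxed to 4 to reach the common constant 36.\<close>

lemma centred_proj_exp: "(\<integral>\<^sup>+x. ennreal (exp (\<bar>proj x - mean\<bar> / B)) \<partial>F) \<le> ennreal 36"
proof -
  have "ennreal (\<bar>mean\<bar> ^ 2) \<le> ennreal 2" using order_trans[OF mean_moment[of 2] k2] by simp
  then have "\<bar>mean\<bar> ^ 2 \<le> 2 ^ 2" by (subst (asm) ennreal_le_iff) auto
  then have "\<bar>mean\<bar> \<le> 2" by (rule power2_le_imp_le) simp
  then have m2: "\<bar>mean\<bar> / B \<le> 2" using B1 by (simp add: pos_divide_le_eq)
  have e2: "exp (2::real) \<le> 9"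
  proof -
    have "exp (2::real) = exp 1 * exp 1" by (simp flip: exp_add)
    also have "\<dots> \<le> 3 * 3" by (intro mult_mono exp_le) auto
    finally show ?thesis by simp
  qed
  have "(\<integral>\<^sup>+x. ennreal (exp (\<bar>proj x - mean\<bar> / B)) \<partial>F) \<le> (\<integral>\<^sup>+x. ennreal 9 * ennreal (exp (\<bar>proj x\<bar> / B)) \<partial>F)"
  proof (intro nn_integral_mono)
    fix x
    have "\<bar>proj x - mean\<bar> / B \<le> (\<bar>proj x\<bar> + \<bar>mean\<bar>) / B" using B1 by (intro divide_right_mono) auto
    also have "\<dots> \<le> 2 + \<bar>proj x\<bar> / B" using m2 by (simp add: add_divide_distrib)
    finally have "exp (\<bar>proj x - mean\<bar> / B) \<le> exp 2 * exp (\<bar>proj x\<bar> / B)" unfolding exp_add[symmetric] by simp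
    also have "\<dots> \<le> 9 * exp (\<bar>proj x\<bar> / B)" using e2 by (intro mult_right_mono) auto
    finally show "ennreal (exp (\<bar>proj x - mean\<bar> / B)) \<le> ennreal 9 * ennreal (exp (\<bar>proj x\<bar> / B))"
      by (simp only: ennreal_mult[symmetric] exp_ge_zero zero_le_numeral) (rule ennreal_leI)
  qed
  also have "\<dots> = ennreal 9 * (\<integral>\<^sup>+x. ennreal (exp (\<bar>proj x\<bar> / B)) \<partial>F)" by (rule nn_integral_cmult) measurable
  also have "(\<integral>\<^sup>+x. ennreal (exp (\<bar>proj x\<bar> / B)) \<partial>F) \<le> (\<integral>\<^sup>+x. \<integral>\<^sup>+y. ennreal (exp (\<bar>k x y\<bar> / B)) \<partial>F \<partial>F)"
    unfolding proj_def using B_pos by (intro nn_integral_mono nn_jensen_exp) auto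
  also have "\<dots> = (\<integral>\<^sup>+z. ennreal (exp (\<bar>k (fst z) (snd z)\<bar> / B)) \<partial>(F \<Otimes>\<^sub>M F))"
    by (subst nn_integral_fst[symmetric]) auto
  also have "ennreal 9 * \<dots> \<le> ennreal 9 * ennreal 4" using k_exp by (intro mult_left_mono) (auto elim!: order_trans)
  also have "\<dots> = ennreal 36" by (simp only: ennreal_mult[symmetric] zero_le_numeral) simp
  finally show ?thesis by (simp add: mult_left_mono)
qed

text \<open>Centring costs 2^3 on two terms of size 2B, in all 32B. The bound must be linear in
  \<open>B\<close>, which the exponential moment alone does not give.\<close>

lemma centred_proj_cube: "(\<integral>\<^sup>+x. ennreal (\<bar>proj x - mean\<bar> ^ 3) \<partial>F) \<le> ennreal (36 * B)"
proof -
  have "(\<integral>\<^sup>+x. ennreal (\<bar>proj x - mean\<bar> ^ 3) \<partial>F) \<le> (\<integral>\<^sup>+x. ennreal 8 * (ennreal (\<bar>proj x\<bar> ^ 3) + ennreal (\<bar>mean\<bar> ^ 3)) \<partial>F)"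
  proof (intro nn_integral_mono)
    fix x
    let ?M = "max \<bar>proj x\<bar> \<bar>mean\<bar>"
    have "\<bar>proj x - mean\<bar> ^ 3 \<le> (2 * ?M) ^ 3" by (intro power_mono) auto
    also have "\<dots> = 8 * ?M ^ 3" by (simp add: power_mult_distrib)
    also have "?M ^ 3 \<le> \<bar>proj x\<bar> ^ 3 + \<bar>mean\<bar> ^ 3" by (auto simp: max_def)
    finally have "\<bar>proj x - mean\<bar> ^ 3 \<le> 8 * (\<bar>proj x\<bar> ^ 3 + \<bar>mean\<bar> ^ 3)" by simp
    from ennreal_leI[OF this] show "ennreal (\<bar>proj x - mean\<bar> ^ 3) \<le> ennreal 8 * (ennreal (\<bar>proj x\<bar> ^ 3) + ennreal (\<bar>mean\<bar> ^ 3))"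
      by (simp add: ennreal_mult ennreal_plus del: ennreal_power)
  qed
  also have "\<dots> = ennreal 8 * ((\<integral>\<^sup>+x. ennreal (\<bar>proj x\<bar> ^ 3) \<partial>F) + ennreal (\<bar>mean\<bar> ^ 3))"
    by (simp add: nn_integral_cmult nn_integral_add emeasure_space_1)
  also have "\<dots> \<le> ennreal 8 * (ennreal (2 * B) + ennreal (2 * B))"
    using k3 by (intro mult_left_mono add_mono order_trans[OF proj_moment] order_trans[OF mean_moment]) auto
  also have "\<dots> = ennreal (8 * (2 * B + 2 * B))"
  proof -
    have "ennreal (8 * (2 * B + 2 * B)) = ennreal 8 * ennreal (2 * B + 2 * B)"
      by (rule ennreal_mult) (use B1 in auto)
    also have "ennreal (2 * B + 2 * B) = ennreal (2 * B) + ennreal (2 * B)"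
      by (rule ennreal_plus) (use B1 in auto)
    finally show ?thesis ..
  qed
  also have "\<dots> \<le> ennreal (36 * B)" using B1 by (intro ennreal_leI) simp
  finally show ?thesis .
qed

lemma proj_square_integrable: "integrable F (\<lambda>x. (proj x)\<^sup>2)"
  and proj_square_le: "(\<integral>x. (proj x)\<^sup>2 \<partial>F) \<le> 2"
proof -
  have le: "(\<integral>\<^sup>+x. ennreal ((proj x)\<^sup>2) \<partial>F) \<le> ennreal 2"
    using order_trans[OF proj_moment[of 2] k2] by simp
  show i: "integrable F (\<lambda>x. (proj x)\<^sup>2)"
    using le_less_trans[OF le] by (intro integrableI_nonneg) auto
  have "ennreal (\<integral>x. (proj x)\<^sup>2 \<partial>F) \<le> ennreal 2"
    using le i by (subst (asm) nn_integral_eq_integral) auto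
  then show "(\<integral>x. (proj x)\<^sup>2 \<partial>F) \<le> 2" by (subst (asm) ennreal_le_iff) auto
qed

lemma centred_proj_square:
  shows "integrable F (\<lambda>x. (proj x - mean)\<^sup>2)" and "(\<integral>x. (proj x - mean)\<^sup>2 \<partial>F) \<le> 2"
proof -
  have eq: "(proj x - mean)\<^sup>2 = (proj x)\<^sup>2 - 2 * mean * proj x + mean\<^sup>2" for x
    by (simp add: power2_diff mult_ac)
  show "integrable F (\<lambda>x. (proj x - mean)\<^sup>2)"
    unfolding eq using proj_square_integrable proj_integrable by simp
  have "(\<integral>x. (proj x - mean)\<^sup>2 \<partial>F) = (\<integral>x. (proj x)\<^sup>2 \<partial>F) - mean\<^sup>2"
    unfolding eq using proj_square_integrable proj_integrable by (simp add: proj_mean prob_space power2_eq_square)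
  then show "(\<integral>x. (proj x - mean)\<^sup>2 \<partial>F) \<le> 2" using proj_square_le zero_le_power2[of mean] by linarith
qed

end

lemma centred_proj_mean: "(\<integral>x. (proj x - mean) \<partial>F) = 0"
  using proj_integrable by (simp add: proj_mean prob_space)

end

section \<open>Reduction to the lower-triangular index set, and the final estimate\<close>

lemma Max_pairs_le_iff:
  fixes f :: "nat \<Rightarrow> nat \<Rightarrow> real"
  assumes "p > 0"
  shows "Max {f m k | m k. m < p \<and> k < p} \<le> t \<longleftrightarrow> (\<forall>m<p. \<forall>k<p. f m k \<le> t)"
proof -
  have e: "{f m k | m k. m < p \<and> k < p} = (\<lambda>(m, k). f m k) ` ({..<p} \<times> {..<p})" by auto
  show ?thesis unfolding e using assms by (subst Max_le_iff) auto
qed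

lemma finite_vI: "finite (vI p)" and card_vI_le: "card (vI p) \<le> p\<^sup>2"
proof -
  have s: "vI p \<subseteq> {..<p} \<times> {..<p}" by (auto simp: vI_def)
  then show "finite (vI p)" by (rule finite_subset) auto
  from card_mono[OF _ s] show "card (vI p) \<le> p\<^sup>2" by (simp add: power2_eq_square)
qed

text \<open>The maximum over all pairs sees each off-diagonal entry twice; the comparison is run on
  the index set of the Gaussian vector, which has one copy of each.\<close>

lemma sym_pairs_vI:
  fixes f :: "nat \<Rightarrow> nat \<Rightarrow> real"
  assumes "\<And>m k. m < p \<Longrightarrow> k < p \<Longrightarrow> f m k = f k m"
  shows "(\<forall>m<p. \<forall>k<p. f m k \<le> t) \<longleftrightarrow> (\<forall>a\<in>vI p. f (fst a) (snd a) \<le> t)"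
proof
  assume r: "\<forall>a\<in>vI p. f (fst a) (snd a) \<le> t"
  show "\<forall>m<p. \<forall>k<p. f m k \<le> t"
  proof (intro allI impI)
    fix m k assume mk: "m < p" "k < p"
    show "f m k \<le> t"
    proof (cases "k \<le> m")
      case True then show ?thesis using r mk by (force simp: vI_def)
    next
      case False
      then have "f k m \<le> t" using r mk by (force simp: vI_def)
      then show ?thesis using assms[OF mk] by simp
    qed
  qed
qed (auto simp: vI_def)

theorem theorem2p1:
  shows "\<forall>C1 C2 :: real. C1 > 0 \<and> C2 > 0 \<longrightarrow>
    (\<exists>C > 0. \<forall>(K::real) (p::nat) (n::nat) (F :: (nat \<Rightarrow> real) measure)
        (h :: (nat \<Rightarrow> real) \<Rightarrow> (nat \<Rightarrow> real) \<Rightarrow> nat \<Rightarrow> nat \<Rightarrow> real) (B::real)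
        (G :: (nat \<times> nat \<Rightarrow> real) measure).
      0 < K \<and> K < 1 \<and> p \<ge> 3 \<and> n \<ge> 2 \<and> B \<ge> 1
      \<and> prob_space F \<and> sets F = sets (Rp p)
      \<and> (\<forall>m<p. \<forall>k<p. (\<lambda>z. h (fst z) (snd z) m k) \<in> borel_measurable (pair_measure (Rp p) (Rp p)))
      \<and> (\<forall>x\<in>space (Rp p). \<forall>y\<in>space (Rp p). \<forall>m<p. \<forall>k<p. h x y m k = h y x m k)
      \<and> (\<forall>x\<in>space (Rp p). \<forall>y\<in>space (Rp p). \<forall>m<p. \<forall>k<p. h x y m k = h x y k m)
      \<and> integrable (pair_measure F F) (\<lambda>z. maxnorm p (h (fst z) (snd z)))
      \<and> (\<forall>m<p. \<forall>k<p. integral\<^sup>L F (\<lambda>x. (gfun F h x m k - integral\<^sup>L F (\<lambda>x'. gfun F h x' m k))\<^sup>2) > 0)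
      \<and> (\<forall>m<p. \<forall>k<p.
           nn_integral F (\<lambda>x. ennreal ((gfun F h x m k)\<^sup>2)) \<ge> ennreal C1
         \<and> (\<forall>l\<in>{0,1,2::nat}. nn_integral (pair_measure F F)
               (\<lambda>z. ennreal (\<bar>h (fst z) (snd z) m k\<bar> ^ (2 + l) / B ^ l)) \<le> 2)
         \<and> nn_integral (pair_measure F F) (\<lambda>z. ennreal (exp (\<bar>h (fst z) (snd z) m k\<bar> / B))) \<le> 2)
      \<and> B\<^sup>2 * (ln (real p * real n)) ^ 7 / real n \<le> C2 * real n powr (- K)
      \<and> centered_gaussian (vI p) (Gamma_g F h) G
      \<longrightarrow> kol_dist (sample n F) (Tbar0 p n F h) (sample n G) (Zbar0 p n)
            \<le> C * real n powr (- K / 8))"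
proof (intro allI impI, goal_cases)
  case (1 C1 C2)
  then have C1: "C1 > 0" and C2: "C2 > 0" by auto
  \<comment> \<open>The first part is the constant of \<open>max_comparison_rate\<close> at K = 36.
    The added 26 absorbs the exceptional event, of probability at most u, and makes the bound
    trivial when u > 1 / 25.\<close>
  define A where "A = 340 * 36 + 12 / C1 * (20 + 1887 * 36) + 26"
  have A26: "A \<ge> 26" using C1 by (simp add: A_def)
  \<comment> \<open>\<open>A\<close> involves only \<open>C1\<close>, so this witness depends only
    on \<open>C1\<close> and \<open>C2\<close>; it does not involve \<open>K\<close>.\<close>
  show ?case
  proof (intro exI[of _ "A * C2 powr (1 / 8)"] conjI allI impI, goal_cases)
    case 1 show ?case using A26 C2 by simp
  next
    case (2 K p n F h B G)
    then have p: "p \<ge> 3" and n: "n \<ge> 2" and B1: "B \<ge> 1" and F: "prob_space F" and sF: "sets F = sets (Rp p)"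
      and hm: "\<And>m k. m < p \<Longrightarrow> k < p \<Longrightarrow> (\<lambda>z. h (fst z) (snd z) m k) \<in> borel_measurable (Rp p \<Otimes>\<^sub>M Rp p)"
      and hs: "\<And>x y m k. x \<in> space (Rp p) \<Longrightarrow> y \<in> space (Rp p) \<Longrightarrow> m < p \<Longrightarrow> k < p \<Longrightarrow> h x y m k = h y x m k"
      and ht: "\<And>x y m k. x \<in> space (Rp p) \<Longrightarrow> y \<in> space (Rp p) \<Longrightarrow> m < p \<Longrightarrow> k < p \<Longrightarrow> h x y m k = h x y k m"
      and gv: "\<And>m k. m < p \<Longrightarrow> k < p \<Longrightarrow> ennreal C1 \<le> (\<integral>\<^sup>+x. ennreal ((gfun F h x m k)\<^sup>2) \<partial>F)"
      and hl: "\<And>m k l. m < p \<Longrightarrow> k < p \<Longrightarrow> l \<in> {0,1,2::nat} \<Longrightarrow>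
           (\<integral>\<^sup>+z. ennreal (\<bar>h (fst z) (snd z) m k\<bar> ^ (2 + l) / B ^ l) \<partial>(F \<Otimes>\<^sub>M F)) \<le> 2"
      and he: "\<And>m k. m < p \<Longrightarrow> k < p \<Longrightarrow> (\<integral>\<^sup>+z. ennreal (exp (\<bar>h (fst z) (snd z) m k\<bar> / B)) \<partial>(F \<Otimes>\<^sub>M F)) \<le> 2"
      and rate: "B\<^sup>2 * (ln (real p * real n)) ^ 7 / real n \<le> C2 * real n powr (- K)"
      and G: "centered_gaussian (vI p) (Gamma_g F h) G"
      by (auto simp del: power_Suc)
    interpret F: prob_space F by (rule F)
    have G': "prob_space G" using G by (simp add: centered_gaussian_def)
    interpret SF: prob_space "sample n F" unfolding sample_def by (intro prob_space_PiM F)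
    interpret SG: prob_space "sample n G" unfolding sample_def by (intro prob_space_PiM G')
    have spF: "space F = space (Rp p)" by (rule sets_eq_imp_space_eq[OF sF])
    let ?L = "ln (real p * real n)"
    define x where "x = sqrt ?L"
    \<comment> \<open>(GA.2) bounds the eighth power of u by C2 n^(-K), so an error of order u is
      the claimed rate. Its fourth power is x^7 B / sqrt n, the form in which the rate lemma uses
      it.\<close>
    define u where "u = (B\<^sup>2 * ?L ^ 7 / real n) powr (1 / 8)"
    have pn: "6 \<le> real p * real n" using mult_mono[of 3 "real p" 2 "real n"] p n by simp
    have L1: "1 \<le> ?L"
    proof -
      have "exp 1 \<le> real p * real n" using exp_le pn by linarith
      then show ?thesis using pn by (subst ln_ge_iff) auto
    qed
    have x: "x \<ge> 1" "x\<^sup>2 = ?L" using L1 by (auto simp: x_def)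
    have r0: "B\<^sup>2 * ?L ^ 7 / real n > 0" using B1 L1 n by simp
    have u0: "u > 0" unfolding u_def powr_gt_zero using less_imp_neq[OF r0] by (rule not_sym)
    have u8: "u ^ 8 = B\<^sup>2 * ?L ^ 7 / real n"
    proof -
      have "u ^ 8 = u powr (real 8)" by (rule powr_realpow[OF u0, symmetric])
      also have "\<dots> = (B\<^sup>2 * ?L ^ 7 / real n) powr 1" unfolding u_def powr_powr by simp
      also have "\<dots> = B\<^sup>2 * ?L ^ 7 / real n" by (rule powr_one[OF less_imp_le[OF r0]])
      finally show ?thesis .
    qed
    have Bu: "B / sqrt n = u ^ 4 / x ^ 7"
    proof -
      have "(B / sqrt n * x ^ 7)\<^sup>2 = B\<^sup>2 * (x\<^sup>2) ^ 7 / n"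
        using n by (simp add: power_mult_distrib power_divide flip: power_mult)
      also have "\<dots> = (u ^ 4)\<^sup>2" unfolding x(2) u8[symmetric] by (simp flip: power_mult)
      finally have "B / sqrt n * x ^ 7 = u ^ 4"
        by (rule power2_eq_imp_eq) (use B1 x(1) u0 in auto)
      then show ?thesis using x(1) by (simp add: field_simps)
    qed
    \<comment> \<open>Because B and the logarithm are at least 1. This lets an exceptional
      probability of order 1 / n be charged to u.\<close>
    have un: "1 / n \<le> u ^ 8"
    proof -
      have "1 * 1 \<le> B\<^sup>2 * ?L ^ 7" by (intro mult_mono one_le_power B1 L1) auto
      then show ?thesis unfolding u8 by (intro divide_right_mono) auto
    qed
    have final: "A * u \<le> A * C2 powr (1 / 8) * real n powr (- K / 8)"
    proof -
      have "u \<le> (C2 * real n powr (- K)) powr (1 / 8)"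
        unfolding u_def using rate r0 by (intro powr_mono2) auto
      also have "\<dots> = C2 powr (1 / 8) * real n powr (- K / 8)"
        using C2 by (simp add: powr_mult powr_powr)
      finally show ?thesis using A26 by (simp add: mult.assoc)
    qed
    have ker: "sym_kernel F (\<lambda>x y. h x y m k) B" if "m < p" "k < p" for m k
    proof
      have "sets (F \<Otimes>\<^sub>M F) = sets (Rp p \<Otimes>\<^sub>M Rp p)" by (intro sets_pair_measure_cong sF)
      then show "(\<lambda>(x, y). h x y m k) \<in> borel_measurable (F \<Otimes>\<^sub>M F)"
        using hm[OF that] by (simp add: case_prod_beta' cong: measurable_cong_sets)
    qed (use B1 hs he that in \<open>auto simp: spF\<close>)
    have Eh_eq: "sym_kernel.mean F (\<lambda>x y. h x y m k) = Eh F h m k" if "m < p" "k < p" for m k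
      using sym_kernel.mean_def[OF ker[OF that]] by (simp add: Eh_def)
    have g_eq: "gfun F h x m k = sym_kernel.proj F (\<lambda>x y. h x y m k) x - sym_kernel.mean F (\<lambda>x y. h x y m k)"
      if "m < p" "k < p" for m k x
      using sym_kernel.proj_def[OF ker[OF that]] Eh_eq[OF that] by (simp add: gfun_def)
    have h2: "(\<integral>\<^sup>+z. ennreal (\<bar>h (fst z) (snd z) m k\<bar> ^ 2) \<partial>(F \<Otimes>\<^sub>M F)) \<le> 2" if "m < p" "k < p" for m k
      using hl[OF that, of 0] by simp
    have h3: "(\<integral>\<^sup>+z. ennreal (\<bar>h (fst z) (snd z) m k\<bar> ^ 3) \<partial>(F \<Otimes>\<^sub>M F)) \<le> ennreal (2 * B)" if "m < p" "k < p" for m k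
    proof -
      interpret k: sym_kernel F "\<lambda>x y. h x y m k" B by (rule ker[OF that])
      have "(\<integral>\<^sup>+z. ennreal (\<bar>h (fst z) (snd z) m k\<bar> ^ 3) \<partial>(F \<Otimes>\<^sub>M F)) =
        (\<integral>\<^sup>+z. ennreal B * ennreal (\<bar>h (fst z) (snd z) m k\<bar> ^ 3 / B) \<partial>(F \<Otimes>\<^sub>M F))"
        using B1 by (simp add: ennreal_mult[symmetric] del: ennreal_power)
      also have "\<dots> = ennreal B * (\<integral>\<^sup>+z. ennreal (\<bar>h (fst z) (snd z) m k\<bar> ^ 3 / B) \<partial>(F \<Otimes>\<^sub>M F))"
        by (rule nn_integral_cmult) measurable
      also have "\<dots> \<le> ennreal B * 2" using hl[OF that, of 1] by (intro mult_left_mono) (auto simp: eval_nat_numeral)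
      also have "\<dots> = ennreal (2 * B)" using B1 by (simp add: ennreal_mult mult.commute)
      finally show ?thesis .
    qed
    let ?J = "vI p"
    have Jp: "fst a < p" "snd a < p" if "a \<in> ?J" for a using that by (auto simp: vI_def)
    have J_ne: "?J \<noteq> {}" using p by (auto simp: vI_def intro!: exI[of _ 0])
    let ?Y = "\<lambda>x a. gfun F h x (fst a) (snd a)"
    have SY: "subexp_vector F ?J ?Y B 36"
    proof
      fix a assume a: "a \<in> ?J"
      note ap = Jp[OF a]
      interpret k: sym_kernel F "\<lambda>x y. h x y (fst a) (snd a)" B by (rule ker[OF ap])
      note mom = B1 h2[OF ap] h3[OF ap]
      show "(\<lambda>x. ?Y x a) \<in> borel_measurable F" unfolding g_eq[OF ap] by measurable
      show "(\<integral>x. ?Y x a \<partial>F) = 0" unfolding g_eq[OF ap] by (rule k.centred_proj_mean)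
      show "(\<integral>\<^sup>+x. ennreal (exp (\<bar>?Y x a\<bar> / B)) \<partial>F) \<le> ennreal 36"
        unfolding g_eq[OF ap] by (rule k.centred_proj_exp[OF mom])
      show "(\<integral>\<^sup>+x. ennreal (\<bar>?Y x a\<bar> ^ 3) \<partial>F) \<le> ennreal (36 * B)"
        unfolding g_eq[OF ap] by (rule k.centred_proj_cube[OF mom])
    qed (use B1 finite_vI J_ne in auto)
    interpret SY: subexp_vector F ?J ?Y B 36 by (rule SY)
    have Gam: "Gamma_g F h a b = (\<integral>x. ?Y x a * ?Y x b \<partial>F)" if "a \<in> ?J" "b \<in> ?J" for a b
      unfolding Gamma_g_def using SY.Y_mean that by simp
    have Gam_diag: "C1 \<le> Gamma_g F h a a" "Gamma_g F h a a \<le> 2" if a: "a \<in> ?J" for a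
    proof -
      note ap = Jp[OF a]
      interpret k: sym_kernel F "\<lambda>x y. h x y (fst a) (snd a)" B by (rule ker[OF ap])
      note mom = B1 h2[OF ap] h3[OF ap]
      have e: "Gamma_g F h a a = (\<integral>x. (?Y x a)\<^sup>2 \<partial>F)" unfolding Gam[OF a a] by (simp add: power2_eq_square)
      show "Gamma_g F h a a \<le> 2" unfolding e g_eq[OF ap] by (rule k.centred_proj_square[OF mom])
      have "integrable F (\<lambda>x. (?Y x a)\<^sup>2)" unfolding g_eq[OF ap] by (rule k.centred_proj_square[OF mom])
      then have "ennreal C1 \<le> ennreal (\<integral>x. (?Y x a)\<^sup>2 \<partial>F)"
        using gv[OF ap] by (subst (asm) nn_integral_eq_integral) auto
      then show "C1 \<le> Gamma_g F h a a" unfolding e by (subst (asm) ennreal_le_iff) auto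
    qed
    have Gsym: "Gamma_g F h a b = Gamma_g F h b a" if "a \<in> ?J" "b \<in> ?J" for a b
      using that by (simp add: Gam mult.commute)
    have Gpos: "Gamma_g F h a a > 0" if "a \<in> ?J" for a using Gam_diag(1)[OF that] C1 by linarith
    note gauss = G finite_vI Gsym Gpos
    have SW: "subexp_vector G ?J (\<lambda>w. w) B 36"
      by (rule gaussian_subexp_vector[OF gauss J_ne B1 Gam_diag(2)])
    have Gcov: "(\<integral>w. w a * w b \<partial>G) = Gamma_g F h a b" if "a \<in> ?J" "b \<in> ?J" for a b
      by (rule gaussian_covariance[OF gauss that])
    have Gmgf_int: "integrable G (\<lambda>w. exp (l * w a))" if "a \<in> ?J" for a and l :: real
      by (rule gaussian_mgf(1)[OF gauss that Gam_diag(2)[OF that]])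
    have Gmgf_le: "(\<integral>w. exp (l * w a) \<partial>G) \<le> exp (l\<^sup>2)" if "a \<in> ?J" for a and l :: real
      by (rule gaussian_mgf(2)[OF gauss that Gam_diag(2)[OF that]])
    let ?T = "\<lambda>\<omega> a. sqrt n * (Ustat n h \<omega> (fst a) (snd a) - integral\<^sup>L (sample n F) (\<lambda>\<omega>'. Ustat n h \<omega>' (fst a) (snd a))) / 2"
    have spS: "\<omega> i \<in> space (Rp p)" if "\<omega> \<in> space (sample n F)" "i < n" for \<omega> i
      using that spF by (auto simp: sample_def space_PiM)
    have Usym: "Ustat n h \<omega> m k = Ustat n h \<omega> k m" if "\<omega> \<in> space (sample n F)" "m < p" "k < p" for \<omega> m k
      unfolding Ustat_def using that ht spS by (intro arg_cong2[where f = "(/)"] sum.cong refl) auto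
    have Tset: "Tbar0 p n F h \<omega> \<le> t \<longleftrightarrow> (\<forall>a\<in>?J. ?T \<omega> a \<le> t)" if \<omega>: "\<omega> \<in> space (sample n F)" for \<omega> t
    proof -
      have "(\<integral>\<omega>'. Ustat n h \<omega>' m k \<partial>sample n F) = (\<integral>\<omega>'. Ustat n h \<omega>' k m \<partial>sample n F)" if "m < p" "k < p" for m k
        using Usym that by (intro Bochner_Integration.integral_cong) auto
      then show ?thesis
        unfolding Tbar0_def using p Usym[OF \<omega>] by (subst Max_pairs_le_iff, simp, subst sym_pairs_vI) auto
    qed
    have Zset: "Zbar0 p n \<zeta> \<le> t \<longleftrightarrow> (\<forall>a\<in>?J. (\<Sum>i<n. \<zeta> i a / sqrt n) \<le> t)" for \<zeta> t
    proof -
      \<comment> \<open>The index (max, min) is symmetric in the pair, and on \<open>vI p\<close> it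
        is the pair itself.\<close>
      have "Zbar0 p n \<zeta> \<le> t \<longleftrightarrow> (\<forall>a\<in>?J. (\<Sum>i<n. \<zeta> i (max (fst a) (snd a), min (fst a) (snd a))) / sqrt n \<le> t)"
        unfolding Zbar0_def using p by (subst Max_pairs_le_iff, simp, subst sym_pairs_vI) (auto simp: max.commute min.commute)
      also have "\<dots> \<longleftrightarrow> (\<forall>a\<in>?J. (\<Sum>i<n. \<zeta> i a / sqrt n) \<le> t)"
        by (intro ball_cong refl) (auto simp: vI_def sum_divide_distrib max_def min_def)
      finally show ?thesis .
    qed
    have bound: "\<bar>measure (sample n F) {\<omega> \<in> space (sample n F). Tbar0 p n F h \<omega> \<le> t} -
       measure (sample n G) {\<zeta> \<in> space (sample n G). Zbar0 p n \<zeta> \<le> t}\<bar> \<le> A * u" for t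
    proof (cases "u \<le> 1 / 25")
      case False
      have "\<bar>measure (sample n F) {\<omega> \<in> space (sample n F). Tbar0 p n F h \<omega> \<le> t} -
       measure (sample n G) {\<zeta> \<in> space (sample n G). Zbar0 p n \<zeta> \<le> t}\<bar> \<le> 1"
        using SF.prob_le_1 SG.prob_le_1 measure_nonneg by (smt (verit))
      also have "1 \<le> A * u" using False A26 mult_mono[of 26 A "1 / 25" u] by linarith
      finally show ?thesis .
    next
      case True
      define E where "E a = {\<omega> \<in> space (sample n F). u / x < \<bar>?T \<omega> a - (\<Sum>i<n. ?Y (\<omega> i) a / sqrt n)\<bar>}" for a
      \<comment> \<open>A moment order near ln (p n) turns the geometric decay in Markov's bound
        into a power of p n. The power 6 obtained below leaves 1 / n after a union over at most p^2
        entries.\<close>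
      define m where "m = nat \<lceil>x\<^sup>2\<rceil>"
      have x2: "1 \<le> x\<^sup>2" using x(1) by simp
      have m: "m \<ge> 1" "x\<^sup>2 \<le> m" "m \<le> 2 * x\<^sup>2" unfolding m_def using x2 by linarith+
      have u3: "u ^ 3 \<le> 1 / 15625" using power_mono[OF True, of 3] u0 by (simp add: power_divide)
      have T_mean: "(\<integral>\<omega>'. Ustat n h \<omega>' i j \<partial>sample n F) = sym_kernel.mean F (\<lambda>x y. h x y i j)" if "i < p" "j < p" for i j
        unfolding Ustat_def sample_def using sym_kernel.ustat_mean[OF ker[OF that] n] .
      have E: "E a \<in> sets (sample n F)" "measure (sample n F) (E a) \<le> 8 / (real p * real n) ^ 6" if a: "a \<in> ?J" for a
      proof -
        note ap = Jp[OF a]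
        have D: "u / x > 0" using u0 x(1) by simp
        have e: "E a = {\<omega> \<in> space (iid {..<n} F). u / x < \<bar>sqrt n * ((\<Sum>i<n. \<Sum>j\<in>{i<..<n}. h (\<omega> i) (\<omega> j) (fst a) (snd a)) / real (n choose 2)
            - sym_kernel.mean F (\<lambda>x y. h x y (fst a) (snd a))) / 2
          - (\<Sum>i<n. (sym_kernel.proj F (\<lambda>x y. h x y (fst a) (snd a)) (\<omega> i) - sym_kernel.mean F (\<lambda>x y. h x y (fst a) (snd a))) / sqrt n)\<bar>}"
          unfolding E_def T_mean[OF ap] g_eq[OF ap] unfolding Ustat_def sample_def ..
        show "E a \<in> sets (sample n F)"
          unfolding e sample_def by (rule sym_kernel.ustat_remainder_prob(1)[OF ker[OF ap] n m(1) D])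
        have "measure (sample n F) (E a) \<le> 8 * (64 * (real m)\<^sup>2 * (B / sqrt n) / (u / x)) ^ (2 * m)"
          unfolding e sample_def by (rule sym_kernel.ustat_remainder_prob(2)[OF ker[OF ap] n m(1) D])
        \<comment> \<open>With m \<le> 2 x^2 and the threshold u / x the base is at most 256 u^3 /
          x^2; u \<le> 1 / 25 brings it below 1 / 27, and e^3 \<le> 27.\<close>
        also have "\<dots> \<le> 8 * (exp (- 3)) ^ (2 * m)"
        proof (intro mult_left_mono power_mono)
          have "64 * (real m)\<^sup>2 * (B / sqrt n) / (u / x) \<le> 64 * (2 * x\<^sup>2)\<^sup>2 * (u ^ 4 / x ^ 7) / (u / x)"
            unfolding Bu using m u0 x(1) by (intro divide_right_mono mult_right_mono mult_left_mono power_mono) auto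
          also have "\<dots> = 256 * (u ^ 3 / x\<^sup>2)" using u0 x(1) by (simp add: field_simps eval_nat_numeral)
          also have "\<dots> \<le> 256 * (u ^ 3 / 1)" using x2 u0 by (intro mult_left_mono divide_left_mono) auto
          also have "\<dots> \<le> 1 / 27" using u3 by simp
          also have "\<dots> \<le> exp (- 3)"
          proof -
            have "exp (3::real) = exp 1 ^ 3" by (simp flip: exp_of_nat_mult)
            also have "\<dots> \<le> 3 ^ 3" by (intro power_mono exp_le) simp
            finally show ?thesis by (simp add: exp_minus divide_simps)
          qed
          finally show "64 * (real m)\<^sup>2 * (B / sqrt n) / (u / x) \<le> exp (- 3)" .
        qed (use B1 u0 x(1) in auto)
        also have "(exp (- 3 :: real)) ^ (2 * m) = exp (- (6 * real m))" by (simp flip: exp_of_nat_mult)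
        also have "\<dots> \<le> exp (- (6 * x\<^sup>2))" using m by simp
        also have "exp (- (6 * x\<^sup>2)) = 1 / (real p * real n) ^ 6"
        proof -
          have "exp (6 * x\<^sup>2) = exp ?L ^ 6" unfolding x(2) by (simp flip: exp_of_nat_mult)
          also have "exp ?L = real p * real n" using pn by simp
          finally show ?thesis by (simp add: exp_minus inverse_eq_divide)
        qed
        finally show "measure (sample n F) (E a) \<le> 8 / (real p * real n) ^ 6" by simp
      qed
      define R where "R = (\<Union>a\<in>?J. E a)"
      have R: "R \<in> sets (sample n F)" unfolding R_def using E finite_vI by (intro sets.finite_UN) auto
      have "measure (sample n F) R \<le> (\<Sum>a\<in>?J. measure (sample n F) (E a))"
        unfolding R_def using E finite_vI by (intro measure_UNION_le) auto
      also have "\<dots> \<le> (\<Sum>a\<in>?J. 8 / (real p * real n) ^ 6)" by (intro sum_mono E)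
      also have "\<dots> = card ?J * (8 / (real p * real n) ^ 6)" by simp
      also have "\<dots> \<le> (real p)\<^sup>2 * (8 / (real p * real n) ^ 6)"
        using card_vI_le[of p] by (intro mult_right_mono) (auto simp: of_nat_power[symmetric] simp del: of_nat_power)
      also have "\<dots> \<le> 1 / n"
      proof -
        have "8 * real n \<le> (real p) ^ 4 * real n ^ 6"
        proof (intro mult_mono)
          show "8 \<le> (real p) ^ 4" using p power_mono[of 3 "real p" 4] by simp
          show "real n \<le> real n ^ 6" using n by (intro self_le_power) auto
        qed auto
        then show ?thesis using p n by (simp add: field_simps power_mult_distrib eval_nat_numeral)
      qed
      also have "\<dots> \<le> u ^ 8" by (rule un)
      also have "\<dots> \<le> u ^ 1" using u0 True by (intro power_decreasing) auto
      finally have mR: "measure (sample n F) R \<le> u" by simp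
      have main: "\<bar>measure (iid {..<n} F) {\<omega>\<in>space (iid {..<n} F). \<forall>a\<in>?J. ?T \<omega> a \<le> t}
          - measure (iid {..<n} G) {\<omega>\<in>space (iid {..<n} G). \<forall>a\<in>?J. (\<Sum>i<n. \<omega> i a / sqrt n) \<le> t}\<bar>
        \<le> (340 * 36 + 12 / C1 * (20 + 1887 * 36)) * u + measure (iid {..<n} F) R"
      proof (rule max_comparison_rate[OF SY SW _ C1 _ _ _ n _ card_vI_le x u0 _ Bu])
        fix a b assume a: "a \<in> ?J" and b: "b \<in> ?J"
        show "(\<integral>x. ?Y x a * ?Y x b \<partial>F) = (\<integral>w. w a * w b \<partial>G)"
          by (rule trans[OF Gam[OF a b, symmetric] Gcov[OF a b, symmetric]])
      next
        fix a assume a: "a \<in> ?J"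
        show "C1 \<le> (\<integral>w. w a * w a \<partial>G)" by (rule ord_le_eq_trans[OF Gam_diag(1)[OF a] Gcov[OF a a, symmetric]])
        show "integrable G (\<lambda>w. exp (l * w a))" "(\<integral>w. exp (l * w a) \<partial>G) \<le> exp (l\<^sup>2)" for l
          using Gmgf_int[OF a] Gmgf_le[OF a] by blast+
        show "(\<lambda>\<omega>. ?T \<omega> a) \<in> borel_measurable (iid {..<n} F)"
        proof -
          interpret k: sym_kernel F "\<lambda>x y. h x y (fst a) (snd a)" B by (rule ker[OF Jp[OF a]])
          have "(\<lambda>\<omega>. h (\<omega> i) (\<omega> j) (fst a) (snd a)) \<in> borel_measurable (iid {..<n} F)" if "i < n" "j < n" for i j
          proof -
            have "(\<lambda>\<omega>. (\<omega> i, \<omega> j)) \<in> measurable (iid {..<n} F) (F \<Otimes>\<^sub>M F)"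
              using that by (intro measurable_Pair measurable_component_singleton) auto
            from measurable_compose[OF this k.k_meas] show ?thesis by simp
          qed
          then show ?thesis unfolding Ustat_def
            by (intro borel_measurable_divide borel_measurable_times borel_measurable_diff borel_measurable_const borel_measurable_sum) auto
        qed
      next
        fix \<omega> a assume "\<omega> \<in> space (iid {..<n} F) - R" and a: "a \<in> ?J"
        then show "\<bar>?T \<omega> a - (\<Sum>i<n. ?Y (\<omega> i) a / sqrt n)\<bar> \<le> u / x"
          unfolding R_def E_def by (auto simp: not_less sample_def)
      qed (use R u3 p in \<open>auto simp: sample_def\<close>)
      have s1: "{\<omega> \<in> space (sample n F). Tbar0 p n F h \<omega> \<le> t} = {\<omega>\<in>space (iid {..<n} F). \<forall>a\<in>?J. ?T \<omega> a \<le> t}"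
        using Tset by (auto simp: sample_def)
      have s2: "{\<zeta> \<in> space (sample n G). Zbar0 p n \<zeta> \<le> t} = {\<omega>\<in>space (iid {..<n} G). \<forall>a\<in>?J. (\<Sum>i<n. \<omega> i a / sqrt n) \<le> t}"
        using Zset by (auto simp: sample_def)
      have le: "(340 * 36 + 12 / C1 * (20 + 1887 * 36)) * u + measure (iid {..<n} F) R \<le> A * u"
        using mR u0 unfolding A_def sample_def distrib_right by linarith
      show ?thesis unfolding s1 s2 unfolding sample_def using order_trans[OF main le] by (simp only: sample_def)
    qed
    have "kol_dist (sample n F) (Tbar0 p n F h) (sample n G) (Zbar0 p n) \<le> A * u"
      unfolding kol_dist_def by (intro cSUP_least bound) auto
    then show ?case using final by linarith
  qed
qed

end
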